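(* Assume the setting described in the context. Every $x\in\mathcal U_r(M):=\{x\in\mathbb R^D:d_M(x)<r\}$ has unique normal coordinates $x=y+v$, where $y=P_M(x)$ and $v\in N_yM$ with $\|v\|<r$, and in these coordinates the Euclidean volume element is $$dx=J_M(y,v)\,dv\,\mathrm{Vol}_M(dy).$$ Moreover, $\ell_y$ is linear, and hence odd, in $v$, and for all $y\in M$ and $v\in N_yM$ with $\|v\|<r$, $$e^{-[g(y+v)-g(y)]}J_M(y,v)=1+\ell_y(v)+R_y(v),\qquad |R_y(v)|\le A_M\|v\|^2 .$$
   Context: $1\le d<D$ are integers. $\|\cdot\|$ is the Euclidean norm on $\mathbb R^D$, $d_A(x):=\inf_{a\in A}\|x-a\|$. The reach $\mathrm{Reach}(M)$ is the largest $\tau\ge0$ such that every point of $\{x:d_M(x)<\tau\}$ has a unique nearest point on $M$; $P_M(x)$ denotes that nearest point. $M\subset\mathbb R^D$ is a compact, connected, $d$-dimensional $C^2$ embedded submanifold without boundary with $\mathrm{Reach}(M)\ge\tau_0>0$; $\mathrm{Vol}_M$ is its Riemannian volume; $T_yM$, $N_yM$ are its tangent and normal spaces at $y$. There are $z_0\in\mathbb R^D$, $R_0>0$ with $M\subseteq\overline B(z_0,R_0)$. Fix $0<2r<\tau_0$ and set $K:=\overline B(z_0,R_0+3r)$. $g$ is $C^2$ on a neighborhood of $K$; $G:=\sup_K\|\nabla g\|$ and $H:=\sup_K\|\nabla^2g\|_{\mathrm{op}}$ and $\sup_Kg-\inf_Kg$ are finite. Let $\mathrm{II}_y:T_yM\times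 T_yM\to N_yM$ be the second fundamental form, and for $v\in N_yM$ let the shape operator $S_{y,v}:T_yM\to T_yM$ be defined by $\langle S_{y,v}u,w\rangle:=\langle\mathrm{II}_y(u,w),v\rangle$ for $u,w\in T_yM$. For $y\in M$ and $v\in N_yM$ with $\|v\|<r$ define $$J_M(y,v):=\det(I-S_{y,v}),\qquad \ell_y(v):=-\langle\nabla g(y),v\rangle-\mathrm{tr}(S_{y,v}),$$ $$R_y(v):=e^{-[g(y+v)-g(y)]}J_M(y,v)-1-\ell_y(v).$$ Here $dv$ is Lebesgue measure on $N_yM$. Set $C_d:=4(d+1)(3/2)^d$ and $$A_M:=C_de^{Gr+\frac12Hr^2}\left(H+G^2+\frac G{\tau_0}+\frac1{\tau_0^2}\right).$$ *)

theory Defs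
  imports "HOL-Analysis.Analysis"
begin

definition C1_on :: "'a::real_normed_vector set \<Rightarrow> ('a \<Rightarrow> 'b::real_normed_vector) \<Rightarrow> bool" where
  "C1_on U f \<longleftrightarrow> (\<exists>f' :: 'a \<Rightarrow> 'a \<Rightarrow>\<^sub>L 'b.
     (\<forall>x\<in>U. (f has_derivative blinfun_apply (f' x)) (at x)) \<and> continuous_on U f')"

definition C2_on :: "'a::real_normed_vector set \<Rightarrow> ('a \<Rightarrow> 'b::real_normed_vector) \<Rightarrow> bool" where
  "C2_on U f \<longleftrightarrow> (\<exists>f' :: 'a \<Rightarrow> 'a \<Rightarrow>\<^sub>L 'b.
     (\<forall>x\<in>U. (f has_derivative blinfun_apply (f' x)) (at x)) \<and> C1_on U f')"

definition gradient :: "('a::real_inner \<Rightarrow> real) \<Rightarrow> 'a \<Rightarrow> 'a" where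
  "gradient g x = (THE D. GDERIV g x :> D)"

definition hessian :: "('a::real_inner \<Rightarrow> real) \<Rightarrow> 'a \<Rightarrow> 'a \<Rightarrow> 'a" where
  "hessian g x = frechet_derivative (gradient g) (at x)"

text \<open>Determinant, trace and Lebesgue measure of a subspace are computed in an orthonormal
  basis; none of them depends on which one is chosen.\<close>

definition onb :: "'a::euclidean_space set \<Rightarrow> 'a set" where
  "onb V = (SOME B. B \<subseteq> V \<and> pairwise orthogonal B \<and> (\<forall>b\<in>B. norm b = 1) \<and> span B = V)"

text \<open>Leibniz formula, as for the library's \<^const>\<open>det\<close>, for a matrix with rows and columns
  indexed by a finite set.\<close>

definition det_indexed :: "'i set \<Rightarrow> ('i \<Rightarrow> 'i \<Rightarrow> real) \<Rightarrow> real" where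
  "det_indexed B A = (\<Sum>p | p permutes B. of_int (sign p) * (\<Prod>b\<in>B. A b (p b)))"

definition det_on :: "'a::euclidean_space set \<Rightarrow> ('a \<Rightarrow> 'a) \<Rightarrow> real" where
  "det_on V f = det_indexed (onb V) (\<lambda>b c. f b \<bullet> c)"

definition trace_on :: "'a::euclidean_space set \<Rightarrow> ('a \<Rightarrow> 'a) \<Rightarrow> real" where
  "trace_on V f = (\<Sum>b\<in>onb V. f b \<bullet> b)"

text \<open>The determinant of \<open>f\<^sup>T f\<close> for a linear map \<open>f\<close> defined on \<open>V\<close>.\<close>

definition gram_det :: "'a::euclidean_space set \<Rightarrow> ('a \<Rightarrow> 'b::real_inner) \<Rightarrow> real" where
  "gram_det V f = det_indexed (onb V) (\<lambda>b c. f b \<bullet> f c)"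

text \<open>Lebesgue measure of a subspace \<open>V\<close>, as a Borel measure on the ambient space concentrated
  on \<open>V\<close>; compare the library's definition of \<^const>\<open>lborel\<close>.\<close>

definition lborel_sub :: "'a::euclidean_space set \<Rightarrow> 'a measure" where
  "lborel_sub V = distr (\<Pi>\<^sub>M b\<in>onb V. lborel) borel (\<lambda>f. \<Sum>b\<in>onb V. f b *\<^sub>R b)"

text \<open>\<open>\<psi>\<close> is (the inverse of) a slice chart: a C2 diffeomorphism between open sets of the ambient
  space that carries the part of the linear subspace \<open>E\<close> in its domain onto the part of \<open>M\<close> in
  its range. A subspace \<open>E\<close> of dimension \<open>d\<close> plays the role of the model space of
  dimension \<open>d\<close>, so that \<open>d\<close> can be a number instead of a type.\<close>

definition slice_chart ::
  "'a::euclidean_space set \<Rightarrow> 'a set \<Rightarrow> 'a set \<Rightarrow> ('a \<Rightarrow> 'a) \<Rightarrow> bool" where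
  "slice_chart M E W \<psi> \<longleftrightarrow>
     subspace E \<and> open W \<and> open (\<psi> ` W) \<and> inj_on \<psi> W \<and>
     C2_on W \<psi> \<and> C2_on (\<psi> ` W) (inv_into W \<psi>) \<and>
     \<psi> ` (W \<inter> E) = \<psi> ` W \<inter> M"

definition C2_submanifold :: "nat \<Rightarrow> 'a::euclidean_space set \<Rightarrow> bool" where
  "C2_submanifold d M \<longleftrightarrow>
     (\<forall>p\<in>M. \<exists>E W \<psi>. slice_chart M E W \<psi> \<and> dim E = d \<and> p \<in> \<psi> ` W)"

definition tangent_space_at :: "'a::euclidean_space set \<Rightarrow> 'a \<Rightarrow> 'a set" where
  "tangent_space_at M y = {v. \<exists>\<gamma> \<epsilon>. \<epsilon> > 0 \<and> \<gamma> C1_differentiable_on {-\<epsilon><..<\<epsilon>} \<and>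
     \<gamma> ` {-\<epsilon><..<\<epsilon>} \<subseteq> M \<and> \<gamma> 0 = y \<and> (\<gamma> has_vector_derivative v) (at 0)}"

definition normal_space_at :: "'a::euclidean_space set \<Rightarrow> 'a \<Rightarrow> 'a set" where
  "normal_space_at M y = orthogonal_comp (tangent_space_at M y)"

text \<open>The Riemannian volume, a measure on \<open>M\<close> with its Borel sets, is determined by its expression
  \<open>sqrt (det (D\<psi>\<^sup>T D\<psi>)) du\<close> in charts.\<close>

definition riemannian_volume :: "'a::euclidean_space set \<Rightarrow> 'a measure" where
  "riemannian_volume M = (THE \<mu>. space \<mu> = M \<and> sets \<mu> = sets (restrict_space borel M) \<and>
     (\<forall>E W \<psi> A. slice_chart M E W \<psi> \<and> A \<in> sets borel \<and> A \<subseteq> W \<inter> E \<longrightarrow>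
        emeasure \<mu> (\<psi> ` A) =
          (\<integral>\<^sup>+u\<in>A. ennreal (sqrt (gram_det E (frechet_derivative \<psi> (at u)))) \<partial>lborel_sub E)))"

text \<open>The normal component of the ambient derivative in direction \<open>u\<close> of a C1 vector field \<open>X\<close>
  that is tangent to \<open>M\<close> and extends \<open>w\<close>; it does not depend on the choice of \<open>X\<close>.\<close>

definition second_fundamental_form :: "'a::euclidean_space set \<Rightarrow> 'a \<Rightarrow> 'a \<Rightarrow> 'a \<Rightarrow> 'a" where
  "second_fundamental_form M y u w = (THE z. z \<in> normal_space_at M y \<and>
     (\<exists>U X. open U \<and> y \<in> U \<and> C1_on U X \<and> (\<forall>p\<in>M \<inter> U. X p \<in> tangent_space_at M p) \<and> X y = w \<and>
        frechet_derivative X (at y) u - z \<in> tangent_space_at M y))"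

definition shape_operator :: "'a::euclidean_space set \<Rightarrow> 'a \<Rightarrow> 'a \<Rightarrow> 'a \<Rightarrow> 'a" where
  "shape_operator M y v u = (THE s. s \<in> tangent_space_at M y \<and>
     (\<forall>w\<in>tangent_space_at M y. s \<bullet> w = second_fundamental_form M y u w \<bullet> v))"

text \<open>The set below is an interval containing its supremum unless it is unbounded, in which case
  the reach is infinite.\<close>

definition reach :: "'a::euclidean_space set \<Rightarrow> ereal" where
  "reach M = Sup {ereal \<tau> | \<tau>. \<tau> \<ge> 0 \<and>
     (\<forall>x. infdist x M < \<tau> \<longrightarrow> (\<exists>!a. a \<in> M \<and> dist x a = infdist x M))}"

definition tube :: "'a::euclidean_space set \<Rightarrow> real \<Rightarrow> 'a set" where
  "tube M r = {x. infdist x M < r}"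

definition normal_disc_bundle :: "'a::euclidean_space set \<Rightarrow> real \<Rightarrow> ('a \<times> 'a) set" where
  "normal_disc_bundle M r = {(y, v). y \<in> M \<and> v \<in> normal_space_at M y \<and> norm v < r}"

definition normal_jacobian :: "'a::euclidean_space set \<Rightarrow> 'a \<Rightarrow> 'a \<Rightarrow> real" where
  "normal_jacobian M y v = det_on (tangent_space_at M y) (\<lambda>u. u - shape_operator M y v u)"

definition linear_part :: "'a::euclidean_space set \<Rightarrow> ('a \<Rightarrow> real) \<Rightarrow> 'a \<Rightarrow> 'a \<Rightarrow> real" where
  "linear_part M g y v =
     - (gradient g y \<bullet> v) - trace_on (tangent_space_at M y) (shape_operator M y v)"

definition remainder :: "'a::euclidean_space set \<Rightarrow> ('a \<Rightarrow> real) \<Rightarrow> 'a \<Rightarrow> 'a \<Rightarrow> real" where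
  "remainder M g y v =
     exp (- (g (y + v) - g y)) * normal_jacobian M y v - 1 - linear_part M g y v"

definition const_C :: "nat \<Rightarrow> real" where
  "const_C d = 4 * (real d + 1) * (3/2) ^ d"

definition const_A :: "nat \<Rightarrow> real \<Rightarrow> real \<Rightarrow> real \<Rightarrow> real \<Rightarrow> real" where
  "const_A d G H r \<tau>\<^sub>0 =
     const_C d * exp (G * r + H * r\<^sup>2 / 2) * (H + G\<^sup>2 + G / \<tau>\<^sub>0 + 1 / \<tau>\<^sub>0\<^sup>2)"

end

theory Submission
  imports Defs
begin

text \<open>Federer: if \<open>n\<close> is a unit normal at \<open>y\<close>, then \<open>y\<close> is the nearest point to \<open>y + t n\<close> for all
  \<open>t < \<tau>\<^sub>0\<close>. Indeed the distance \<open>d\<^sub>M\<close> grows with slope one in some direction at every point outside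
  \<open>M\<close> with a unique nearest point, hence by \<open>t\<close> on a suitable point of each ball of radius \<open>t\<close>, and equality
  in the triangle inequality puts that point on the normal ray. So \<open>n \<bullet> (z - y) \<le> \<bar>z - y\<bar>\<^sup>2 / (2 \<tau>\<^sub>0)\<close> for
  \<open>z \<in> M\<close>; this gives the normal coordinates and, to second order at \<open>y\<close>, the bound \<open>\<bar>v\<bar> / \<tau>\<^sub>0\<close> on the eigenvalues
  of the shape operator.

  In a slice chart \<open>\<psi>\<close> over \<open>E\<close> the map \<open>u + b \<mapsto> \<psi> u + \<nu> u b\<close>, with \<open>\<nu> u\<close> the transposed inverse of
  \<open>D\<psi>\<close>, parametrizes the tube. Relative to tangent and normal spaces its derivative is block triangular with
  diagonal \<open>(I - S) D\<psi>\<close> and \<open>\<nu> u\<close>, so the change of variables formula in the ambient space, Fubini and a linear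
  change of variables in the normal space give the tube formula over the chart. Applied to functions that are constant
  on the normal fibres it also shows that the Riemannian volume exists: it is the push-forward, under
  the nearest point projection, of Lebesgue measure on the tube divided by the mass of the fibres.

  The remainder is estimated from \<open>det (I - S) = \<Prod>(1 - \<lambda>\<^sub>i)\<close> and Taylor expansions of \<open>g\<close> and \<open>exp\<close>.\<close>

section \<open>The scalar remainder estimate\<close>

text \<open>Several notions are defined by choice: \<open>onb\<close> is an arbitrary orthonormal
  basis, and \<open>second_fundamental_form\<close>, \<open>shape_operator\<close> and
  \<open>riemannian_volume\<close> are definite descriptions. Determinants and integrals on a
  subspace are therefore moved to the ambient space, extended by the identity or an isometry in the
  complementary directions, where matrix determinants and \<open>lborel\<close> are available. For
  the descriptions existence and uniqueness have to be proved. For the volume, gluing chart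
  densities would mean comparing overlapping charts; the tube avoids this, because the Lebesgue
  integral over the part of the tube above a set does not depend on a chart, and the tube formula
  over one chart does not mention the Riemannian volume. For a C2 submanifold the normal frame, and
  hence the parametrization of the tube, is only C1, so the change of variables has to be available
  for differentiable injective maps. Normal coordinates and positivity of the Jacobian hold for
  radii below the reach bound; the remainder estimate works with
  \<open>norm v / \<tau>\<^sub>0 \<le> 1/2\<close>, which is the origin of the base 3/2 in
  \<open>const_C\<close>.\<close>

lemma power_one_plus_bound:
  fixes e :: real
  assumes "0 \<le> e" "e \<le> 1/2"
  shows "(1 + e) ^ d - 1 \<le> 2 * e * ((3/2) ^ d - 1)"
proof (induction d)
  case (Suc d)
  have "(1 + e) ^ Suc d - 1 = (1 + e) * ((1 + e) ^ d - 1) + e" by (simp add: algebra_simps)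
  also have "\<dots> \<le> (3/2) * (2 * e * ((3/2) ^ d - 1)) + e"
    using Suc assms by (intro add_right_mono mult_mono) auto
  also have "\<dots> = 2 * e * ((3/2) ^ Suc d - 1)" by (simp add: algebra_simps)
  finally show ?case .
qed simp

text \<open>As polynomials in \<open>e\<close>, \<open>((1 + e) ^ d - 1) / e\<close> and
  \<open>((1 + e) ^ d - 1 - d * e) / e\<^sup>2\<close> have nonnegative coefficients, so for
  \<open>e\<close> up to 1/2 they are largest at 1/2. That gives the factors \<open>2 * e\<close>
  and \<open>4 * e\<^sup>2\<close> in the preceding bound and here; the inductions avoid the
  division.\<close>

lemma power_one_plus_bound2:
  fixes e :: real
  assumes "0 \<le> e" "e \<le> 1/2"
  shows "(1 + e) ^ d - 1 - d * e \<le> 4 * e\<^sup>2 * ((3/2) ^ d - 1 - d / 2)"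
proof (induction d)
  case (Suc d)
  have "(1 + e) ^ Suc d - 1 - Suc d * e = ((1 + e) ^ d - 1 - d * e) + e * ((1 + e) ^ d - 1)"
    by (simp add: algebra_simps)
  also have "\<dots> \<le> 4 * e\<^sup>2 * ((3/2) ^ d - 1 - d / 2) + e * (2 * e * ((3/2) ^ d - 1))"
    by (rule add_mono[OF Suc mult_left_mono[OF power_one_plus_bound[OF assms] assms(1)]])
  also have "\<dots> = 4 * e\<^sup>2 * ((3/2) ^ Suc d - 1 - Suc d / 2)" by (simp add: algebra_simps power2_eq_square)
  finally show ?case .
qed simp

lemma exp_quadratic_remainder: "\<bar>exp a - 1 - a\<bar> \<le> a\<^sup>2 / 2 * exp \<bar>a\<bar>" for a :: real
proof -
  obtain t where t: "\<bar>t\<bar> \<le> \<bar>a\<bar>" "exp a = (\<Sum>m<2. a ^ m / fact m) + exp t / fact 2 * a ^ 2"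
    using Maclaurin_exp_le[of a 2] by blast
  then have "exp a - 1 - a = a\<^sup>2 / 2 * exp t" by (simp add: numeral_2_eq_2)
  moreover have "0 \<le> a\<^sup>2 / 2 * exp t" by simp
  ultimately have "\<bar>exp a - 1 - a\<bar> = a\<^sup>2 / 2 * exp t" by (metis abs_of_nonneg)
  also have "\<dots> \<le> a\<^sup>2 / 2 * exp \<bar>a\<bar>" using t(1) by (intro mult_left_mono) auto
  finally show ?thesis .
qed

text \<open>In the application \<open>x\<close> is the length of the normal vector, \<open>a\<close>
  the negative increment of \<open>g\<close>, \<open>l\<close> its gradient term, \<open>J\<close>
  the Jacobian and \<open>t\<close> the trace. Both linear approximations are accurate to second
  order, so expanding the product leaves only quadratic errors.\<close>

lemma remainder_estimate:
  fixes a :: real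
  assumes e: "0 \<le> x" "x / \<tau> \<le> 1/2" "\<tau> > 0" "x \<le> r" and GH: "G \<ge> 0" "H \<ge> 0"
    and a: "\<bar>a\<bar> \<le> G * x" and lin: "\<bar>a + l\<bar> \<le> H * x\<^sup>2 / 2"
    and J: "\<bar>J - 1\<bar> \<le> (1 + x / \<tau>) ^ d - 1" "\<bar>J - 1 + t\<bar> \<le> (1 + x / \<tau>) ^ d - 1 - d * (x / \<tau>)"
  shows "\<bar>exp a * J - 1 - (- l - t)\<bar> \<le> const_A d G H r \<tau> * x\<^sup>2"
proof -
  define q :: real where "q = (3/2) ^ d"
  define X where "X = exp (G * r + H * r\<^sup>2 / 2)"
  have q: "q \<ge> 1" by (simp add: q_def)
  have X: "X \<ge> 1" using GH e by (simp add: X_def)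
  have xt: "0 \<le> x / \<tau>" using e by simp
  have ea: "exp \<bar>a\<bar> \<le> X"
  proof -
    have "G * x \<le> G * r" using GH e by (intro mult_left_mono) auto
    then show ?thesis using a GH by (simp add: X_def add_increasing2 order_trans[of "\<bar>a\<bar>" "G * x"])
  qed
  have J1: "\<bar>J - 1\<bar> \<le> 2 * (x / \<tau>) * (q - 1)"
    using J(1) power_one_plus_bound[OF xt e(2), of d] by (simp add: q_def)
  have J1': "\<bar>J - 1\<bar> \<le> 2 * (x / \<tau>) * q"
    using J1 xt mult_left_mono[of "q - 1" q "2 * (x / \<tau>)"] by linarith
  have "2 * (x / \<tau>) * (q - 1) \<le> 1 * (q - 1)"
    using e(2) q by (intro mult_right_mono) linarith+
  then have "\<bar>J - 1\<bar> \<le> q - 1" using J1 by simp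
  then have Jq: "\<bar>J\<bar> \<le> q" by linarith
  have J2: "\<bar>J - 1 + t\<bar> \<le> 4 * (x / \<tau>)\<^sup>2 * q"
  proof -
    have "4 * (x / \<tau>)\<^sup>2 * (q - 1 - d / 2) \<le> 4 * (x / \<tau>)\<^sup>2 * q" by (intro mult_left_mono) auto
    then show ?thesis using J(2) power_one_plus_bound2[OF xt e(2), of d] by (simp add: q_def)
  qed
  have a2: "a\<^sup>2 \<le> (G * x)\<^sup>2" using a by (simp add: abs_le_square_iff[symmetric])
  have T1: "\<bar>(exp a - 1 - a) * J\<bar> \<le> ((G * x)\<^sup>2 / 2 * X) * q"
    unfolding abs_mult using exp_quadratic_remainder[of a] a2 ea Jq X
    by (intro mult_mono order_trans[OF exp_quadratic_remainder]) auto
  have T2: "\<bar>a * (J - 1)\<bar> \<le> (G * x) * (2 * (x / \<tau>) * q)"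
    unfolding abs_mult using a J1' GH e by (intro mult_mono) auto
  \<comment> \<open>Each of the four summands is of second order: the exponential remainder, a
    product of two first-order errors, the Taylor remainder of \<open>g\<close>, and the
    second-order part of the determinant.\<close>
  have "exp a * J - 1 - (- l - t) = (exp a - 1 - a) * J + a * (J - 1) + (a + l) + (J - 1 + t)"
    by (simp add: algebra_simps)
  then have "\<bar>exp a * J - 1 - (- l - t)\<bar>
      \<le> ((G * x)\<^sup>2 / 2 * X) * q + (G * x) * (2 * (x / \<tau>) * q) + H * x\<^sup>2 / 2 + 4 * (x / \<tau>)\<^sup>2 * q"
    using T1 T2 lin J2 by linarith
  also have "\<dots> = (G\<^sup>2 / 2 * (X * q) + 2 * (G / \<tau>) * q + H / 2 + 4 * (1 / \<tau>\<^sup>2) * q) * x\<^sup>2"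
    by (simp add: power2_eq_square field_simps)
  also have "\<dots> \<le> (4 * (real d + 1) * q * X * (H + G\<^sup>2 + G / \<tau> + 1 / \<tau>\<^sup>2)) * x\<^sup>2"
  proof (intro mult_right_mono)
    define Y where "Y = 4 * (real d + 1) * q * X"
    have Xq: "1 \<le> X * q" "q \<le> X * q" using mult_mono[of 1 X 1 q] mult_right_mono[of 1 X q] X q by auto
    have "4 * (X * q) \<le> (4 * (real d + 1)) * (X * q)" using Xq by (intro mult_right_mono) auto
    then have "4 * (X * q) \<le> Y" by (simp add: Y_def mult_ac)
    \<comment> \<open>Since \<open>X\<close> and \<open>q\<close> are at least 1, the single number
      \<open>Y\<close> dominates all four numerical coefficients, and a common constant can be
      factored out.\<close>
    then have Y: "X * q / 2 \<le> Y" "2 * q \<le> Y" "1 / 2 \<le> Y" "4 * q \<le> Y" using Xq q by linarith+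
    have "G\<^sup>2 / 2 * (X * q) \<le> G\<^sup>2 * Y" "2 * (G / \<tau>) * q \<le> G / \<tau> * Y" "H / 2 \<le> H * Y" "4 * (1 / \<tau>\<^sup>2) * q \<le> 1 / \<tau>\<^sup>2 * Y"
    proof -
      have "G\<^sup>2 * (X * q / 2) \<le> G\<^sup>2 * Y" by (intro mult_left_mono Y) auto
      then show "G\<^sup>2 / 2 * (X * q) \<le> G\<^sup>2 * Y" by simp
      have "G / \<tau> * (2 * q) \<le> G / \<tau> * Y" using GH e by (intro mult_left_mono Y) auto
      then show "2 * (G / \<tau>) * q \<le> G / \<tau> * Y" by (simp add: mult_ac)
      have "H * (1 / 2) \<le> H * Y" using GH by (intro mult_left_mono Y) auto
      then show "H / 2 \<le> H * Y" by simp
      have "1 / \<tau>\<^sup>2 * (4 * q) \<le> 1 / \<tau>\<^sup>2 * Y" by (intro mult_left_mono Y) auto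
      then show "4 * (1 / \<tau>\<^sup>2) * q \<le> 1 / \<tau>\<^sup>2 * Y" by (simp add: mult_ac)
    qed
    then have "G\<^sup>2 / 2 * (X * q) + 2 * (G / \<tau>) * q + H / 2 + 4 * (1 / \<tau>\<^sup>2) * q
        \<le> G\<^sup>2 * Y + G / \<tau> * Y + H * Y + 1 / \<tau>\<^sup>2 * Y" by linarith
    also have "\<dots> = Y * (H + G\<^sup>2 + G / \<tau> + 1 / \<tau>\<^sup>2)" by (simp add: distrib_left mult.commute)
    finally show "G\<^sup>2 / 2 * (X * q) + 2 * (G / \<tau>) * q + H / 2 + 4 * (1 / \<tau>\<^sup>2) * q
        \<le> 4 * (real d + 1) * q * X * (H + G\<^sup>2 + G / \<tau> + 1 / \<tau>\<^sup>2)" by (simp add: Y_def)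
  qed simp
  finally show ?thesis by (simp add: const_A_def const_C_def q_def X_def)
qed

section \<open>Determinants in orthonormal bases\<close>

text \<open>\<open>onb\<close> picks one basis satisfying this predicate. Keeping the predicate
  separate allows bases adapted to the situation, such as one containing an eigenvector or the union
  of bases of a subspace and its complement.\<close>

definition is_onb :: "'a::euclidean_space set \<Rightarrow> 'a set \<Rightarrow> bool" where
  "is_onb V B \<longleftrightarrow> B \<subseteq> V \<and> pairwise orthogonal B \<and> (\<forall>b\<in>B. norm b = 1) \<and> span B = V"

lemma is_onb_exists:
  fixes V :: "'a::euclidean_space set"
  assumes "subspace V"
  shows "\<exists>B. is_onb V B"
proof -
  obtain B where "B \<subseteq> V" "pairwise orthogonal B" "\<And>x. x \<in> B \<Longrightarrow> norm x = 1" "span B = V"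
    using orthonormal_basis_subspace[OF assms] by metis
  then show ?thesis unfolding is_onb_def by blast
qed

lemma is_onb_onb:
  fixes V :: "'a::euclidean_space set"
  assumes "subspace V"
  shows "is_onb V (onb V)"
  using someI_ex[OF is_onb_exists[OF assms]] unfolding onb_def is_onb_def .

context
  fixes V B :: "'a::euclidean_space set"
  assumes onb: "is_onb V B"
begin

lemma is_onb_subspace: "subspace V"
  using onb subspace_span unfolding is_onb_def by metis

lemma is_onb_mem: "b \<in> B \<Longrightarrow> b \<in> V"
  using onb by (auto simp: is_onb_def)

lemma is_onb_indep: "independent B"
  using onb pairwise_orthogonal_independent[of B] by (force simp: is_onb_def)

lemma is_onb_finite: "finite B"
  using is_onb_indep independent_imp_finite by blast

lemma is_onb_card: "card B = dim V"
  using is_onb_indep onb by (metis dim_span_eq_card_independent is_onb_def)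

lemma is_onb_inner: "b \<in> B \<Longrightarrow> c \<in> B \<Longrightarrow> b \<bullet> c = (if b = c then 1 else 0)"
  using onb by (auto simp: is_onb_def pairwise_def orthogonal_def dot_square_norm)

lemma is_onb_coeff:
  assumes "c \<in> B"
  shows "(\<Sum>b\<in>B. f b *\<^sub>R b) \<bullet> c = f c"
proof -
  have "(\<Sum>b\<in>B. f b *\<^sub>R b) \<bullet> c = (\<Sum>b\<in>B. if b = c then f b else 0)"
    unfolding inner_sum_left by (rule sum.cong) (auto simp: is_onb_inner assms)
  then show ?thesis using assms is_onb_finite by (simp add: sum.delta)
qed

lemma is_onb_expand:
  assumes "x \<in> V"
  shows "(\<Sum>b\<in>B. (x \<bullet> b) *\<^sub>R b) = x"
proof -
  have "x \<in> span B" using assms onb by (simp add: is_onb_def)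
  then obtain f where f: "x = (\<Sum>b\<in>B. f b *\<^sub>R b)"
    unfolding span_finite[OF is_onb_finite] by auto
  show ?thesis using is_onb_coeff[of _ f] f by (auto intro!: sum.cong)
qed

lemma is_onb_parseval:
  assumes "x \<in> V"
  shows "x \<bullet> y = (\<Sum>b\<in>B. (x \<bullet> b) * (b \<bullet> y))"
  by (subst is_onb_expand[OF assms, symmetric]) (simp add: inner_sum_left)

lemma is_onb_orthogonal_comp: "x \<in> orthogonal_comp V \<longleftrightarrow> (\<forall>b\<in>B. b \<bullet> x = 0)"
proof
  assume R: "\<forall>b\<in>B. b \<bullet> x = 0"
  have "v \<bullet> x = 0" if "v \<in> V" for v
    using is_onb_parseval[OF that, of x] R by simp
  then show "x \<in> orthogonal_comp V" by (simp add: orthogonal_comp_def orthogonal_def)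
qed (use is_onb_mem in \<open>auto simp: orthogonal_comp_def orthogonal_def\<close>)

end

lemma is_onb_Un:
  fixes E :: "'a::euclidean_space set"
  assumes B: "is_onb E B" and C: "is_onb (orthogonal_comp E) C"
  shows "is_onb UNIV (B \<union> C)" "B \<inter> C = {}"
proof -
  have orth: "b \<bullet> c = 0" "c \<bullet> b = 0" if "b \<in> B" "c \<in> C" for b c
    using is_onb_mem[OF B that(1)] is_onb_mem[OF C that(2)]
    by (auto simp: orthogonal_comp_def orthogonal_def inner_commute)
  show disj: "B \<inter> C = {}"
    using orth B by (fastforce simp: is_onb_def)
  have sub: "subspace E" by (rule is_onb_subspace[OF B])
  have "x \<in> span (B \<union> C)" for x
  proof -
    define p where "p = (\<Sum>b\<in>B. (x \<bullet> b) *\<^sub>R b)"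
    have pB: "p \<in> span (B \<union> C)"
      unfolding p_def by (intro span_sum span_scale span_base) auto
    have "b \<bullet> (x - p) = 0" if "b \<in> B" for b
      using is_onb_coeff[OF B that, of "\<lambda>b. x \<bullet> b"] by (simp add: p_def inner_diff_right inner_commute)
    then have "x - p \<in> orthogonal_comp E"
      using is_onb_orthogonal_comp[OF B] by blast
    then have "x - p \<in> span C" using C by (simp add: is_onb_def)
    then have "x - p \<in> span (B \<union> C)" using span_mono[of C "B \<union> C"] by auto
    then show ?thesis using span_add[OF pB] by fastforce
  qed
  then show "is_onb UNIV (B \<union> C)"
    using B C orth unfolding is_onb_def pairwise_def
    by (auto simp: orthogonal_def)
qed

text \<open>Orthogonal projection written in coordinates, so that it is linear even without knowing
  that \<open>V\<close> is a subspace.\<close>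

definition oproj :: "'a::euclidean_space set \<Rightarrow> 'a \<Rightarrow> 'a" where
  "oproj V x = (\<Sum>b\<in>onb V. (x \<bullet> b) *\<^sub>R b)"

lemma linear_oproj: "linear (oproj V)"
  unfolding oproj_def[abs_def]
  by (rule linearI) (auto simp: inner_add_left scaleR_add_left sum.distrib scaleR_sum_right)

context
  fixes V :: "'a::euclidean_space set"
  assumes V: "subspace V"
begin

lemma oproj_mem: "oproj V x \<in> V"
  unfolding oproj_def using is_onb_mem[OF is_onb_onb[OF V]] V
  by (intro subspace_sum subspace_scale) auto

lemma oproj_id: "x \<in> V \<Longrightarrow> oproj V x = x"
  unfolding oproj_def using is_onb_expand[OF is_onb_onb[OF V]] .

lemma oproj_perp: "x \<in> orthogonal_comp V \<Longrightarrow> oproj V x = 0"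
  unfolding oproj_def using is_onb_orthogonal_comp[OF is_onb_onb[OF V], of x]
  by (intro sum.neutral) (auto simp: inner_commute)

lemma diff_oproj_perp: "x - oproj V x \<in> orthogonal_comp V"
proof -
  have "b \<bullet> (x - oproj V x) = 0" if "b \<in> onb V" for b
    using is_onb_coeff[OF is_onb_onb[OF V] that, of "\<lambda>b. x \<bullet> b"]
    by (simp add: oproj_def inner_diff_right inner_commute)
  then show ?thesis using is_onb_orthogonal_comp[OF is_onb_onb[OF V]] by blast
qed

lemma perp_perp: "orthogonal_comp (orthogonal_comp V) = V"
  using orthogonal_comp_self V by blast

lemma inner_perp: "x \<in> V \<Longrightarrow> y \<in> orthogonal_comp V \<Longrightarrow> x \<bullet> y = 0"
  by (simp add: orthogonal_comp_def orthogonal_def)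

lemma oproj_add: "x \<in> V \<Longrightarrow> y \<in> orthogonal_comp V \<Longrightarrow> oproj V (x + y) = x"
  using linear_add[OF linear_oproj[of V]] oproj_id oproj_perp by simp

lemma oproj_inner: "y \<in> V \<Longrightarrow> oproj V x \<bullet> y = x \<bullet> y"
  using inner_perp[of y "x - oproj V x"] diff_oproj_perp by (simp add: inner_diff_right inner_commute)

end

text \<open>Expansion along a row with a single entry: a permutation that moves \<open>u\<close>
  sends it into \<open>B\<close> and contributes the factor \<open>M u (p u) = 0\<close>.\<close>

lemma det_indexed_insert:
  assumes fin: "finite B" and u: "u \<notin> B" and row: "\<And>c. c \<in> B \<Longrightarrow> M u c = 0"
  shows "det_indexed (insert u B) M = M u u * det_indexed B M"
proof -
  have sub: "{p. p permutes B} \<subseteq> {p. p permutes insert u B}"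
    by (auto intro: permutes_subset)
  have "det_indexed (insert u B) M
      = (\<Sum>p | p permutes B. of_int (sign p) * (\<Prod>b\<in>insert u B. M b (p b)))"
    unfolding det_indexed_def
  proof (rule sum.mono_neutral_right[OF _ sub])
    show "\<forall>p\<in>{p. p permutes insert u B} - {p. p permutes B}.
        of_int (sign p) * (\<Prod>b\<in>insert u B. M b (p b)) = 0"
    proof
      fix p assume p: "p \<in> {p. p permutes insert u B} - {p. p permutes B}"
      have "p u \<noteq> u"
      proof
        assume "p u = u"
        then have "p permutes B"
          using p u by (auto intro: permutes_superset)
        then show False using p by simp
      qed
      then have "p u \<in> B" using p permutes_in_image[of p "insert u B" u] by auto
      then show "of_int (sign p) * (\<Prod>b\<in>insert u B. M b (p b)) = 0"
        using row fin u by simp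
    qed
  qed (use fin in \<open>simp add: finite_permutations\<close>)
  also have "\<dots> = (\<Sum>p | p permutes B. M u u * (of_int (sign p) * (\<Prod>b\<in>B. M b (p b))))"
    using fin u by (intro sum.cong) (auto simp: permutes_not_in)
  finally show ?thesis by (simp add: det_indexed_def sum_distrib_left)
qed

text \<open>Expanding successively along the unit rows of \<open>C\<close> removes them. This is how
  the determinant on a subspace is found inside a determinant on the ambient space.\<close>

lemma det_indexed_Un_identity:
  assumes fin: "finite C" "finite B" and disj: "B \<inter> C = {}"
    and row: "\<And>b c. b \<in> C \<Longrightarrow> c \<in> B \<union> C \<Longrightarrow> M b c = (if b = c then 1 else 0)"
  shows "det_indexed (B \<union> C) M = det_indexed B M"
  using fin(1) disj row
proof (induction C rule: finite_induct)
  case (insert u C)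
  have "det_indexed (insert u (B \<union> C)) M = M u u * det_indexed (B \<union> C) M"
    using insert fin(2) by (intro det_indexed_insert) auto
  moreover have "det_indexed (B \<union> C) M = det_indexed B M"
    using insert.prems by (intro insert.IH) auto
  ultimately show ?case using insert.prems(2)[of u u] by simp
qed simp

section \<open>Basis changes and comparison with matrix determinants\<close>

lemma det_indexed_cong:
  assumes "\<And>b c. b \<in> B \<Longrightarrow> c \<in> B \<Longrightarrow> M b c = N b c"
  shows "det_indexed B M = det_indexed B N"
  unfolding det_indexed_def
  by (intro sum.cong refl arg_cong2[where f="(*)"] prod.cong) (auto simp: assms permutes_in_image)

text \<open>Rows and columns are relabelled together, so the permutations are conjugated by
  \<open>e\<close>, which preserves signs.\<close>

lemma det_indexed_reindex:
  assumes e: "bij_betw e A B" and fin: "finite A"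
  shows "det_indexed B M = det_indexed A (\<lambda>i j. M (e i) (e j))"
proof -
  have inj: "inj_on e A" and B: "B = e ` A" using e by (auto simp: bij_betw_def)
  have bij: "bij_betw (map_permutation A e) {p. p permutes A} {p. p permutes B}"
  proof (rule bij_betwI')
    fix p q assume p: "p \<in> {p. p permutes A}" and q: "q \<in> {p. p permutes A}"
    have val: "map_permutation A e r (e i) = e (r i)" if "r permutes A" "i \<in> A" for r i
      using that inj by (simp add: map_permutation_def restrict_id_def)
    show "(map_permutation A e p = map_permutation A e q) = (p = q)"
    proof
      assume eq: "map_permutation A e p = map_permutation A e q"
      show "p = q"
      proof
        fix i show "p i = q i"
        proof (cases "i \<in> A")
          case True
          have "e (p i) = e (q i)" using val[of p i] val[of q i] p q True eq by simp
          then show ?thesis using inj p q True by (auto simp: inj_on_def permutes_in_image)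
        qed (use p q in \<open>auto simp: permutes_not_in\<close>)
      qed
    qed simp
  next
    fix p assume "p \<in> {p. p permutes A}"
    then show "map_permutation A e p \<in> {p. p permutes B}"
      using map_permutation_permutes[OF e] by simp
  next
    fix q assume q: "q \<in> {p. p permutes B}"
    define p where "p = map_permutation B (inv_into A e) q"
    have e': "bij_betw (inv_into A e) B A" using e by (rule bij_betw_inv_into)
    have "map_permutation A e p = map_permutation B (e \<circ> inv_into A e) q"
      unfolding p_def using q e' inj by (intro map_permutation_compose) auto
    also have "\<dots> = map_permutation B id q"
      using q unfolding B by (intro map_permutation_cong_strong) (auto simp: f_inv_into_f permutes_in_image inj_on_def)
    also have "\<dots> = q" using q by simp
    finally show "\<exists>p\<in>{p. p permutes A}. q = map_permutation A e p"
      using map_permutation_permutes[OF e'] q unfolding p_def by fastforce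
  qed
  have "det_indexed B M = (\<Sum>p | p permutes A. of_int (sign (map_permutation A e p)) *
      (\<Prod>b\<in>B. M b (map_permutation A e p b)))"
    unfolding det_indexed_def by (rule sum.reindex_bij_betw[OF bij, symmetric])
  also have "\<dots> = (\<Sum>p | p permutes A. of_int (sign p) * (\<Prod>i\<in>A. M (e i) (e (p i))))"
  proof (rule sum.cong[OF refl])
    fix p assume p: "p \<in> {p. p permutes A}"
    have "(\<Prod>b\<in>B. M b (map_permutation A e p b)) = (\<Prod>i\<in>A. M (e i) (map_permutation A e p (e i)))"
      unfolding B using inj by (simp add: prod.reindex)
    also have "\<dots> = (\<Prod>i\<in>A. M (e i) (e (p i)))"
      using inj by (intro prod.cong) (auto simp: map_permutation_def restrict_id_def)
    finally show "of_int (sign (map_permutation A e p)) * (\<Prod>b\<in>B. M b (map_permutation A e p b))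
        = of_int (sign p) * (\<Prod>i\<in>A. M (e i) (e (p i)))"
      using sign_map_permutation[OF inj _ fin, of p] p by simp
  qed
  finally show ?thesis by (simp add: det_indexed_def)
qed

text \<open>Realizes a basis indexed by its own elements as the orthogonal image of the standard
  basis, the form in which matrix determinants and Lebesgue measure can be transported.\<close>

lemma orthonormal_matrix_exists:
  fixes U :: "(real^'n) set"
  assumes U: "is_onb UNIV U"
  obtains Q :: "real^'n \<Rightarrow> real^'n" where "orthogonal_transformation Q"
    "bij_betw (\<lambda>i. Q (axis i 1)) UNIV U"
proof -
  have "card U = CARD('n)" using is_onb_card[OF U] by simp
  then obtain e :: "'n \<Rightarrow> real^'n" where e: "bij_betw e UNIV U"
    using finite_same_card_bij[of "UNIV::'n set" U] is_onb_finite[OF U] by auto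
  define Q :: "real^'n \<Rightarrow> real^'n" where "Q x = (\<Sum>i\<in>UNIV. (x $ i) *\<^sub>R e i)" for x
  have Qe: "Q (axis i 1) = e i" for i
    by (simp add: Q_def axis_def if_distrib[of "\<lambda>c. c *\<^sub>R _"] sum.delta cong: if_cong)
  have in_e: "e i \<bullet> e j = (if i = j then 1 else 0)" for i j
    using is_onb_inner[OF U, of "e i" "e j"] e by (auto simp: bij_betw_def inj_def)
  have lin: "linear Q" unfolding Q_def[abs_def]
    by (rule linearI) (auto simp: scaleR_add_left sum.distrib scaleR_sum_right)
  have "Q v \<bullet> Q w = v \<bullet> w" for v w
  proof -
    have "Q v \<bullet> Q w = (\<Sum>i\<in>UNIV. \<Sum>j\<in>UNIV. v $ i * (w $ j * (e i \<bullet> e j)))"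
      unfolding Q_def inner_sum_left inner_sum_right inner_scaleR_left inner_scaleR_right sum_distrib_left
      by (subst sum.swap) (simp add: mult_ac)
    then show ?thesis
      by (simp add: in_e if_distrib[of "\<lambda>c. _ * c"] sum.delta' cong: if_cong) (simp add: inner_vec_def)
  qed
  then have "orthogonal_transformation Q" using lin by (simp add: orthogonal_transformation_def)
  then show ?thesis using that e Qe by simp
qed

text \<open>With \<open>Q\<close> carrying the standard basis to \<open>U\<close>, the inner
  products form the transposed matrix of the conjugate of \<open>f\<close> by \<open>Q\<close>; the
  two factors \<open>det (matrix Q)\<close> multiply to 1.\<close>

lemma det_matrix_onb:
  fixes f :: "real^'n \<Rightarrow> real^'n"
  assumes U: "is_onb UNIV U" and f: "linear f"
  shows "det (matrix f) = det_indexed U (\<lambda>b c. f b \<bullet> c)"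
proof -
  obtain Q :: "real^'n \<Rightarrow> real^'n" where Q: "orthogonal_transformation Q"
      and bij: "bij_betw (\<lambda>i. Q (axis i 1)) UNIV U"
    by (rule orthonormal_matrix_exists[OF U])
  have linQ: "linear Q" using Q orthogonal_transformation_linear by blast
  have lina: "linear (adjoint Q)" by (rule adjoint_linear[OF linQ])
  have "det_indexed U (\<lambda>b c. f b \<bullet> c) = det_indexed UNIV (\<lambda>i j. f (Q (axis i 1)) \<bullet> Q (axis j 1))"
    by (rule det_indexed_reindex[OF bij]) simp
  also have "\<dots> = det (\<chi> i j. f (Q (axis i 1)) \<bullet> Q (axis j 1))"
    by (simp add: det_indexed_def det_def)
  also have "(\<chi> i j. f (Q (axis i 1)) \<bullet> Q (axis j 1)) = transpose (matrix (adjoint Q \<circ> (f \<circ> Q)))"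
  proof -
    have "adjoint Q y $ j = y \<bullet> Q (axis j 1)" for y j
      using adjoint_works[OF linQ, of "axis j 1" y] by (simp add: cart_eq_inner_axis inner_commute)
    then show ?thesis by (simp add: vec_eq_iff transpose_def matrix_def)
  qed
  also have "det \<dots> = det (matrix (adjoint Q)) * (det (matrix f) * det (matrix Q))"
    using linQ lina f by (simp add: matrix_compose linear_compose det_mul)
  also have "det (matrix (adjoint Q)) = det (matrix Q)"
    by (simp add: matrix_adjoint[OF linQ] det_transpose)
  also have "det (matrix Q) * (det (matrix f) * det (matrix Q)) = det (matrix f)"
  proof -
    have "det (matrix Q) * det (matrix Q) = 1"
      using orthogonal_transformation_det[OF Q] by (metis abs_mult_self_eq mult_1)
    then show ?thesis by (simp add: mult.left_commute)
  qed
  finally show ?thesis by simp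
qed

text \<open>Completing \<open>B\<close> by a basis of the complement gives a block triangular matrix
  whose remaining rows are unit rows, since \<open>Z\<close> fixes the complement. Vectors of
  \<open>T\<close> may acquire components in the complement without affecting the
  determinant.\<close>

lemma det_matrix_block:
  fixes Z :: "real^'n \<Rightarrow> real^'n"
  assumes B: "is_onb T B" and Z: "linear Z" and id: "\<And>n. n \<in> orthogonal_comp T \<Longrightarrow> Z n = n"
  shows "det (matrix Z) = det_indexed B (\<lambda>b c. Z b \<bullet> c)"
proof -
  let ?C = "onb (orthogonal_comp T)"
  have C: "is_onb (orthogonal_comp T) ?C" by (rule is_onb_onb[OF subspace_orthogonal_comp])
  have "det (matrix Z) = det_indexed (B \<union> ?C) (\<lambda>b c. Z b \<bullet> c)"
    by (rule det_matrix_onb[OF is_onb_Un(1)[OF B C] Z])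
  also have "\<dots> = det_indexed B (\<lambda>b c. Z b \<bullet> c)"
    using is_onb_mem[OF C] is_onb_inner[OF is_onb_Un(1)[OF B C]] is_onb_Un(2)[OF B C]
    by (intro det_indexed_Un_identity is_onb_finite[OF C] is_onb_finite[OF B]) (auto simp: id)
  finally show ?thesis .
qed

text \<open>The right-hand side, \<open>f\<close> on \<open>T\<close> extended by the identity on
  the complement, does not mention \<open>B\<close>; hence the independence of the basis.\<close>

lemma det_indexed_block:
  fixes f :: "real^'n \<Rightarrow> real^'n"
  assumes B: "is_onb T B" and f: "linear f"
  shows "det_indexed B (\<lambda>b c. f b \<bullet> c) = det (matrix (\<lambda>x. f (oproj T x) + (x - oproj T x)))"
proof -
  let ?Z = "\<lambda>x. f (oproj T x) + (x - oproj T x)"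
  have T: "subspace T" by (rule is_onb_subspace[OF B])
  have lin: "linear ?Z"
    using linear_compose[OF linear_oproj f, unfolded o_def] linear_oproj linear_ident
    by (intro linear_compose_add linear_compose_sub) auto
  have "det (matrix ?Z) = det_indexed B (\<lambda>b c. ?Z b \<bullet> c)"
    by (rule det_matrix_block[OF B lin]) (simp add: oproj_perp[OF T] linear_0[OF f])
  also have "\<dots> = det_indexed B (\<lambda>b c. f b \<bullet> c)"
    using is_onb_mem[OF B] by (intro det_indexed_cong) (simp add: oproj_id[OF T])
  finally show ?thesis by simp
qed

lemma det_indexed_onb_indep:
  fixes f :: "real^'n \<Rightarrow> real^'n"
  assumes "is_onb T B" "is_onb T C" "linear f"
  shows "det_indexed B (\<lambda>b c. f b \<bullet> c) = det_indexed C (\<lambda>b c. f b \<bullet> c)"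
  using det_indexed_block[OF assms(1,3)] det_indexed_block[OF assms(2,3)] by simp

text \<open>Expand \<open>b\<close> in the basis \<open>C\<close>, exchange the sums, and resum over
  \<open>B\<close> by Parseval.\<close>

lemma trace_onb_indep:
  fixes f :: "'a::euclidean_space \<Rightarrow> 'a"
  assumes B: "is_onb T B" and C: "is_onb T C" and f: "linear f"
  shows "(\<Sum>b\<in>B. f b \<bullet> b) = (\<Sum>b\<in>C. f b \<bullet> b)"
proof -
  have "(\<Sum>b\<in>B. f b \<bullet> b) = (\<Sum>b\<in>B. \<Sum>c\<in>C. (b \<bullet> c) * (f c \<bullet> b))"
  proof (rule sum.cong[OF refl])
    fix b assume b: "b \<in> B"
    have "f (\<Sum>c\<in>C. (b \<bullet> c) *\<^sub>R c) = (\<Sum>c\<in>C. (b \<bullet> c) *\<^sub>R f c)"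
      by (simp only: linear_sum[OF f] linear_cmul[OF f])
    then have "f b = (\<Sum>c\<in>C. (b \<bullet> c) *\<^sub>R f c)"
      by (simp only: is_onb_expand[OF C is_onb_mem[OF B b]])
    then show "f b \<bullet> b = (\<Sum>c\<in>C. (b \<bullet> c) * (f c \<bullet> b))" by (simp add: inner_sum_left)
  qed
  also have "\<dots> = (\<Sum>c\<in>C. \<Sum>b\<in>B. (c \<bullet> b) * (b \<bullet> f c))"
    by (subst sum.swap) (simp only: inner_commute)
  also have "\<dots> = (\<Sum>c\<in>C. c \<bullet> f c)"
    by (intro sum.cong refl is_onb_parseval[OF B, symmetric] is_onb_mem[OF C])
  finally show ?thesis by (simp add: inner_commute)
qed

text \<open>\<open>f\<close> factors as an operator equal to \<open>f\<close> on \<open>E\<close>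
  and to the identity on the complement, applied after one with the roles exchanged. The order
  matters, because \<open>f\<close> is only known to preserve the complement.\<close>

lemma det_matrix_block_diag:
  fixes f :: "real^'n \<Rightarrow> real^'n"
  assumes B: "is_onb E B" and C: "is_onb (orthogonal_comp E) C" and f: "linear f"
    and pres: "\<And>x. x \<in> orthogonal_comp E \<Longrightarrow> f x \<in> orthogonal_comp E"
  shows "det (matrix f) = det_indexed B (\<lambda>b c. f b \<bullet> c) * det_indexed C (\<lambda>b c. f b \<bullet> c)"
proof -
  let ?F = "orthogonal_comp E"
  have E: "subspace E" by (rule is_onb_subspace[OF B])
  have F: "subspace ?F" by (rule subspace_orthogonal_comp)
  have comp: "oproj ?F x = x - oproj E x" for x
  proof -
    have "oproj ?F ((x - oproj E x) + oproj E x) = x - oproj E x"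
      using diff_oproj_perp[OF E, of x] oproj_mem[OF E, of x]
      by (intro oproj_add[OF F]) (auto simp: perp_perp[OF E])
    then show ?thesis by simp
  qed
  let ?Z1 = "\<lambda>x. f (oproj E x) + (x - oproj E x)"
  let ?Z2 = "\<lambda>x. f (oproj ?F x) + (x - oproj ?F x)"
  have lin: "linear ?Z1" "linear ?Z2"
    using linear_compose[OF linear_oproj f, unfolded o_def] linear_oproj linear_ident
    by (auto intro!: linear_compose_add linear_compose_sub)
  have "(?Z1 \<circ> ?Z2) x = f x" for x
  proof -
    have 1: "oproj E (?Z2 x) = oproj E x"
      using oproj_add[OF E oproj_mem[OF E, of x] pres[OF oproj_mem[OF F, of x]]] comp[of x]
      by (simp add: add.commute)
    have "f (oproj E x) + f (x - oproj E x) = f x"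
      by (simp flip: linear_add[OF f])
    then show ?thesis using 1 comp[of x] by simp
  qed
  then have eq: "f = ?Z1 \<circ> ?Z2" by (intro ext) (rule sym)
  have "matrix g = matrix ?Z1 ** matrix ?Z2" if "g = ?Z1 \<circ> ?Z2" for g
    unfolding that by (rule matrix_compose[OF lin(2,1)])
  from this[OF eq] have "matrix f = matrix ?Z1 ** matrix ?Z2" .
  then have "det (matrix f) = det (matrix ?Z1) * det (matrix ?Z2)"
    by (simp only: det_mul)
  then show ?thesis by (simp only: det_indexed_block[OF B f] det_indexed_block[OF C f])
qed

text \<open>Apply the block formula to \<open>adjoint A \<circ> A\<close>, which preserves the
  complement because \<open>A\<close> maps the two summands to orthogonal sets; its determinant is
  the square of that of \<open>A\<close>.\<close>

lemma gram_det_block: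
  fixes A :: "real^'n \<Rightarrow> real^'n"
  assumes E: "subspace E" and A: "linear A"
    and orth: "\<And>x y. x \<in> E \<Longrightarrow> y \<in> orthogonal_comp E \<Longrightarrow> A x \<bullet> A y = 0"
  shows "\<bar>det (matrix A)\<bar> = sqrt (gram_det E A) * sqrt (gram_det (orthogonal_comp E) A)"
proof -
  let ?F = "orthogonal_comp E"
  have F: "subspace ?F" by (rule subspace_orthogonal_comp)
  let ?f = "adjoint A \<circ> A"
  have lin: "linear ?f" "linear (adjoint A)" using A adjoint_linear linear_compose by blast+
  have val: "?f b \<bullet> c = A b \<bullet> A c" for b c
    by (simp add: adjoint_works[OF A] inner_commute)
  have "?f x \<in> ?F" if "x \<in> ?F" for x
    using orth[OF _ that] val[of x] by (auto simp: orthogonal_comp_def orthogonal_def inner_commute)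
  then have "det (matrix ?f) = gram_det E A * gram_det ?F A"
    unfolding gram_det_def using det_matrix_block_diag[OF is_onb_onb[OF E] is_onb_onb[OF F] lin(1)]
    by (simp add: val[unfolded o_def])
  moreover have "det (matrix ?f) = (det (matrix A))\<^sup>2"
    using A lin by (simp add: matrix_compose det_mul matrix_adjoint det_transpose power2_eq_square)
  ultimately show ?thesis by (metis real_sqrt_abs real_sqrt_mult)
qed

text \<open>Along the segment from the identity to \<open>Z\<close> the quadratic form stays
  positive, so no operator on it is singular and the determinant cannot change sign.\<close>

lemma det_pos_def:
  fixes Z :: "real^'n \<Rightarrow> real^'n"
  assumes Z: "linear Z" and pos: "\<And>x. x \<noteq> 0 \<Longrightarrow> x \<bullet> Z x > 0"
  shows "det (matrix Z) > 0"
proof (rule ccontr)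
  assume neg: "\<not> det (matrix Z) > 0"
  define h where "h t = det ((1 - t) *\<^sub>R mat 1 + t *\<^sub>R matrix Z)" for t :: real
  have cont: "continuous_on {0..1} h"
    unfolding h_def det_def by (intro continuous_intros)
  have "h 1 \<le> 0" "h 0 \<ge> 0" using neg by (auto simp: h_def)
  then obtain t where t: "t \<in> {0..1}" "h t = 0"
    using IVT2'[OF _ _ _ cont, of 0] by auto
  then have "\<not> invertible ((1 - t) *\<^sub>R mat 1 + t *\<^sub>R matrix Z)"
    by (simp add: h_def invertible_det_nz)
  then obtain x where x: "x \<noteq> 0" "((1 - t) *\<^sub>R mat 1 + t *\<^sub>R matrix Z) *v x = 0"
    by (metis invertible_left_inverse matrix_left_invertible_ker)
  have "(1 - t) *\<^sub>R x + t *\<^sub>R Z x = 0"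
    using x(2) Z by (simp add: matrix_vector_mult_add_rdistrib scaleR_matrix_vector_assoc[symmetric] matrix_works)
  then have "(1 - t) * (x \<bullet> x) + t * (x \<bullet> Z x) = 0"
    by (metis inner_add_right inner_scaleR_right inner_zero_right)
  moreover have "(1 - t) * (x \<bullet> x) \<ge> 0" "t * (x \<bullet> Z x) \<ge> 0" "t > 0 \<Longrightarrow> t * (x \<bullet> Z x) > 0" "t = 0 \<Longrightarrow> (1 - t) * (x \<bullet> x) > 0"
    using t pos[OF x(1)] x(1) by auto
  ultimately show False using t by (cases "t = 0") auto
qed

text \<open>Compressing \<open>f\<close> to \<open>T\<close> and adding the identity on the
  complement gives a positive operator on the whole space: its form at \<open>x\<close> is that of
  \<open>f\<close> at the projection plus the squared norm of the orthogonal part.\<close>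

lemma det_indexed_pos_def:
  fixes f :: "real^'n \<Rightarrow> real^'n"
  assumes B: "is_onb T B" and f: "linear f"
    and pos: "\<And>x. x \<in> T \<Longrightarrow> x \<noteq> 0 \<Longrightarrow> f x \<bullet> x > 0"
  shows "det_indexed B (\<lambda>b c. f b \<bullet> c) > 0"
proof -
  have T: "subspace T" by (rule is_onb_subspace[OF B])
  let ?p = "oproj T"
  let ?g = "\<lambda>x. ?p (f x)"
  have g: "linear ?g" using linear_compose[OF f linear_oproj, unfolded o_def] .
  let ?Z = "\<lambda>x. ?g (?p x) + (x - ?p x)"
  have lin: "linear ?Z"
    using linear_compose[OF linear_oproj g, unfolded o_def] linear_oproj linear_ident
    by (intro linear_compose_add linear_compose_sub) auto
  have "det (matrix ?Z) > 0"
  proof (rule det_pos_def[OF lin])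
    fix x :: "real^'n" assume x: "x \<noteq> 0"
    have eq: "x \<bullet> ?Z x = f (?p x) \<bullet> ?p x + (x - ?p x) \<bullet> (x - ?p x)"
    proof -
      have "x \<bullet> ?g (?p x) = f (?p x) \<bullet> ?p x"
        by (metis T inner_commute oproj_inner oproj_mem)
      moreover have "x \<bullet> (x - ?p x) = (x - ?p x) \<bullet> (x - ?p x)"
        using inner_perp[OF T oproj_mem[OF T] diff_oproj_perp[OF T], of x x] by (simp add: inner_diff_left)
      ultimately show ?thesis by (simp add: inner_add_right)
    qed
    show "x \<bullet> ?Z x > 0"
    proof (cases "?p x = 0")
      case True
      then show ?thesis unfolding eq using x by (simp add: linear_0[OF f])
    next
      case False
      then show ?thesis unfolding eq using pos[OF oproj_mem[OF T] False]
        by (simp add: add_pos_nonneg)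
    qed
  qed
  then have "det_indexed B (\<lambda>b c. ?g b \<bullet> c) > 0" using det_indexed_block[OF B g] by simp
  also have "det_indexed B (\<lambda>b c. ?g b \<bullet> c) = det_indexed B (\<lambda>b c. f b \<bullet> c)"
    using is_onb_mem[OF B] by (intro det_indexed_cong) (simp add: oproj_inner[OF T])
  finally show ?thesis .
qed

text \<open>A maximum point \<open>u\<close> of the quadratic form on the unit sphere of
  \<open>T\<close> is an eigenvector: the first variation makes \<open>S u\<close> orthogonal to
  every \<open>w\<close> in \<open>T\<close> orthogonal to \<open>u\<close>, and
  \<open>S u - l *\<^sub>R u\<close> is itself such a \<open>w\<close>.\<close>

lemma self_adjoint_eigenvector:
  fixes S :: "'a::euclidean_space \<Rightarrow> 'a"
  assumes T: "subspace T" "T \<noteq> {0}" and S: "linear S" "\<And>x. x \<in> T \<Longrightarrow> S x \<in> T"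
    and sym: "\<And>x y. x \<in> T \<Longrightarrow> y \<in> T \<Longrightarrow> S x \<bullet> y = x \<bullet> S y"
  obtains u l where "u \<in> T" "norm u = 1" "S u = l *\<^sub>R u"
proof -
  let ?K = "T \<inter> sphere 0 1"
  obtain a where a: "a \<in> T" "a \<noteq> 0" using T subspace_0 by blast
  have "a /\<^sub>R norm a \<in> ?K" using a T(1) by (auto simp: subspace_scale)
  then have ne: "?K \<noteq> {}" by blast
  have cpt: "compact ?K" using T(1) by (simp add: closed_Int_compact closed_subspace)
  have cont: "continuous_on ?K (\<lambda>x. S x \<bullet> x)"
    by (intro continuous_intros linear_continuous_on S(1)[unfolded linear_conv_bounded_linear])
  obtain u where u: "u \<in> ?K" and max: "\<And>x. x \<in> ?K \<Longrightarrow> S x \<bullet> x \<le> S u \<bullet> u"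
    using continuous_attains_sup[OF cpt ne cont] by blast
  define l where "l = S u \<bullet> u"
  have uT: "u \<in> T" and nu: "u \<bullet> u = 1" using u by (auto simp: dot_square_norm)
  have max': "S x \<bullet> x \<le> l * (x \<bullet> x)" if "x \<in> T" for x
  proof (cases "x = 0")
    case False
    have "x /\<^sub>R norm x \<in> ?K" using that False T(1) by (auto simp: subspace_scale)
    from max[OF this] show ?thesis
      using False by (simp add: linear_cmul[OF S(1)] l_def dot_square_norm power2_eq_square field_simps)
  qed (simp add: linear_0[OF S(1)])
  have orth: "S u \<bullet> w = 0" if w: "w \<in> T" "w \<bullet> u = 0" for w
  proof (rule ccontr)
    assume c: "S u \<bullet> w \<noteq> 0"
    define q where "q = S w \<bullet> w - l * (w \<bullet> w)"
    have quad: "2 * t * (S u \<bullet> w) + t\<^sup>2 * q \<le> 0" for t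
    proof -
      have le: "S (u + t *\<^sub>R w) \<bullet> (u + t *\<^sub>R w) \<le> l * ((u + t *\<^sub>R w) \<bullet> (u + t *\<^sub>R w))"
        using w(1) uT T(1) by (intro max') (simp add: subspace_add subspace_scale)
      have 1: "S (u + t *\<^sub>R w) \<bullet> (u + t *\<^sub>R w) = l + 2 * t * (S u \<bullet> w) + t\<^sup>2 * (S w \<bullet> w)"
        using sym[OF w(1) uT]
        by (simp add: linear_add[OF S(1)] linear_cmul[OF S(1)] inner_add_left inner_add_right l_def
            power2_eq_square inner_commute algebra_simps)
      have 2: "(u + t *\<^sub>R w) \<bullet> (u + t *\<^sub>R w) = 1 + t\<^sup>2 * (w \<bullet> w)"
        using w(2) nu by (simp add: inner_add_left inner_add_right power2_eq_square inner_commute)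
      show ?thesis using le unfolding 1 2 by (simp add: q_def algebra_simps)
    qed
    define c where "c = S u \<bullet> w"
    \<comment> \<open>For this step size the linear gain exceeds the quadratic loss: the expression
      equals \<open>c\<^sup>2 / m\<close> times \<open>2 + q / m\<close>, and the second factor is
      positive since \<open>q > - m\<close>.\<close>
    define m where "m = \<bar>q\<bar> + 1"
    define t where "t = c / m"
    have m: "m > 0" "q > - m" by (auto simp: m_def)
    have "2 * t * c + t\<^sup>2 * q = (c\<^sup>2 / m) * (2 + q / m)"
      using m(1) unfolding t_def by (simp add: power2_eq_square field_simps)
    moreover have "c\<^sup>2 / m > 0" using c m by (simp add: c_def)
    moreover have "2 + q / m > 0"
      using m by (simp add: field_simps)
    ultimately have "2 * t * c + t\<^sup>2 * q > 0" by (simp only: mult_pos_pos)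
    then show False using quad[of t] by (simp add: c_def)
  qed
  let ?d = "S u - l *\<^sub>R u"
  have dT: "?d \<in> T" using S(2)[OF uT] uT T(1) by (simp add: subspace_diff subspace_scale)
  have du: "?d \<bullet> u = 0" using nu by (simp add: inner_diff_left l_def)
  have "?d \<bullet> ?d = 0"
    using orth[OF dT du] du by (simp add: inner_diff_left inner_commute)
  then have "S u = l *\<^sub>R u" by simp
  then show ?thesis using that uT u by auto
qed

text \<open>Induction over the dimension: an eigenvector \<open>u\<close> splits off, its orthogonal
  complement in \<open>T\<close> is invariant by symmetry, and the restriction satisfies the same
  hypotheses. The bounds are those for the elementary symmetric functions of eigenvalues of modulus
  at most \<open>e\<close>.\<close>

lemma det_perturbation_bounds:
  fixes S :: "real^'n \<Rightarrow> real^'n"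
  assumes S: "linear S" and e: "e \<ge> 0" and k: "dim T = k" and B: "is_onb T B"
    and inv: "\<And>x. x \<in> T \<Longrightarrow> S x \<in> T"
    and sym: "\<And>x y. x \<in> T \<Longrightarrow> y \<in> T \<Longrightarrow> S x \<bullet> y = x \<bullet> S y"
    and bnd: "\<And>x. x \<in> T \<Longrightarrow> \<bar>S x \<bullet> x\<bar> \<le> e * (norm x)\<^sup>2"
  shows "\<bar>det_indexed B (\<lambda>b c. (b - S b) \<bullet> c) - 1\<bar> \<le> (1 + e) ^ k - 1 \<and>
    \<bar>det_indexed B (\<lambda>b c. (b - S b) \<bullet> c) - 1 + (\<Sum>b\<in>B. S b \<bullet> b)\<bar> \<le> (1 + e) ^ k - 1 - k * e"
  using k B inv sym bnd
proof (induction k arbitrary: T B)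
  case 0
  have "B = {}" using is_onb_card[OF 0(2)] is_onb_finite[OF 0(2)] 0(1) by simp
  then show ?case by (simp add: det_indexed_def)
next
  case (Suc k)
  have T: "subspace T" by (rule is_onb_subspace[OF Suc.prems(2)])
  have "T \<noteq> {0}" using Suc.prems(1) by auto
  then obtain u l where u: "u \<in> T" "norm u = 1" and l: "S u = l *\<^sub>R u"
    using self_adjoint_eigenvector[OF T _ S Suc.prems(3,4)] by metis
  have uu: "u \<bullet> u = 1" using u(2) by (simp add: dot_square_norm)
  define T' where "T' = T \<inter> {x. u \<bullet> x = 0}"
  have T': "subspace T'" unfolding T'_def by (intro subspace_inter T subspace_hyperplane)
  obtain C where C: "is_onb T' C" using is_onb_exists[OF T'] by blast
  have uC: "u \<notin> C" using is_onb_mem[OF C, of u] uu by (auto simp: T'_def)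
  have onbI: "is_onb T (insert u C)"
  proof -
    have "x \<in> span (insert u C)" if x: "x \<in> T" for x
    proof -
      have "x - (u \<bullet> x) *\<^sub>R u \<in> T'"
        using x u T by (auto simp: T'_def inner_diff_right uu intro: subspace_diff subspace_scale)
      then have "x - (u \<bullet> x) *\<^sub>R u \<in> span C" using C by (simp add: is_onb_def)
      then show ?thesis unfolding span_insert by blast
    qed
    moreover have "span (insert u C) \<subseteq> T"
      using u(1) is_onb_mem[OF C] T by (intro span_minimal) (auto simp: T'_def)
    moreover have "insert u C \<subseteq> T" using u(1) is_onb_mem[OF C] by (auto simp: T'_def)
    moreover have "u \<bullet> c = 0" "c \<bullet> u = 0" if "c \<in> C" for c
      using is_onb_mem[OF C that] by (auto simp: T'_def inner_commute)
    ultimately show ?thesis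
      using C u(2) unfolding is_onb_def by (auto simp: pairwise_insert orthogonal_def)
  qed
  have dimT': "dim T' = k"
    using is_onb_card[OF onbI] is_onb_card[OF C] uC is_onb_finite[OF C] Suc.prems(1) by simp
  have inv': "S x \<in> T'" if "x \<in> T'" for x
    using that Suc.prems(3)[of x] Suc.prems(4)[OF u(1), of x] l by (auto simp: T'_def)
  let ?D = "det_indexed C (\<lambda>b c. (b - S b) \<bullet> c)"
  let ?t = "\<Sum>b\<in>C. S b \<bullet> b"
  have IH: "\<bar>?D - 1\<bar> \<le> (1 + e) ^ k - 1" "\<bar>?D - 1 + ?t\<bar> \<le> (1 + e) ^ k - 1 - k * e"
    using Suc.IH[OF dimT' C inv'] Suc.prems(4,5) unfolding T'_def by blast+
  have le: "\<bar>l\<bar> \<le> e" using Suc.prems(5)[OF u(1)] u(2) by (simp add: l uu)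
  have ls: "linear (\<lambda>x. x - S x)" by (intro linear_compose_sub S linear_ident)
  have "det_indexed (insert u C) (\<lambda>b c. (b - S b) \<bullet> c) = (u - S u) \<bullet> u * ?D"
  proof (rule det_indexed_insert[OF is_onb_finite[OF C] uC])
    fix c assume "c \<in> C"
    then have "u \<bullet> c = 0" using is_onb_mem[OF C] by (simp add: T'_def)
    then show "(u - S u) \<bullet> c = 0" by (simp add: l inner_diff_left)
  qed
  then have D: "det_indexed B (\<lambda>b c. (b - S b) \<bullet> c) = (1 - l) * ?D"
    using det_indexed_onb_indep[OF Suc.prems(2) onbI ls] u(2)
    by (simp add: l inner_diff_left uu)
  have t: "(\<Sum>b\<in>B. S b \<bullet> b) = l + ?t"
    using trace_onb_indep[OF Suc.prems(2) onbI S] uC is_onb_finite[OF C] u(2)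
    by (simp add: l uu)
  have lD: "\<bar>l * (?D - 1)\<bar> \<le> e * ((1 + e) ^ k - 1)"
    unfolding abs_mult using le IH(1) e by (intro mult_mono) auto
  \<comment> \<open>The bounds for the three terms add up to the recursion of
    \<open>(1 + e) ^ Suc k - 1\<close>. Adding the trace below cancels the isolated
    \<open>l\<close>, which improves the estimate to second order.\<close>
  have "(1 - l) * ?D - 1 = (?D - 1) - l * (?D - 1) - l" by (simp add: algebra_simps)
  then have "\<bar>(1 - l) * ?D - 1\<bar> \<le> ((1 + e) ^ k - 1) + e * ((1 + e) ^ k - 1) + e"
    using IH(1) lD le by linarith
  moreover have "(1 - l) * ?D - 1 + (l + ?t) = (?D - 1 + ?t) - l * (?D - 1)" by (simp add: algebra_simps)
  then have "\<bar>(1 - l) * ?D - 1 + (l + ?t)\<bar> \<le> ((1 + e) ^ k - 1 - k * e) + e * ((1 + e) ^ k - 1)"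
    using IH(2) lD by linarith
  moreover obtain DD where DD: "?D = DD" by blast
  ultimately show ?case unfolding D t DD by (simp add: algebra_simps)
qed

section \<open>Change of variables for nonnegative functions\<close>

text \<open>For an image of finite measure this is the change of variables for sets. If the image
  has infinite measure, the integral is infinite too, since integrability of the determinant would
  force the image to have finite measure.\<close>

lemma emeasure_differentiable_image:
  fixes g :: "real^'n::{finite,wellorder} \<Rightarrow> real^'n::_"
  assumes T: "T \<in> sets borel" and der: "\<And>x. x \<in> T \<Longrightarrow> (g has_derivative g' x) (at x within T)"
    and inj: "inj_on g T" and gT: "g ` T \<in> sets borel"
    and dm: "(\<lambda>x. if x \<in> T then \<bar>det (matrix (g' x))\<bar> else 0) \<in> borel_measurable borel"
  shows "emeasure lborel (g ` T) = (\<integral>\<^sup>+x. ennreal (if x \<in> T then \<bar>det (matrix (g' x))\<bar> else 0) \<partial>lborel)"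
proof -
  let ?d = "\<lambda>x. if x \<in> T then \<bar>det (matrix (g' x))\<bar> else 0"
  have TL: "T \<in> sets lebesgue" using T by (simp add: sets_completionI_sets)
  have eml: "emeasure lborel (g ` T) = emeasure lebesgue (g ` T)"
    using gT by simp
  have gTL: "g ` T \<in> sets lebesgue" using gT by (simp add: sets_completionI_sets)
  show ?thesis
  proof (cases "g ` T \<in> lmeasurable")
    case True
    define m where "m = measure lebesgue (g ` T)"
    have "((\<lambda>x. \<bar>det (matrix (g' x))\<bar>) has_integral m) T"
      using has_measure_differentiable_image[OF TL der inj] True m_def by blast
    then have "(?d has_integral m) UNIV" by (simp add: has_integral_restrict_UNIV)
    then have "integral\<^sup>N lborel ?d = m"
      by (intro nn_integral_has_integral_lborel dm) auto
    then show ?thesis using emeasure_eq_ennreal_measure[OF fmeasurableD2[OF True]] by (simp add: eml m_def)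
  next
    case False
    then have inf: "emeasure lebesgue (g ` T) = \<infinity>"
      using fmeasurableI[OF gTL] by (metis infinity_ennreal_def top.not_eq_extremum)
    have "integral\<^sup>N lborel ?d = \<infinity>"
    proof (rule ccontr)
      assume "integral\<^sup>N lborel ?d \<noteq> \<infinity>"
      then have "?d integrable_on UNIV"
        by (intro nn_integral_integrable_on dm) (auto simp: top.not_eq_extremum)
      then have "(\<lambda>x. \<bar>det (matrix (g' x))\<bar>) integrable_on T"
        by (simp add: integrable_restrict_UNIV)
      then show False using False measurable_differentiable_image_eq[OF TL der inj] by blast
    qed
    then show ?thesis using inf eml by simp
  qed
qed

text \<open>It suffices that two measures agree: Lebesgue measure on the image, and the push-forward
  under \<open>g\<close> of the determinant density. On a set \<open>B\<close> this is the previous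
  lemma for the part of \<open>S\<close> mapped into \<open>B\<close>.\<close>

lemma nn_integral_change_of_variables_wellorder:
  fixes g :: "real^'n::{finite,wellorder} \<Rightarrow> real^'n::_"
  assumes S: "S \<in> sets borel" and der: "\<And>x. x \<in> S \<Longrightarrow> (g has_derivative g' x) (at x within S)"
    and inj: "inj_on g S" and gS: "g ` S \<in> sets borel"
    and dm: "(\<lambda>x. if x \<in> S then \<bar>det (matrix (g' x))\<bar> else 0) \<in> borel_measurable borel"
    and f: "f \<in> borel_measurable borel"
  shows "(\<integral>\<^sup>+x. f x * indicator (g ` S) x \<partial>lborel)
    = (\<integral>\<^sup>+x. f (g x) * ennreal \<bar>det (matrix (g' x))\<bar> * indicator S x \<partial>lborel)"
proof -
  let ?d = "\<lambda>x. if x \<in> S then \<bar>det (matrix (g' x))\<bar> else 0"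
  \<comment> \<open>A Borel map on the whole space that agrees with \<open>g\<close> on
    \<open>S\<close>; outside \<open>S\<close> the density vanishes.\<close>
  define h where "h x = (if x \<in> S then g x else 0)" for x
  have "continuous_on S g" using der by (metis has_derivative_continuous_on)
  then have h: "h \<in> borel_measurable borel"
    unfolding h_def by (rule borel_measurable_continuous_on_if[OF S]) simp
  note [measurable] = h dm f S gS
  have "density lborel (indicator (g ` S)) = distr (density lborel (\<lambda>x. ennreal (?d x))) borel h"
  proof (rule measure_eqI)
    fix B assume "B \<in> sets (density lborel (indicator (g ` S)))"
    then have B[measurable]: "B \<in> sets borel" by simp
    let ?T = "S \<inter> h -` B"
    have TB: "?T \<in> sets borel" using measurable_sets[OF h B] S by (intro sets.Int) auto
    have gT: "g ` ?T = g ` S \<inter> B" by (auto simp: h_def)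
    have "emeasure (density lborel (indicator (g ` S))) B = emeasure lborel (g ` S \<inter> B)"
      by (subst emeasure_density) (simp_all add: indicator_inter_arith[symmetric])
    also have "\<dots> = emeasure lborel (g ` ?T)" by (simp add: gT)
    also have "\<dots> = (\<integral>\<^sup>+x. ennreal (if x \<in> ?T then \<bar>det (matrix (g' x))\<bar> else 0) \<partial>lborel)"
    proof (rule emeasure_differentiable_image[OF TB])
      show "(g has_derivative g' x) (at x within ?T)" if "x \<in> ?T" for x
        using that der[of x] by (auto intro: has_derivative_subset)
      show "inj_on g ?T" using inj by (auto simp: inj_on_def)
      show "g ` ?T \<in> sets borel" unfolding gT by simp
      have "(\<lambda>x. if x \<in> ?T then \<bar>det (matrix (g' x))\<bar> else 0) = (\<lambda>x. ?d x * indicator ?T x)"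
        by (auto simp: fun_eq_iff)
      then show "(\<lambda>x. if x \<in> ?T then \<bar>det (matrix (g' x))\<bar> else 0) \<in> borel_measurable borel"
        using TB dm by simp
    qed
    also have "\<dots> = (\<integral>\<^sup>+x. ennreal (?d x) * indicator (h -` B) x \<partial>lborel)"
      by (intro nn_integral_cong) (auto split: split_indicator)
    also have "\<dots> = emeasure (density lborel (\<lambda>x. ennreal (?d x))) (h -` B)"
      using measurable_sets[OF h B] by (intro emeasure_density[symmetric]) auto
    also have "\<dots> = emeasure (distr (density lborel (\<lambda>x. ennreal (?d x))) borel h) B"
      by (subst emeasure_distr) auto
    finally show "emeasure (density lborel (indicator (g ` S))) B
      = emeasure (distr (density lborel (\<lambda>x. ennreal (?d x))) borel h) B" .
  qed simp
  then have "integral\<^sup>N (density lborel (indicator (g ` S))) f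
      = integral\<^sup>N (distr (density lborel (\<lambda>x. ennreal (?d x))) borel h) f" by simp
  also have "\<dots> = (\<integral>\<^sup>+x. ennreal (?d x) * f (h x) \<partial>lborel)"
    by (subst nn_integral_distr, simp, simp, subst nn_integral_density) auto
  also have "\<dots> = (\<integral>\<^sup>+x. f (g x) * ennreal \<bar>det (matrix (g' x))\<bar> * indicator S x \<partial>lborel)"
    by (intro nn_integral_cong) (auto simp: h_def mult.commute split: split_indicator)
  finally show ?thesis by (simp add: nn_integral_density mult.commute)
qed

text \<open>The library's change of variables is stated for well-ordered index types only; the copy
  \<open>'a wo\<close> of a finite type carries such an order.\<close>

typedef 'a wo = "UNIV :: 'a set" by auto

instance wo :: (finite) finite
proof
  have "(UNIV :: 'a wo set) = range Abs_wo" by (metis Rep_wo_inverse surjI)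
  then show "finite (UNIV :: 'a wo set)" by (metis finite finite_imageI)
qed

instantiation wo :: (finite) wellorder
begin

definition wo_idx :: "'a wo \<Rightarrow> nat" where "wo_idx = (SOME f. inj f)"

definition less_eq_wo :: "'a wo \<Rightarrow> 'a wo \<Rightarrow> bool" where "x \<le> y \<longleftrightarrow> wo_idx x \<le> wo_idx y"

definition less_wo :: "'a wo \<Rightarrow> 'a wo \<Rightarrow> bool" where "x < y \<longleftrightarrow> wo_idx x < wo_idx y"

lemma inj_wo_idx: "inj (wo_idx :: 'a wo \<Rightarrow> nat)"
proof -
  have "\<exists>f :: 'a wo \<Rightarrow> nat. inj f" using finite_imp_inj_to_nat_seg[of "UNIV :: 'a wo set"] by auto
  then show ?thesis unfolding wo_idx_def by (rule someI_ex)
qed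

instance
proof
  fix P :: "'a wo \<Rightarrow> bool" and a :: "'a wo"
  assume step: "\<And>x. (\<And>y. y < x \<Longrightarrow> P y) \<Longrightarrow> P x"
  show "P a" by (induction a rule: measure_induct_rule[of wo_idx]) (use step in \<open>auto simp: less_wo_def\<close>)
qed (use inj_wo_idx in \<open>auto simp: less_eq_wo_def less_wo_def inj_def\<close>)

end

section \<open>Relabelling the coordinates by an ordered copy of the index type\<close>

lemma bij_Rep_wo: "bij (Rep_wo :: 'a wo \<Rightarrow> 'a)"
  by (metis Abs_wo_inverse Rep_wo_inverse UNIV_I bijI')

definition to_wo :: "real^'n \<Rightarrow> real^('n wo)" where "to_wo x = (\<chi> i. x $ Rep_wo i)"

definition of_wo :: "real^('n wo) \<Rightarrow> real^'n" where "of_wo y = (\<chi> i. y $ Abs_wo i)"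

lemma of_to_wo [simp]: "of_wo (to_wo x) = x"
  by (simp add: of_wo_def to_wo_def Abs_wo_inverse vec_eq_iff)

lemma to_of_wo [simp]: "to_wo (of_wo x) = x"
  by (simp add: of_wo_def to_wo_def Rep_wo_inverse vec_eq_iff)

lemma linear_to_wo: "linear to_wo"
  by (rule linearI) (auto simp: to_wo_def vec_eq_iff)

lemma linear_of_wo: "linear of_wo"
  by (rule linearI) (auto simp: of_wo_def vec_eq_iff)

lemma borel_to_wo [measurable]: "to_wo \<in> borel_measurable borel"
  by (intro borel_measurable_continuous_onI linear_continuous_on linear_to_wo[unfolded linear_conv_bounded_linear])

lemma borel_of_wo [measurable]: "of_wo \<in> borel_measurable borel"
  by (intro borel_measurable_continuous_onI linear_continuous_on linear_of_wo[unfolded linear_conv_bounded_linear])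

text \<open>Lebesgue measure is characterized by its values on boxes, and relabelling coordinates
  turns a box into one with the same side lengths.\<close>

lemma lborel_distr_to_wo: "distr lborel borel (to_wo :: real^'n \<Rightarrow> _) = lborel"
proof (rule lborel_eqI[symmetric])
  fix l u :: "real^('n wo)"
  assume le: "\<And>b. b \<in> Basis \<Longrightarrow> l \<bullet> b \<le> u \<bullet> b"
  have lu: "l $ i \<le> u $ i" for i
    using le[of "axis i 1"] by (simp add: cart_eq_inner_axis axis_in_Basis_iff)
  have pre: "to_wo -` box l u = box (of_wo l) (of_wo u :: real^'n)"
  proof -
    have "(\<forall>i. l $ i < x $ Rep_wo i \<and> x $ Rep_wo i < u $ i) \<longleftrightarrow> (\<forall>j. l $ Abs_wo j < x $ j \<and> x $ j < u $ Abs_wo j)" for x :: "real^'n"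
      by (metis Abs_wo_inverse Rep_wo_inverse UNIV_I)
    then show ?thesis by (auto simp: mem_box_cart to_wo_def of_wo_def)
  qed
  have prodc: "(\<Prod>b\<in>Basis. x \<bullet> b) = (\<Prod>i\<in>UNIV. x $ i)" for x :: "real^'k"
  proof -
    have "(\<Prod>b\<in>Basis. x \<bullet> b) = (\<Prod>b\<in>range (\<lambda>i. axis i 1). x \<bullet> b)"
      by (rule prod.cong) (auto simp: Basis_vec_def)
    moreover have "inj (\<lambda>i. axis i 1 :: real^'k)" by (simp add: inj_def axis_eq_axis)
    ultimately show ?thesis by (simp only: prod.reindex o_def cart_eq_inner_axis)
  qed
  have "emeasure (distr lborel borel (to_wo :: real^'n \<Rightarrow> _)) (box l u) = emeasure lborel (box (of_wo l) (of_wo u :: real^'n))"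
    by (subst emeasure_distr) (auto simp: pre)
  also have "\<dots> = ennreal (\<Prod>b\<in>Basis. (of_wo u - of_wo l :: real^'n) \<bullet> b)"
    using lu by (subst emeasure_lborel_box) (auto simp: Basis_vec_def of_wo_def inner_axis)
  also have "(\<Prod>b\<in>Basis. (of_wo u - of_wo l :: real^'n) \<bullet> b) = (\<Prod>b\<in>Basis. (u - l) \<bullet> b)"
  proof -
    have "(\<Prod>i\<in>UNIV. (u - l) $ i) = (\<Prod>j\<in>UNIV. (of_wo u - of_wo l :: real^'n) $ j)"
      using prod.reindex_bij_betw[OF bij_Rep_wo, of "\<lambda>j. (of_wo u - of_wo l :: real^'n) $ j"]
      by (simp add: of_wo_def Rep_wo_inverse)
    then show ?thesis by (simp only: prodc)
  qed
  finally show "emeasure (distr lborel borel (to_wo :: real^'n \<Rightarrow> _)) (box l u) = ennreal (\<Prod>b\<in>Basis. (u - l) \<bullet> b)" .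
qed simp

lemma det_to_wo: "det (matrix (\<lambda>y. to_wo (f (of_wo y)))) = det (matrix (f :: real^'n \<Rightarrow> real^'n))"
proof -
  have ax: "of_wo (axis j 1) = axis (Rep_wo j) 1" for j
    by (auto simp: of_wo_def axis_def vec_eq_iff Abs_wo_inverse Rep_wo_inverse)
  have "det (matrix f) = det_indexed UNIV (\<lambda>i j. matrix f $ i $ j)" by (simp add: det_def det_indexed_def)
  also have "\<dots> = det_indexed UNIV (\<lambda>i j. matrix f $ Rep_wo i $ Rep_wo j)"
    by (rule det_indexed_reindex[OF bij_Rep_wo]) simp
  also have "\<dots> = det (matrix (\<lambda>y. to_wo (f (of_wo y))))"
    by (simp add: det_def det_indexed_def matrix_def to_wo_def ax)
  finally show ?thesis by simp
qed

theorem nn_integral_change_of_variables: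
  fixes g :: "real^'n \<Rightarrow> real^'n"
  assumes S: "S \<in> sets borel" and der: "\<And>x. x \<in> S \<Longrightarrow> (g has_derivative g' x) (at x within S)"
    and inj: "inj_on g S" and gS: "g ` S \<in> sets borel"
    and dm: "(\<lambda>x. if x \<in> S then \<bar>det (matrix (g' x))\<bar> else 0) \<in> borel_measurable borel"
    and f: "f \<in> borel_measurable borel"
  shows "(\<integral>\<^sup>+x. f x * indicator (g ` S) x \<partial>lborel)
    = (\<integral>\<^sup>+x. f (g x) * ennreal \<bar>det (matrix (g' x))\<bar> * indicator S x \<partial>lborel)"
proof -
  let ?g = "\<lambda>y. to_wo (g (of_wo y))" and ?g' = "\<lambda>y z. to_wo (g' (of_wo y) (of_wo z))"
  let ?S = "of_wo -` S"
  note [measurable] = S dm f gS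
  have tr: "(\<integral>\<^sup>+x. h x \<partial>lborel) = (\<integral>\<^sup>+x. h (to_wo x) \<partial>lborel)" if "h \<in> borel_measurable borel"
    for h :: "real^('n wo) \<Rightarrow> ennreal"
    using that by (subst lborel_distr_to_wo[symmetric], subst nn_integral_distr) auto
  have img: "?g ` ?S = of_wo -` (g ` S)"
  proof -
    have "y \<in> ?g ` ?S" if "of_wo y = g x" "x \<in> S" for x y
      using that by (intro image_eqI[of _ _ "to_wo x"]) (auto simp: that(1)[symmetric])
    then show ?thesis by auto
  qed
  have SB: "?S \<in> sets borel" using measurable_sets[OF borel_of_wo S] by simp
  have gSB: "?g ` ?S \<in> sets borel" unfolding img using measurable_sets[OF borel_of_wo gS] by simp
  have derw: "(?g has_derivative ?g' y) (at y within ?S)" if "y \<in> ?S" for y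
  proof -
    have "(g has_derivative g' (of_wo y)) (at (of_wo y) within of_wo ` ?S)"
      using that der[of "of_wo y"] by (auto intro: has_derivative_subset)
    from diff_chain_within[OF linear_imp_has_derivative[OF linear_of_wo] this]
    have "(g \<circ> of_wo has_derivative g' (of_wo y) \<circ> of_wo) (at y within ?S)" .
    from diff_chain_within[OF this linear_imp_has_derivative[OF linear_to_wo]]
    show ?thesis by (simp add: o_def)
  qed
  have injw: "inj_on ?g ?S"
    using inj by (auto simp: inj_on_def) (metis of_to_wo to_of_wo)
  have det': "det (matrix (?g' y)) = det (matrix (g' (of_wo y)))" for y
    by (rule det_to_wo)
  have dmw: "(\<lambda>y. if y \<in> ?S then \<bar>det (matrix (?g' y))\<bar> else 0) \<in> borel_measurable borel"
    unfolding det' using measurable_compose[OF borel_of_wo dm] by simp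
  have "(\<integral>\<^sup>+x. f x * indicator (g ` S) x \<partial>lborel) = (\<integral>\<^sup>+y. f (of_wo y) * indicator (?g ` ?S) y \<partial>lborel)"
    using gSB by (subst tr) (auto simp: img indicator_def)
  also have "\<dots> = (\<integral>\<^sup>+y. f (of_wo (?g y)) * ennreal \<bar>det (matrix (?g' y))\<bar> * indicator ?S y \<partial>lborel)"
    by (rule nn_integral_change_of_variables_wellorder[OF SB derw injw gSB dmw]) auto
  also have "\<dots> = (\<integral>\<^sup>+y. f (g (of_wo y)) * ennreal (if of_wo y \<in> S then \<bar>det (matrix (g' (of_wo y)))\<bar> else 0) * indicator ?S y \<partial>lborel)"
    unfolding det' by (intro nn_integral_cong) (auto split: split_indicator)
  \<comment> \<open>Off \<open>S\<close> nothing is known about the measurability of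
    \<open>f \<circ> g\<close> or of the determinant. Replacing both by 0 there produces an
    integrand that is Borel on the whole space and can be transported by
    \<open>to_wo\<close>.\<close>
  also have "\<dots> = (\<integral>\<^sup>+y. (if of_wo y \<in> S then f (g (of_wo y)) else 0) * ennreal (if of_wo y \<in> S then \<bar>det (matrix (g' (of_wo y)))\<bar> else 0) \<partial>lborel)"
    by (intro nn_integral_cong) (auto split: split_indicator)
  also have "\<dots> = (\<integral>\<^sup>+x. (if x \<in> S then f (g x) else 0) * ennreal (if x \<in> S then \<bar>det (matrix (g' x))\<bar> else 0) \<partial>lborel)"
  proof (subst tr)
    have "continuous_on S g" using der by (metis has_derivative_continuous_on)
    then have "(\<lambda>x. if x \<in> S then g x else 0) \<in> borel_measurable borel"
      by (rule borel_measurable_continuous_on_if[OF S]) simp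
    from measurable_compose[OF this f]
    have "(\<lambda>x. f (if x \<in> S then g x else 0)) \<in> borel_measurable borel" .
    then have "(\<lambda>x. if x \<in> S then f (if x \<in> S then g x else 0) else 0) \<in> borel_measurable borel"
      by measurable
    moreover have "(\<lambda>x. if x \<in> S then f (if x \<in> S then g x else 0) else 0) = (\<lambda>x. if x \<in> S then f (g x) else 0)"
      by auto
    ultimately have 1: "(\<lambda>x. if x \<in> S then f (g x) else 0) \<in> borel_measurable borel" by simp
    have 2: "(\<lambda>x. (if x \<in> S then f (g x) else 0) * ennreal (if x \<in> S then \<bar>det (matrix (g' x))\<bar> else 0)) \<in> borel_measurable borel"
      using 1 dm by measurable
    show "(\<lambda>y. (if of_wo y \<in> S then f (g (of_wo y)) else 0) * ennreal (if of_wo y \<in> S then \<bar>det (matrix (g' (of_wo y)))\<bar> else 0)) \<in> borel_measurable borel"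
      using measurable_compose[OF borel_of_wo 2] .
  qed (simp cong: if_cong)
  also have "\<dots> = (\<integral>\<^sup>+x. f (g x) * ennreal \<bar>det (matrix (g' x))\<bar> * indicator S x \<partial>lborel)"
    by (intro nn_integral_cong) (auto split: split_indicator)
  finally show ?thesis .
qed

section \<open>Lebesgue measure on subspaces\<close>

lemma linear_borel_measurable:
  fixes f :: "'a::euclidean_space \<Rightarrow> 'b::euclidean_space"
  assumes "linear f" shows "f \<in> borel_measurable borel"
  using assms by (intro borel_measurable_continuous_onI linear_continuous_on) (simp add: linear_conv_bounded_linear)

lemma nn_integral_lborel_linear:
  fixes A :: "real^'n \<Rightarrow> real^'n"
  assumes A: "linear A" and det: "det (matrix A) \<noteq> 0" and f: "f \<in> borel_measurable borel"
  shows "(\<integral>\<^sup>+x. f x \<partial>lborel) = (\<integral>\<^sup>+x. f (A x) * ennreal \<bar>det (matrix A)\<bar> \<partial>lborel)"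
proof -
  have "bij A" using invertible_eq_bij[of "matrix A"] det A by (simp add: invertible_det_nz matrix_works)
  then have "inj A" "range A = UNIV" by (auto simp: bij_def)
  then show ?thesis
    using nn_integral_change_of_variables[of UNIV A "\<lambda>_. A", OF _ linear_imp_has_derivative[OF A] _ _ _ f] by simp
qed

lemma lborel_distr_orthogonal:
  fixes Q :: "real^'n \<Rightarrow> real^'n"
  assumes Q: "orthogonal_transformation Q"
  shows "distr lborel borel Q = lborel"
proof (rule measure_eqI)
  have lin: "linear Q" using Q orthogonal_transformation_linear by blast
  note [measurable] = linear_borel_measurable[OF lin]
  have det: "\<bar>det (matrix Q)\<bar> = 1" using orthogonal_transformation_det[OF Q] .
  fix B assume "B \<in> sets (distr lborel borel Q)"
  then have [measurable]: "B \<in> sets borel" by simp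
  have "emeasure lborel B = (\<integral>\<^sup>+x. indicator B x \<partial>lborel)" by simp
  also have "\<dots> = (\<integral>\<^sup>+x. indicator B (Q x) \<partial>lborel)"
    using det by (subst nn_integral_lborel_linear[OF lin]) auto
  also have "\<dots> = (\<integral>\<^sup>+x. indicator B x \<partial>distr lborel borel Q)"
    by (subst nn_integral_distr) auto
  finally show "emeasure (distr lborel borel Q) B = emeasure lborel B" by simp
qed simp

section \<open>Lebesgue measure in orthonormal coordinates\<close>

abbreviation coord_measure :: "'a set \<Rightarrow> ('a \<Rightarrow> real) measure" where
  "coord_measure B \<equiv> \<Pi>\<^sub>M b\<in>B. lborel"

definition combine :: "'a::euclidean_space set \<Rightarrow> ('a \<Rightarrow> real) \<Rightarrow> 'a" where
  "combine B f = (\<Sum>b\<in>B. f b *\<^sub>R b)"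

lemma combine_measurable: "combine B \<in> borel_measurable (coord_measure B)"
  unfolding combine_def[abs_def] by measurable

lemma lborel_sub_combine: "lborel_sub V = distr (coord_measure (onb V)) borel (combine (onb V))"
  by (simp add: lborel_sub_def combine_def[abs_def])

interpretation lborel_product: product_sigma_finite "\<lambda>_. lborel :: real measure"
  by standard

lemma coord_measure_reindex:
  assumes e: "bij_betw e A B" and fin: "finite A"
  shows "distr (coord_measure B) (coord_measure A) (\<lambda>f. \<lambda>a\<in>A. f (e a)) = coord_measure A"
proof (rule lborel_product.PiM_eqI[OF fin])
  have eB: "e a \<in> B" if "a \<in> A" for a using e that by (auto simp: bij_betw_def)
  have finB: "finite B" using e fin bij_betw_finite by blast
  have m: "(\<lambda>f. \<lambda>a\<in>A. f (e a)) \<in> measurable (coord_measure B) (coord_measure A)"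
    using eB by (intro measurable_restrict measurable_component_singleton) auto
  fix X :: "'a \<Rightarrow> real set" assume X: "\<And>a. a \<in> A \<Longrightarrow> X a \<in> sets lborel"
  let ?Y = "\<lambda>b. X (inv_into A e b)"
  have inv: "inv_into A e (e a) = a" if "a \<in> A" for a
    using e that by (simp add: bij_betw_def)
  have pre: "(\<lambda>f. \<lambda>a\<in>A. f (e a)) -` Pi\<^sub>E A X \<inter> space (coord_measure B) = Pi\<^sub>E B ?Y"
  proof -
    have "f b \<in> ?Y b" if "b \<in> B" "\<forall>a\<in>A. f (e a) \<in> X a" for f :: "'b \<Rightarrow> real" and b
    proof -
      have "inv_into A e b \<in> A" "e (inv_into A e b) = b"
        using e that(1) by (auto simp: bij_betw_def inv_into_into f_inv_into_f)
      then show ?thesis using that(2) by metis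
    qed
    then show ?thesis using eB inv by (fastforce simp: space_PiM PiE_iff extensional_def)
  qed
  have "emeasure (distr (coord_measure B) (coord_measure A) (\<lambda>f. \<lambda>a\<in>A. f (e a))) (Pi\<^sub>E A X)
      = emeasure (coord_measure B) (Pi\<^sub>E B ?Y)"
    using X fin by (subst emeasure_distr[OF m]) (auto intro!: sets_PiM_I_finite simp: pre)
  also have "\<dots> = (\<Prod>b\<in>B. emeasure lborel (?Y b))"
    using X e by (intro lborel_product.emeasure_PiM finB) (auto simp: bij_betw_def inv_into_into)
  also have "\<dots> = (\<Prod>a\<in>A. emeasure lborel (X a))"
    by (subst prod.reindex_bij_betw[OF e, symmetric]) (auto simp: inv)
  finally show "emeasure (distr (coord_measure B) (coord_measure A) (\<lambda>f. \<lambda>a\<in>A. f (e a))) (Pi\<^sub>E A X)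
      = (\<Prod>a\<in>A. emeasure lborel (X a))" .
qed simp

text \<open>In the standard basis this is the usual product description of Lebesgue measure. An
  orthogonal \<open>Q\<close> taking \<open>Basis\<close> to \<open>U\<close> preserves the measure
  and renames the factors of the product.\<close>

lemma lborel_combine:
  fixes U :: "(real^'n) set"
  assumes U: "is_onb UNIV U"
  shows "lborel = distr (coord_measure U) borel (combine U)"
proof -
  obtain Q :: "real^'n \<Rightarrow> real^'n" where Q: "orthogonal_transformation Q"
      and bij: "bij_betw (\<lambda>i. Q (axis i 1)) UNIV U"
    by (rule orthonormal_matrix_exists[OF U])
  have lin: "linear Q" using Q orthogonal_transformation_linear by blast
  have bijB: "bij_betw (\<lambda>i. axis i 1 :: real^'n) UNIV Basis"
    by (auto simp: bij_betw_def inj_def axis_eq_axis Basis_vec_def)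
  have bQ: "bij_betw Q Basis U"
    using bij bij_betw_comp_iff[OF bijB, of Q U] by (simp add: o_def)
  let ?r = "\<lambda>f::real^'n \<Rightarrow> real. \<lambda>a\<in>Basis. f (Q a)"
  have m: "?r \<in> measurable (coord_measure U) (coord_measure Basis)"
    using bQ by (intro measurable_restrict measurable_component_singleton) (auto simp: bij_betw_def)
  have "(lborel :: (real^'n) measure) = distr (distr (coord_measure Basis) borel (combine Basis)) borel Q"
    using lborel_distr_orthogonal[OF Q] lborel_eq[where 'a="real^'n"] by (simp add: combine_def[abs_def])
  also have "\<dots> = distr (coord_measure Basis) borel (Q \<circ> combine Basis)"
    by (rule distr_distr[OF linear_borel_measurable[OF lin] combine_measurable])
  also have "\<dots> = distr (distr (coord_measure U) (coord_measure Basis) ?r) borel (Q \<circ> combine Basis)"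
    by (simp add: coord_measure_reindex[OF bQ])
  also have "\<dots> = distr (coord_measure U) borel ((Q \<circ> combine Basis) \<circ> ?r)"
    by (rule distr_distr[OF measurable_comp[OF combine_measurable linear_borel_measurable[OF lin]] m])
  also have "(Q \<circ> combine Basis) \<circ> ?r = combine U"
  proof
    fix f :: "real^'n \<Rightarrow> real"
    have "((Q \<circ> combine Basis) \<circ> ?r) f = (\<Sum>a\<in>Basis. f (Q a) *\<^sub>R Q a)"
      by (simp add: combine_def linear_sum[OF lin] linear_cmul[OF lin])
    also have "\<dots> = combine U f"
      unfolding combine_def by (rule sum.reindex_bij_betw[OF bQ, of "\<lambda>c. f c *\<^sub>R c"])
    finally show "((Q \<circ> combine Basis) \<circ> ?r) f = combine U f" .
  qed
  finally show ?thesis .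
qed

lemma sets_lborel_sub [measurable_cong, simp]: "sets (lborel_sub V) = sets borel"
  by (simp add: lborel_sub_def)

lemma space_lborel_sub [simp]: "space (lborel_sub V) = UNIV"
  by (simp add: lborel_sub_def)

lemma nn_integral_lborel_sub:
  "f \<in> borel_measurable borel \<Longrightarrow>
    (\<integral>\<^sup>+x. f x \<partial>lborel_sub V) = (\<integral>\<^sup>+c. f (combine (onb V) c) \<partial>coord_measure (onb V))"
  unfolding lborel_sub_combine by (rule nn_integral_distr[OF combine_measurable]) simp

lemma emeasure_lborel_sub:
  assumes "A \<in> sets borel"
  shows "emeasure (lborel_sub V) A
    = emeasure (coord_measure (onb V)) (combine (onb V) -` A \<inter> space (coord_measure (onb V)))"
  unfolding lborel_sub_combine by (rule emeasure_distr[OF combine_measurable assms])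

text \<open>A cylinder: only the coordinates along \<open>V\<close> are restricted, those along the
  complement are free. It has measure 1 for \<open>lborel_sub V\<close>, so its indicator turns
  integrals over the complement into integrals over the ambient space.\<close>

definition unit_cube :: "'a::euclidean_space set \<Rightarrow> 'a set" where
  "unit_cube V = {x. \<forall>b\<in>onb V. x \<bullet> b \<in> {0..1}}"

context
  fixes V :: "'a::euclidean_space set"
  assumes V: "subspace V"
begin

lemma finite_onb: "finite (onb V)"
  by (rule is_onb_finite[OF is_onb_onb[OF V]])

lemma emeasure_lborel_sub_ball_finite: "emeasure (lborel_sub V) (ball 0 r) < \<infinity>"
proof -
  let ?B = "onb V"
  have "combine ?B -` ball 0 r \<inter> space (coord_measure ?B) \<subseteq> Pi\<^sub>E ?B (\<lambda>_. {- r .. r})"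
  proof
    fix c assume c: "c \<in> combine ?B -` ball 0 r \<inter> space (coord_measure ?B)"
    have "\<bar>c b\<bar> \<le> r" if "b \<in> ?B" for b
    proof -
      have "\<bar>c b\<bar> = \<bar>combine ?B c \<bullet> b\<bar>"
        using is_onb_coeff[OF is_onb_onb[OF V] that, of c] by (simp add: combine_def)
      also have "\<dots> \<le> norm (combine ?B c) * norm b" by (rule Cauchy_Schwarz_ineq2)
      also have "\<dots> \<le> r" using is_onb_onb[OF V] that c by (simp add: is_onb_def)
      finally show ?thesis .
    qed
    then show "c \<in> Pi\<^sub>E ?B (\<lambda>_. {- r .. r})"
      using c by (auto simp: space_PiM PiE_iff abs_le_iff minus_le_iff)
  qed
  then have "emeasure (lborel_sub V) (ball 0 r) \<le> emeasure (coord_measure ?B) (Pi\<^sub>E ?B (\<lambda>_. {- r .. r}))"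
    using finite_onb by (subst emeasure_lborel_sub) (auto intro!: emeasure_mono sets_PiM_I_finite)
  also have "\<dots> = (\<Prod>b\<in>?B. emeasure lborel {- r .. r})"
    by (rule lborel_product.emeasure_PiM[OF finite_onb]) simp
  also have "\<dots> < \<infinity>" by (auto simp: emeasure_lborel_Icc_eq less_top[symmetric] power_eq_top_ennreal)
  finally show ?thesis .
qed

lemma emeasure_lborel_sub_ball_pos:
  assumes r: "r > 0"
  shows "emeasure (lborel_sub V) (ball 0 r) > 0"
proof -
  let ?B = "onb V"
  \<comment> \<open>The coordinate cube of this half side fits into the ball by the triangle
    inequality; the added 1 also covers the zero subspace, whose basis is empty.\<close>
  define \<delta> where "\<delta> = r / (card ?B + 1)"
  have \<delta>: "\<delta> > 0" "card ?B * \<delta> < r"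
    using r by (auto simp: \<delta>_def field_simps)
  have "0 < (\<Prod>b\<in>?B. emeasure lborel {- \<delta> .. \<delta>})"
    using \<delta>(1) by (auto simp: zero_less_iff_neq_zero finite_onb)
  also have "\<dots> = emeasure (coord_measure ?B) (Pi\<^sub>E ?B (\<lambda>_. {- \<delta> .. \<delta>}))"
    by (rule lborel_product.emeasure_PiM[OF finite_onb, symmetric]) simp
  also have "\<dots> \<le> emeasure (lborel_sub V) (ball 0 r)"
  proof -
    have "Pi\<^sub>E ?B (\<lambda>_. {- \<delta> .. \<delta>}) \<subseteq> combine ?B -` ball 0 r \<inter> space (coord_measure ?B)"
    proof
      fix c assume c: "c \<in> Pi\<^sub>E ?B (\<lambda>_. {- \<delta> .. \<delta>})"
      have "norm (combine ?B c) \<le> (\<Sum>b\<in>?B. norm (c b *\<^sub>R b))" unfolding combine_def by (rule norm_sum)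
      also have "\<dots> \<le> (\<Sum>b\<in>?B. \<delta>)"
        using c is_onb_onb[OF V] by (intro sum_mono) (auto simp: is_onb_def PiE_iff abs_le_iff)
      also have "\<dots> < r" using \<delta>(2) by simp
      finally show "c \<in> combine ?B -` ball 0 r \<inter> space (coord_measure ?B)"
        using c by (auto simp: space_PiM PiE_iff)
    qed
    then show ?thesis
      by (subst emeasure_lborel_sub)
        (auto intro!: emeasure_mono measurable_sets[OF combine_measurable])
  qed
  finally show ?thesis .
qed

lemma sigma_finite_lborel_sub: "sigma_finite_measure (lborel_sub V)"
proof
  let ?A = "range (\<lambda>n::nat. ball (0::'a) n)"
  have "\<exists>n::nat. norm x < n" for x :: 'a by (rule reals_Archimedean2)
  then have "\<Union> ?A = space (lborel_sub V)" by auto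
  moreover have "emeasure (lborel_sub V) a \<noteq> \<infinity>" if "a \<in> ?A" for a
    using that emeasure_lborel_sub_ball_finite by (auto simp: less_top)
  ultimately show "\<exists>A. countable A \<and> A \<subseteq> sets (lborel_sub V) \<and> \<Union> A = space (lborel_sub V) \<and>
      (\<forall>a\<in>A. emeasure (lborel_sub V) a \<noteq> \<infinity>)"
    by (intro exI[of _ ?A]) auto
qed

text \<open>The measure is defined on the ambient Borel sets but concentrated on \<open>V\<close>,
  so integrands need to be compared at points of \<open>V\<close> only.\<close>

lemma AE_lborel_sub: "AE x in lborel_sub V. x \<in> V"
proof -
  have "V \<in> sets borel" using V by (intro borel_closed closed_subspace)
  moreover have "combine (onb V) c \<in> V" for c
    unfolding combine_def using is_onb_mem[OF is_onb_onb[OF V]] V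
    by (intro subspace_sum subspace_scale) auto
  ultimately show ?thesis
    unfolding lborel_sub_combine by (subst AE_distr_iff[OF combine_measurable]) auto
qed

lemma unit_cube_borel: "unit_cube V \<in> sets borel"
proof -
  have "unit_cube V = (\<Inter>b\<in>onb V. {x. x \<bullet> b \<in> {0..1}})" by (auto simp: unit_cube_def)
  moreover have "closed {x::'a. x \<bullet> b \<in> {0..1}}" for b
  proof -
    have "{x::'a. x \<bullet> b \<in> {0..1}} = {x. 0 \<le> x \<bullet> b} \<inter> {x. x \<bullet> b \<le> 1}" by auto
    then show ?thesis by (auto intro!: closed_Int closed_Collect_le continuous_intros)
  qed
  ultimately have "closed (unit_cube V)" by auto
  then show ?thesis by (rule borel_closed)
qed

lemma emeasure_unit_cube: "emeasure (lborel_sub V) (unit_cube V) = 1"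
proof -
  let ?B = "onb V"
  have "combine ?B -` (unit_cube V) \<inter> space (coord_measure ?B) = Pi\<^sub>E ?B (\<lambda>_. {0..1})"
    using is_onb_coeff[OF is_onb_onb[OF V]]
    by (auto simp: unit_cube_def combine_def space_PiM PiE_iff)
  then have "emeasure (lborel_sub V) (unit_cube V) = (\<Prod>b\<in>?B. emeasure lborel {0..1::real})"
    by (subst emeasure_lborel_sub[OF unit_cube_borel])
      (simp add: lborel_product.emeasure_PiM[OF finite_onb])
  then show ?thesis by simp
qed

end

lemma borel_measurable_nn_integral_lborel_sub:
  fixes h :: "'a::euclidean_space \<Rightarrow> ennreal"
  assumes V: "subspace V" and h: "h \<in> borel_measurable borel"
  shows "(\<lambda>u. \<integral>\<^sup>+v. h (u + v) \<partial>lborel_sub V) \<in> borel_measurable borel"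
proof (rule sigma_finite_measure.borel_measurable_nn_integral[OF sigma_finite_lborel_sub[OF V]])
  have "(\<lambda>p::'a \<times> 'a. h (fst p + snd p)) \<in> borel_measurable (borel \<Otimes>\<^sub>M borel)"
    using h by measurable
  then show "(\<lambda>(u, v). h (u + v)) \<in> borel_measurable (borel \<Otimes>\<^sub>M lborel_sub V)"
    by (simp add: case_prod_beta' cong: measurable_cong_sets sets_pair_measure_cong)
qed

text \<open>Fubini in the orthonormal coordinates obtained by joining bases of \<open>E\<close> and
  its complement.\<close>

lemma nn_integral_lborel_split:
  fixes h :: "real^'n \<Rightarrow> ennreal"
  assumes E: "subspace E" and h: "h \<in> borel_measurable borel"
  shows "(\<integral>\<^sup>+x. h x \<partial>lborel) = (\<integral>\<^sup>+u. (\<integral>\<^sup>+v. h (u + v) \<partial>lborel_sub (orthogonal_comp E)) \<partial>lborel_sub E)"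
proof -
  let ?F = "orthogonal_comp E"
  have F: "subspace ?F" by (rule subspace_orthogonal_comp)
  note B = is_onb_onb[OF E] and C = is_onb_onb[OF F]
  let ?U = "onb E \<union> onb ?F"
  note U = is_onb_Un[OF B C]
  have fin: "finite (onb E)" "finite (onb ?F)" using finite_onb E F by auto
  have hm: "(\<lambda>c. h (combine ?U c)) \<in> borel_measurable (coord_measure ?U)"
    by (rule measurable_compose[OF combine_measurable h])
  have cm: "combine ?U (merge (onb E) (onb ?F) (x, y)) = combine (onb E) x + combine (onb ?F) y" for x y
  proof -
    have "combine ?U (merge (onb E) (onb ?F) (x, y))
        = combine (onb E) (merge (onb E) (onb ?F) (x, y)) + combine (onb ?F) (merge (onb E) (onb ?F) (x, y))"
      unfolding combine_def by (rule sum.union_disjoint[OF fin U(2)])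
    moreover have "combine (onb E) (merge (onb E) (onb ?F) (x, y)) = combine (onb E) x"
      unfolding combine_def by (intro sum.cong) (auto simp: merge_def)
    moreover have "combine (onb ?F) (merge (onb E) (onb ?F) (x, y)) = combine (onb ?F) y"
      unfolding combine_def using U(2) by (intro sum.cong) (auto simp: merge_def)
    ultimately show ?thesis by simp
  qed
  have hF: "(\<lambda>v. h (u + v)) \<in> borel_measurable borel" for u using h by measurable
  have hE: "(\<lambda>u. \<integral>\<^sup>+v. h (u + v) \<partial>lborel_sub ?F) \<in> borel_measurable borel"
    by (rule borel_measurable_nn_integral_lborel_sub[OF F h])
  have "(\<integral>\<^sup>+x. h x \<partial>lborel) = (\<integral>\<^sup>+c. h (combine ?U c) \<partial>coord_measure ?U)"
    unfolding lborel_combine[OF U(1)] by (rule nn_integral_distr[OF combine_measurable]) (simp add: h)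
  also have "\<dots> = (\<integral>\<^sup>+x. (\<integral>\<^sup>+y. h (combine (onb E) x + combine (onb ?F) y) \<partial>coord_measure (onb ?F)) \<partial>coord_measure (onb E))"
    by (subst lborel_product.product_nn_integral_fold[OF U(2) fin hm]) (simp add: cm)
  also have "\<dots> = (\<integral>\<^sup>+x. (\<integral>\<^sup>+v. h (combine (onb E) x + v) \<partial>lborel_sub ?F) \<partial>coord_measure (onb E))"
    by (simp add: nn_integral_lborel_sub[OF hF])
  also have "\<dots> = (\<integral>\<^sup>+u. (\<integral>\<^sup>+v. h (u + v) \<partial>lborel_sub ?F) \<partial>lborel_sub E)"
    by (rule nn_integral_lborel_sub[OF hE, symmetric])
  finally show ?thesis .
qed

section \<open>Linear change of variables between orthogonal complements\<close>

lemma gram_det_isometric: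
  fixes E :: "'a::euclidean_space set"
  assumes E: "subspace E" and A: "\<And>b c. b \<in> onb E \<Longrightarrow> c \<in> onb E \<Longrightarrow> A b \<bullet> A c = (if b = c then 1 else 0)"
  shows "gram_det E A = 1"
proof -
  have "gram_det E A = det_indexed ({} \<union> onb E) (\<lambda>b c. if b = c then 1 else 0)"
    unfolding gram_det_def by (simp add: A det_indexed_cong[of _ "\<lambda>b c. A b \<bullet> A c" "\<lambda>b c. if b = c then 1 else 0"])
  also have "\<dots> = det_indexed ({} :: 'a set) (\<lambda>b c. if b = c then 1 else 0)"
    using finite_onb[OF E] by (intro det_indexed_Un_identity) auto
  finally show ?thesis by (simp add: det_indexed_def)
qed

text \<open>By Fubini the cube contributes the factor
  \<open>emeasure (lborel_sub V) (unit_cube V) = 1\<close>.\<close>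

lemma nn_integral_unit_cube_product:
  fixes F :: "real^'n \<Rightarrow> ennreal"
  assumes V: "subspace V" and F: "F \<in> borel_measurable borel" and k: "k \<in> borel_measurable borel"
    and prod: "\<And>u v. u \<in> V \<Longrightarrow> v \<in> orthogonal_comp V \<Longrightarrow> F (u + v) = k v * indicator (unit_cube V) u"
  shows "(\<integral>\<^sup>+x. F x \<partial>lborel) = (\<integral>\<^sup>+v. k v \<partial>lborel_sub (orthogonal_comp V))"
proof -
  let ?V' = "orthogonal_comp V"
  have "(\<integral>\<^sup>+x. F x \<partial>lborel) = (\<integral>\<^sup>+u. (\<integral>\<^sup>+v. F (u + v) \<partial>lborel_sub ?V') \<partial>lborel_sub V)"
    by (rule nn_integral_lborel_split[OF V F])
  also have "\<dots> = (\<integral>\<^sup>+u. (\<integral>\<^sup>+v. k v \<partial>lborel_sub ?V') * indicator (unit_cube V) u \<partial>lborel_sub V)"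
  proof (rule nn_integral_cong_AE)
    show "AE u in lborel_sub V. (\<integral>\<^sup>+v. F (u + v) \<partial>lborel_sub ?V') = (\<integral>\<^sup>+v. k v \<partial>lborel_sub ?V') * indicator (unit_cube V) u"
      using AE_lborel_sub[OF V]
    proof eventually_elim
      fix u assume u: "u \<in> V"
      have "(\<integral>\<^sup>+v. F (u + v) \<partial>lborel_sub ?V') = (\<integral>\<^sup>+v. k v * indicator (unit_cube V) u \<partial>lborel_sub ?V')"
        using AE_lborel_sub[OF subspace_orthogonal_comp[of V]]
        by (intro nn_integral_cong_AE) (auto elim!: eventually_mono simp: prod[OF u])
      then show "(\<integral>\<^sup>+v. F (u + v) \<partial>lborel_sub ?V') = (\<integral>\<^sup>+v. k v \<partial>lborel_sub ?V') * indicator (unit_cube V) u"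
        using k by (simp add: nn_integral_multc)
    qed
  qed
  also have "\<dots> = (\<integral>\<^sup>+v. k v \<partial>lborel_sub ?V')"
    using unit_cube_borel[OF V] by (simp add: nn_integral_cmult emeasure_unit_cube[OF V])
  finally show ?thesis .
qed

text \<open>Extending \<open>\<nu>\<close> by an isometry \<open>E \<rightarrow> T\<close> and integrating against the indicator of the unit cube
  of \<open>T\<close> reduces the claim to the change of variables in the ambient space.\<close>

lemma nn_integral_lborel_sub_linear:
  fixes \<nu> :: "real^'n \<Rightarrow> real^'n"
  assumes E: "subspace E" and T: "subspace T" and dim: "dim E = dim T" and \<nu>: "linear \<nu>"
    and into: "\<And>x. x \<in> orthogonal_comp E \<Longrightarrow> \<nu> x \<in> orthogonal_comp T"
    and nz: "gram_det (orthogonal_comp E) \<nu> \<noteq> 0"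
    and h: "h \<in> borel_measurable borel"
  shows "(\<integral>\<^sup>+v. h v \<partial>lborel_sub (orthogonal_comp T))
    = (\<integral>\<^sup>+b. h (\<nu> b) * ennreal (sqrt (gram_det (orthogonal_comp E) \<nu>)) \<partial>lborel_sub (orthogonal_comp E))"
proof -
  let ?E' = "orthogonal_comp E" and ?T' = "orthogonal_comp T"
  have E': "subspace ?E'" and T': "subspace ?T'" by (auto simp: subspace_orthogonal_comp)
  note oE = is_onb_onb[OF E] and oT = is_onb_onb[OF T]
  have "card (onb E) = card (onb T)" using dim is_onb_card[OF oE] is_onb_card[OF oT] by simp
  then obtain \<phi> where \<phi>: "bij_betw \<phi> (onb E) (onb T)"
    using finite_same_card_bij finite_onb[OF E] finite_onb[OF T] by blast
  \<comment> \<open>Equal dimensions provide \<open>\<phi>\<close>. On \<open>E\<close> the map is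
    an isometry onto \<open>T\<close> and on the complement it is \<open>\<nu>\<close>, so the
    modulus of its determinant is exactly the factor in the claim.\<close>
  define A where "A x = (\<Sum>b\<in>onb E. (x \<bullet> b) *\<^sub>R \<phi> b) + \<nu> (x - oproj E x)" for x
  have lin1: "linear (\<lambda>x. \<Sum>b\<in>onb E. (x \<bullet> b) *\<^sub>R \<phi> b)"
    by (rule linearI) (auto simp: inner_add_left scaleR_add_left sum.distrib scaleR_sum_right)
  have lin: "linear A" unfolding A_def[abs_def]
    using linear_compose[OF linear_compose_sub[OF linear_ident linear_oproj] \<nu>, unfolded o_def]
    by (intro linear_compose_add lin1) auto
  have A\<phi>: "A b = \<phi> b" if "b \<in> onb E" for b
  proof -
    have "(\<Sum>c\<in>onb E. (b \<bullet> c) *\<^sub>R \<phi> c) = (\<Sum>c\<in>onb E. if c = b then \<phi> c else 0)"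
      by (rule sum.cong) (auto simp: is_onb_inner[OF oE that])
    then show ?thesis
      using that finite_onb[OF E] is_onb_mem[OF oE that] by (simp add: A_def oproj_id[OF E] linear_0[OF \<nu>])
  qed
  have A\<nu>: "A b = \<nu> b" if "b \<in> ?E'" for b
    using that inner_perp[OF E is_onb_mem[OF oE]] by (simp add: A_def oproj_perp[OF E] inner_commute)
  have AE: "A x \<in> T" if "x \<in> E" for x
    using that \<phi> is_onb_mem[OF oT] T unfolding A_def
    by (auto simp: oproj_id[OF E] linear_0[OF \<nu>] bij_betw_def intro!: subspace_sum subspace_scale)
  have "gram_det E A = 1"
  proof (rule gram_det_isometric[OF E])
    fix b c assume bc: "b \<in> onb E" "c \<in> onb E"
    then have "\<phi> b \<in> onb T" "\<phi> c \<in> onb T" "\<phi> b = \<phi> c \<longleftrightarrow> b = c"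
      using \<phi> by (auto simp: bij_betw_def inj_on_def)
    then show "A b \<bullet> A c = (if b = c then 1 else 0)" using bc by (simp add: A\<phi> is_onb_inner[OF oT])
  qed
  moreover have "gram_det ?E' A = gram_det ?E' \<nu>"
    unfolding gram_det_def using is_onb_mem[OF is_onb_onb[OF E']] by (intro det_indexed_cong) (simp add: A\<nu>)
  moreover have "\<bar>det (matrix A)\<bar> = sqrt (gram_det E A) * sqrt (gram_det ?E' A)"
    using inner_perp[OF T AE into] by (intro gram_det_block[OF E lin]) (simp add: A\<nu>)
  ultimately have det: "\<bar>det (matrix A)\<bar> = sqrt (gram_det ?E' \<nu>)" by simp
  \<comment> \<open>Depends on the \<open>T\<close>-part of \<open>x\<close> only through the unit
    cube and on the normal part only through \<open>h\<close>. Since \<open>A\<close> matches the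
    two cubes, composing with \<open>A\<close> gives the same product form over
    \<open>E\<close>.\<close>
  define F where "F x = indicator (unit_cube T) x * h (x - oproj T x)" for x
  note [measurable] = h unit_cube_borel[OF T] unit_cube_borel[OF E] linear_borel_measurable[OF linear_oproj]
    linear_borel_measurable[OF lin] linear_borel_measurable[OF \<nu>]
  have Fm[measurable]: "F \<in> borel_measurable borel" unfolding F_def[abs_def] by measurable
  have cubeT: "u + v \<in> unit_cube T \<longleftrightarrow> u \<in> unit_cube T" if "v \<in> ?T'" for u v
  proof -
    have "v \<bullet> b = 0" if "b \<in> onb T" for b
      using inner_perp[OF T is_onb_mem[OF oT that] \<open>v \<in> ?T'\<close>] by (simp add: inner_commute)
    then show ?thesis by (simp add: unit_cube_def inner_add_left)
  qed
  have cubeE: "A u \<in> unit_cube T \<longleftrightarrow> u \<in> unit_cube E" if u: "u \<in> E" for u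
  proof -
    have "A u \<bullet> \<phi> b = u \<bullet> b" if b: "b \<in> onb E" for b
    proof -
      have "A u \<bullet> \<phi> b = (\<Sum>c\<in>onb E. (u \<bullet> c) * (\<phi> c \<bullet> \<phi> b))"
        using u by (simp add: A_def oproj_id[OF E] linear_0[OF \<nu>] inner_sum_left)
      also have "\<dots> = (\<Sum>c\<in>onb E. if c = b then u \<bullet> c else 0)"
      proof (rule sum.cong[OF refl])
        fix c assume c: "c \<in> onb E"
        then have "\<phi> c \<in> onb T" "\<phi> b \<in> onb T" "\<phi> c = \<phi> b \<longleftrightarrow> c = b"
          using \<phi> b by (auto simp: bij_betw_def inj_on_def)
        then show "(u \<bullet> c) * (\<phi> c \<bullet> \<phi> b) = (if c = b then u \<bullet> c else 0)" by (simp add: is_onb_inner[OF oT])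
      qed
      finally show ?thesis using b finite_onb[OF E] by simp
    qed
    moreover have "onb T = \<phi> ` onb E" using \<phi> by (simp add: bij_betw_def)
    ultimately show ?thesis by (simp add: unit_cube_def unit_cube_def)
  qed
  have lhs: "(\<integral>\<^sup>+x. F x \<partial>lborel) = (\<integral>\<^sup>+v. h v \<partial>lborel_sub ?T')"
    by (rule nn_integral_unit_cube_product[OF T Fm h]) (simp add: F_def oproj_add[OF T] cubeT indicator_def)
  let ?s = "ennreal (sqrt (gram_det ?E' \<nu>))"
  have rhs: "(\<integral>\<^sup>+x. F (A x) * ?s \<partial>lborel) = (\<integral>\<^sup>+b. h (\<nu> b) * ?s \<partial>lborel_sub ?E')"
  proof (rule nn_integral_unit_cube_product[OF E])
    fix u b assume u: "u \<in> E" and b: "b \<in> ?E'"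
    show "F (A (u + b)) * ?s = h (\<nu> b) * ?s * indicator (unit_cube E) u"
      using oproj_add[OF T AE[OF u] into[OF b]] cubeT[OF into[OF b], of "A u"]
      by (simp add: F_def linear_add[OF lin] A\<nu>[OF b] cubeE[OF u] indicator_def)
  qed measurable
  have "det (matrix A) \<noteq> 0" using det nz by auto
  from nn_integral_lborel_linear[OF lin this Fm] show ?thesis
    by (simp only: lhs rhs det)
qed

section \<open>Sets of positive reach\<close>

text \<open>Since \<open>infdist x M\<close> lies strictly below the supremum, some admissible
  \<open>\<tau>\<close> lies above it.\<close>

lemma reach_unique_nearest:
  assumes "reach M \<ge> ereal t0" "infdist x M < t0"
  shows "\<exists>!a. a \<in> M \<and> dist x a = infdist x M"
proof -
  have "ereal (infdist x M) < reach M" using assms by (metis ereal_less_eq(3) less_le_trans less_ereal.simps(1))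
  then obtain \<tau> where "infdist x M < \<tau>"
      "\<forall>x. infdist x M < \<tau> \<longrightarrow> (\<exists>!a. a \<in> M \<and> dist x a = infdist x M)"
    unfolding reach_def less_Sup_iff by auto
  then show ?thesis by blast
qed

locale positive_reach =
  fixes M :: "'a::euclidean_space set" and t0 :: real
  assumes compact: "compact M" and t0: "t0 > 0" and reach_ge: "reach M \<ge> ereal t0"
begin

text \<open>\<open>infdist\<close> to the empty set is 0 by convention, so a positive reach demands
  a nearest point that the empty set cannot supply.\<close>

lemma nonempty: "M \<noteq> {}"
  using reach_unique_nearest[OF reach_ge, of 0] t0 by (auto simp: infdist_def)

lemma closed: "closed M" by (rule compact_imp_closed[OF compact])

abbreviation "nearest \<equiv> closest_point M"

lemma nearest_mem: "nearest x \<in> M"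
  using closest_point_exists[OF closed nonempty] by blast

lemma dist_nearest: "dist x (nearest x) = infdist x M"
proof (rule antisym)
  show "infdist x M \<le> dist x (nearest x)" by (rule infdist_le[OF nearest_mem])
  show "dist x (nearest x) \<le> infdist x M"
    unfolding infdist_notempty[OF nonempty]
    by (intro cINF_greatest nonempty closest_point_le[OF closed])
qed

lemma nearest_unique: "infdist x M < t0 \<Longrightarrow> a \<in> M \<Longrightarrow> dist x a = infdist x M \<Longrightarrow> nearest x = a"
  using reach_unique_nearest[OF reach_ge] nearest_mem dist_nearest by blast

text \<open>By uniqueness the graph of \<open>nearest\<close> is cut out by the closed condition
  \<open>dist x a = infdist x M\<close>; a map into a compact set with closed graph is
  continuous.\<close>

lemma continuous_on_nearest: "continuous_on {x. infdist x M < t0} nearest"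
proof -
  let ?S = "{x. infdist x M < t0}"
  have cl: "closed {p::'a \<times> 'a. dist (fst p) (snd p) = infdist (fst p) M}"
    by (intro closed_Collect_eq continuous_intros)
  have eq: "(\<lambda>x. (x, nearest x)) ` ?S = (?S \<times> M) \<inter> {p. dist (fst p) (snd p) = infdist (fst p) M}"
    using nearest_mem dist_nearest nearest_unique by (auto simp: image_iff)
  have c: "closedin (top_of_set (?S \<times> M)) ((\<lambda>x. (x, nearest x)) ` ?S)"
    unfolding eq by (rule closedin_closed_Int[OF cl])
  have "nearest \<in> ?S \<rightarrow> M" using nearest_mem by auto
  from continuous_closed_graph_eq[OF compact this] c show ?thesis by simp
qed

text \<open>Step away from the nearest point in the unit direction \<open>e\<close>. By continuity
  the nearest point \<open>a\<close> of the new position is close to the old one, so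
  \<open>e \<bullet> (p - a)\<close> is almost \<open>infdist p M\<close>, and expanding the squared
  distance shows growth at any rate below 1.\<close>

lemma infdist_increases:
  assumes p: "0 < infdist p M" "infdist p M < t0" and c: "0 < c" "c < 1" and \<epsilon>: "\<epsilon> > 0"
  obtains s where "0 < s" "s < \<epsilon>"
    "infdist (p + s *\<^sub>R ((p - nearest p) /\<^sub>R infdist p M)) M \<ge> infdist p M + c * s"
proof -
  define \<rho> where "\<rho> = infdist p M"
  define e where "e = (p - nearest p) /\<^sub>R \<rho>"
  let ?S = "{x. infdist x M < t0}"
  have \<rho>: "0 < \<rho>" using p by (simp add: \<rho>_def)
  have np: "norm (p - nearest p) = \<rho>" using dist_nearest[of p] by (simp add: \<rho>_def dist_norm)
  have ne: "norm e = 1" using np \<rho> by (simp add: e_def)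
  have ep: "e \<bullet> (p - nearest p) = \<rho>"
    using np \<rho> by (simp add: e_def dot_square_norm power2_eq_square)
  have op: "open ?S" by (intro open_Collect_less continuous_intros)
  have "isCont nearest p"
    using continuous_on_nearest op p(2) continuous_on_eq_continuous_at by blast
  then have "isCont (\<lambda>s. nearest (p + s *\<^sub>R e)) 0"
    by (intro isCont_o2[of 0 "\<lambda>s. p + s *\<^sub>R e" nearest]) (auto intro!: continuous_intros)
  then have cont: "isCont (\<lambda>s. e \<bullet> (p - nearest (p + s *\<^sub>R e))) 0"
    by (intro continuous_intros)
  have "\<forall>\<^sub>F s in at 0. e \<bullet> (p - nearest (p + s *\<^sub>R e)) > c * \<rho>"
    by (rule order_tendstoD(1)[OF isContD[OF cont]]) (use ep \<rho> c in simp)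
  then obtain \<delta> where \<delta>: "\<delta> > 0" "\<And>s. s \<noteq> 0 \<Longrightarrow> dist s 0 < \<delta> \<Longrightarrow> e \<bullet> (p - nearest (p + s *\<^sub>R e)) > c * \<rho>"
    unfolding eventually_at by auto
  define s where "s = min \<delta> \<epsilon> / 2"
  have s: "0 < s" "s < \<epsilon>" "s < \<delta>" using \<delta>(1) \<epsilon> by (auto simp: s_def)
  let ?a = "nearest (p + s *\<^sub>R e)"
  have gt: "e \<bullet> (p - ?a) > c * \<rho>" using \<delta>(2)[of s] s by simp
  have "(infdist (p + s *\<^sub>R e) M)\<^sup>2 = (norm ((p - ?a) + s *\<^sub>R e))\<^sup>2"
    using dist_nearest[of "p + s *\<^sub>R e"] by (simp add: dist_norm algebra_simps)
  also have "\<dots> = (norm (p - ?a))\<^sup>2 + 2 * s * (e \<bullet> (p - ?a)) + s\<^sup>2"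
  proof -
    have "e \<bullet> e = 1" using ne by (simp add: dot_square_norm)
    then show ?thesis unfolding power2_norm_eq_inner
      by (simp add: inner_add_left inner_add_right inner_commute power2_eq_square)
  qed
  also have "\<dots> \<ge> \<rho>\<^sup>2 + 2 * s * (c * \<rho>) + c\<^sup>2 * s\<^sup>2"
  proof -
    have "\<rho> \<le> norm (p - ?a)" using infdist_le[OF nearest_mem, of p "p + s *\<^sub>R e"] by (simp add: \<rho>_def dist_norm)
    then have "\<rho>\<^sup>2 \<le> (norm (p - ?a))\<^sup>2" using \<rho> by (intro power_mono) auto
    moreover have "2 * s * (c * \<rho>) \<le> 2 * s * (e \<bullet> (p - ?a))" using gt s by (intro mult_left_mono) auto
    moreover have "c\<^sup>2 * s\<^sup>2 \<le> 1 * s\<^sup>2" using c by (intro mult_right_mono power_le_one) auto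
    ultimately show ?thesis by simp
  qed
  finally have "(\<rho> + c * s)\<^sup>2 \<le> (infdist (p + s *\<^sub>R e) M)\<^sup>2"
    by (simp add: power2_eq_square algebra_simps)
  then have "\<rho> + c * s \<le> infdist (p + s *\<^sub>R e) M"
    by (rule power2_le_imp_le) (rule infdist_nonneg)
  then show ?thesis using that s by (simp add: e_def \<rho>_def)
qed

text \<open>A maximum point \<open>z\<close> of \<open>infdist z M - c * dist z x\<close> on the ball of radius \<open>T\<close> cannot lie in
  the interior, because one could still move away from \<open>M\<close>.\<close>

lemma infdist_attains_growth:
  assumes x: "0 < infdist x M" "infdist x M + T < t0" and T: "T \<ge> 0"
  obtains x' where "dist x' x \<le> T" "infdist x' M \<ge> infdist x M + T"
proof -
  have grow: "\<exists>z\<in>cball x T. infdist z M \<ge> infdist x M + c * T" if c: "0 < c" "c < 1" for c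
  proof -
    let ?\<phi> = "\<lambda>z. infdist z M - c * dist z x"
    have cont: "continuous_on (cball x T) ?\<phi>" by (intro continuous_intros)
    have "x \<in> cball x T" using T by simp
    then obtain z where z: "z \<in> cball x T" and max: "\<And>w. w \<in> cball x T \<Longrightarrow> ?\<phi> w \<le> ?\<phi> z"
      using continuous_attains_sup[OF compact_cball _ cont] by blast
    have zx: "infdist z M \<ge> infdist x M + c * dist z x" using max[OF \<open>x \<in> cball x T\<close>] by simp
    have "dist z x = T"
    proof (rule ccontr)
      assume "dist z x \<noteq> T"
      then have lt: "dist z x < T" using z by (simp add: dist_commute)
      have "infdist z M \<le> infdist x M + dist z x" using infdist_triangle[of z M x] .
      then have zt: "infdist z M < t0" using lt x by simp
      have z0: "0 < infdist z M"
      proof -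
        have "0 \<le> c * dist z x" using c by simp
        then show ?thesis using zx x by linarith
      qed
      \<comment> \<open>The midpoint of \<open>c\<close> and 1 is a growth rate strictly larger than
        the penalty \<open>c\<close>, so the step increases the function that \<open>z\<close>
        maximizes.\<close>
      have c': "0 < (1 + c) / 2" "(1 + c) / 2 < 1" "T - dist z x > 0" using c lt by auto
      define e where "e = (z - nearest z) /\<^sub>R infdist z M"
      obtain s where s: "0 < s" "s < T - dist z x" "infdist (z + s *\<^sub>R e) M \<ge> infdist z M + (1 + c) / 2 * s"
        using infdist_increases[OF z0 zt c'] unfolding e_def by metis
      have "norm e = 1" using dist_nearest[of z] z0 by (simp add: dist_norm e_def)
      then have d: "dist (z + s *\<^sub>R e) x \<le> dist z x + s"
        using dist_triangle[of "z + s *\<^sub>R e" x z] s(1) by (simp add: dist_norm)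
      then have "z + s *\<^sub>R e \<in> cball x T" using s by (simp add: dist_commute)
      from max[OF this] have "(1 + c) / 2 * s \<le> c * dist (z + s *\<^sub>R e) x - c * dist z x" using s(3) by linarith
      also have "\<dots> \<le> c * s" using d c by (simp flip: right_diff_distrib)
      finally show False using s(1) c by (simp add: field_simps)
    qed
    then show ?thesis using z zx by auto
  qed
  \<comment> \<open>The point found above depends on \<open>c\<close>. A maximum point of
    \<open>infdist\<close> on the ball serves all \<open>c\<close> at once, and then
    \<open>c\<close> tends to 1.\<close>
  have "continuous_on (cball x T) (\<lambda>z. infdist z M)" by (intro continuous_intros)
  then obtain x' where x': "x' \<in> cball x T" and max: "\<And>w. w \<in> cball x T \<Longrightarrow> infdist w M \<le> infdist x' M"
    using continuous_attains_sup[OF compact_cball, of x T "\<lambda>z. infdist z M"] T by auto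
  have "infdist x M + c * T \<le> infdist x' M" if "0 < c" "c < 1" for c
    using grow[OF that] max by force
  then have "\<forall>\<^sub>F c in at_left (1::real). infdist x M + c * T \<le> infdist x' M"
    unfolding eventually_at_left_field by (intro exI[of _ 0]) auto
  then have "infdist x M + 1 * T \<le> infdist x' M"
    by (intro tendsto_upperbound[of "\<lambda>c. infdist x M + c * T" _ "at_left 1"] tendsto_intros) auto
  then show ?thesis using that x' by (simp add: dist_commute)
qed

lemma infdist_normal_ray:
  assumes a: "a \<in> M" and e: "norm e = 1" and t: "0 < t" and ta: "infdist (a + t *\<^sub>R e) M = t"
    and s: "t \<le> s" "s < t0"
  shows "infdist (a + s *\<^sub>R e) M = s"
proof -
  let ?x = "a + t *\<^sub>R e"
  obtain x' where x': "dist x' ?x \<le> s - t" "infdist x' M \<ge> infdist ?x M + (s - t)"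
    using infdist_attains_growth[of ?x "s - t"] ta t s by auto
  have 1: "norm (x' - a) \<ge> s" using infdist_le[OF a, of x'] x'(2) ta by (simp add: dist_norm)
  have 2: "norm (t *\<^sub>R e) = t" "norm (x' - ?x) \<le> s - t" using e t x'(1) by (auto simp: dist_norm)
  have 3: "x' - a = (x' - ?x) + t *\<^sub>R e" by simp
  \<comment> \<open>The end points are at distance at least \<open>s\<close>, while the two pieces
    have lengths at most \<open>s - t\<close> and exactly \<open>t\<close>: there is no slack in the
    triangle inequality.\<close>
  have 4: "norm ((x' - ?x) + t *\<^sub>R e) = norm (x' - ?x) + norm (t *\<^sub>R e)" and 5: "norm (x' - ?x) = s - t"
    using 1 2 norm_triangle_ineq[of "x' - ?x" "t *\<^sub>R e"] unfolding 3 by linarith+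
  have "(s - t) *\<^sub>R (t *\<^sub>R e) = t *\<^sub>R (x' - ?x)"
    using 4[unfolded norm_triangle_eq] unfolding 2(1) 5 .
  then have "t *\<^sub>R ((s - t) *\<^sub>R e) = t *\<^sub>R (x' - ?x)" by (simp add: mult.commute)
  then have "x' - ?x = (s - t) *\<^sub>R e" using t scaleR_cancel_left[of t] by (metis less_irrefl)
  then have "x' = a + s *\<^sub>R e" by (simp add: algebra_simps)
  moreover have "infdist (a + s *\<^sub>R e) M \<le> s" using infdist_le[OF a, of "a + s *\<^sub>R e"] e t s by (simp add: dist_norm)
  ultimately show ?thesis using x'(2) ta by simp
qed

text \<open>The hypothesis \<open>loc\<close>, with an arbitrary constant \<open>C\<close>, makes
  \<open>y\<close> a nearest point of \<open>y + t *\<^sub>R e\<close> for one small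
  \<open>t\<close>. The ray lemma extends this to all radii below \<open>t0\<close>, which replaces
  \<open>C\<close> by the constant dictated by the reach.\<close>

theorem federer_inequality:
  assumes y: "y \<in> M" and z: "z \<in> M" and loc: "\<And>z. z \<in> M \<Longrightarrow> n \<bullet> (z - y) \<le> C * (norm (z - y))\<^sup>2"
  shows "n \<bullet> (z - y) \<le> norm n * (norm (z - y))\<^sup>2 / (2 * t0)"
proof (cases "n = 0")
  case False
  define e where "e = n /\<^sub>R norm n"
  \<comment> \<open>Normalizing \<open>n\<close> divides \<open>C\<close> by \<open>norm n\<close>;
    the added 1 keeps \<open>D\<close> positive when \<open>C\<close> is 0.\<close>
  define D where "D = \<bar>C\<bar> / norm n + 1"
  have e: "norm e = 1" "n = norm n *\<^sub>R e" using False by (auto simp: e_def)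
  have D: "D > 0" "e \<bullet> (w - y) \<le> D * (norm (w - y))\<^sup>2" if "w \<in> M" for w
  proof -
    show "D > 0" using False by (auto simp: D_def intro!: add_nonneg_pos)
    have "e \<bullet> (w - y) = (n \<bullet> (w - y)) / norm n" by (simp add: e_def divide_inverse)
    also have "\<dots> \<le> \<bar>C\<bar> * (norm (w - y))\<^sup>2 / norm n"
      using loc[OF that] by (intro divide_right_mono) (auto intro: order_trans[OF _ mult_right_mono])
    also have "\<dots> \<le> D * (norm (w - y))\<^sup>2" by (simp add: D_def distrib_right)
    finally show "e \<bullet> (w - y) \<le> D * (norm (w - y))\<^sup>2" .
  qed
  \<comment> \<open>The bound \<open>2 * t * D \<le> 1\<close> lets the quadratic term dominate the
    linear one, so no point of \<open>M\<close> is closer to \<open>y + t *\<^sub>R e\<close> than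
    \<open>y\<close>.\<close>
  define t where "t = min (1 / (2 * D)) (t0 / 2)"
  have t: "0 < t" "t < t0" "2 * t * D \<le> 1"
    using D(1)[OF y] t0 by (auto simp: t_def min_def field_simps)
  have sq: "(dist (y + s *\<^sub>R e) w)\<^sup>2 = s\<^sup>2 - 2 * s * (e \<bullet> (w - y)) + (norm (w - y))\<^sup>2" for s w
  proof -
    have "(dist (y + s *\<^sub>R e) w)\<^sup>2 = (norm (s *\<^sub>R e - (w - y)))\<^sup>2" by (simp add: dist_norm algebra_simps)
    also have "\<dots> = s\<^sup>2 * (e \<bullet> e) - 2 * s * (e \<bullet> (w - y)) + (norm (w - y))\<^sup>2"
      by (simp only: dot_square_norm[symmetric] inner_diff_left inner_diff_right inner_scaleR_left inner_scaleR_right)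
        (simp add: power2_eq_square inner_commute algebra_simps)
    finally show ?thesis using e(1) by (simp add: dot_square_norm)
  qed
  have "infdist (y + t *\<^sub>R e) M = t"
  proof (rule antisym)
    show "infdist (y + t *\<^sub>R e) M \<le> t" using infdist_le[OF y, of "y + t *\<^sub>R e"] e(1) t by (simp add: dist_norm)
    show "t \<le> infdist (y + t *\<^sub>R e) M"
      unfolding infdist_notempty[OF nonempty]
    proof (intro cINF_greatest nonempty)
      fix w assume w: "w \<in> M"
      have "2 * t * (e \<bullet> (w - y)) \<le> 2 * t * (D * (norm (w - y))\<^sup>2)"
        using D(2)[OF w] t by (intro mult_left_mono) auto
      also have "\<dots> \<le> 1 * (norm (w - y))\<^sup>2"
        using t(3) by (simp only: mult.assoc[symmetric]) (intro mult_right_mono, auto)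
      finally have "t\<^sup>2 \<le> (dist (y + t *\<^sub>R e) w)\<^sup>2" unfolding sq by simp
      then show "t \<le> dist (y + t *\<^sub>R e) w" by (rule power2_le_imp_le) simp
    qed
  qed
  have "2 * s * (e \<bullet> (z - y)) \<le> (norm (z - y))\<^sup>2" if s: "t \<le> s" "s < t0" for s
  proof -
    have "s \<le> dist (y + s *\<^sub>R e) z"
      using infdist_normal_ray[OF y e(1) t(1) \<open>infdist (y + t *\<^sub>R e) M = t\<close> s] infdist_le[OF z, of "y + s *\<^sub>R e"] by simp
    then have "s\<^sup>2 \<le> (dist (y + s *\<^sub>R e) z)\<^sup>2" using s t by (intro power_mono) auto
    then show ?thesis unfolding sq by simp
  qed
  \<comment> \<open>The ray lemma requires \<open>s < t0\<close>, so the radius \<open>t0\<close> is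
    reached as a limit from the left.\<close>
  then have "\<forall>\<^sub>F s in at_left t0. 2 * s * (e \<bullet> (z - y)) \<le> (norm (z - y))\<^sup>2"
    unfolding eventually_at_left_field using t(2) by (intro exI[of _ t]) auto
  then have "2 * t0 * (e \<bullet> (z - y)) \<le> (norm (z - y))\<^sup>2"
    by (intro tendsto_upperbound[of "\<lambda>s. 2 * s * (e \<bullet> (z - y))" _ "at_left t0"] tendsto_intros) auto
  then have "e \<bullet> (z - y) \<le> (norm (z - y))\<^sup>2 / (2 * t0)" using t0 by (simp add: field_simps)
  then have "norm n * (e \<bullet> (z - y)) \<le> norm n * ((norm (z - y))\<^sup>2 / (2 * t0))" by (intro mult_left_mono) auto
  then show ?thesis by (subst e(2)) simp
qed simp

text \<open>For \<open>norm v < t0\<close> the linear term in the squared distance from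
  \<open>y + v\<close> to \<open>z\<close> is absorbed by \<open>(norm (z - y))\<^sup>2\<close>, so
  no point of \<open>M\<close> is nearer than \<open>y\<close>; uniqueness comes from the
  reach.\<close>

lemma nearest_add_normal:
  assumes y: "y \<in> M" and v: "norm v < t0"
    and fed: "\<And>z. z \<in> M \<Longrightarrow> v \<bullet> (z - y) \<le> norm v * (norm (z - y))\<^sup>2 / (2 * t0)"
  shows "nearest (y + v) = y" "infdist (y + v) M = norm v"
proof -
  have le: "norm v \<le> dist (y + v) z" if z: "z \<in> M" for z
  proof (rule power2_le_imp_le)
    have "norm v / t0 \<le> 1" using v t0 by simp
    then have "norm v / t0 * (norm (z - y))\<^sup>2 \<le> 1 * (norm (z - y))\<^sup>2" by (intro mult_right_mono) auto
    then have "norm v * (norm (z - y))\<^sup>2 / (2 * t0) \<le> (norm (z - y))\<^sup>2 / 2"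
      using t0 by (simp add: field_simps)
    then have "2 * (v \<bullet> (z - y)) \<le> (norm (z - y))\<^sup>2" using fed[OF z] by linarith
    moreover have "(dist (y + v) z)\<^sup>2 = (norm v)\<^sup>2 - 2 * (v \<bullet> (z - y)) + (norm (z - y))\<^sup>2"
    proof -
      have "(dist (y + v) z)\<^sup>2 = (norm (v - (z - y)))\<^sup>2" by (simp add: dist_norm algebra_simps)
      then show ?thesis
        by (simp only: dot_square_norm[symmetric] inner_diff_left inner_diff_right) (simp add: inner_commute)
    qed
    ultimately show "(norm v)\<^sup>2 \<le> (dist (y + v) z)\<^sup>2" by simp
  qed simp
  have "norm v \<le> infdist (y + v) M"
    unfolding infdist_notempty[OF nonempty] by (intro cINF_greatest nonempty le)
  then show inf: "infdist (y + v) M = norm v" using infdist_le[OF y, of "y + v"] by (simp add: dist_norm)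
  show "nearest (y + v) = y" by (rule nearest_unique) (use inf v y in \<open>auto simp: dist_norm\<close>)
qed

end

section \<open>Slice charts and the second fundamental form\<close>

text \<open>The second difference of \<open>f\<close> in directions \<open>a\<close> and
  \<open>c\<close> is symmetric, and divided by \<open>t\<^sup>2\<close> it tends to either mixed
  derivative. Testing against a vector \<open>n\<close> makes the real mean value theorem available;
  \<open>f'\<close> is differentiated at the single point \<open>u\<close> only.\<close>

lemma second_derivative_symmetric:
  fixes f :: "'a::real_normed_vector \<Rightarrow> 'b::real_inner" and f' :: "'a \<Rightarrow> 'a \<Rightarrow>\<^sub>L 'b"
  assumes W: "open W" "u \<in> W" and f: "\<And>x. x \<in> W \<Longrightarrow> (f has_derivative f' x) (at x)"
    and f': "(f' has_derivative f'') (at u)"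
  shows "f'' a c = f'' c a"
proof -
  have lin: "linear f''" using f' has_derivative_linear by blast
  have est: "\<exists>T>0. \<forall>t. 0 < t \<longrightarrow> t < T \<longrightarrow>
      \<bar>n \<bullet> (f (u + t *\<^sub>R a + t *\<^sub>R c) - f (u + t *\<^sub>R a) - f (u + t *\<^sub>R c) + f u) - t\<^sup>2 * (n \<bullet> f'' c a)\<bar>
        \<le> 2 * \<epsilon> * norm n * (norm a + norm c)\<^sup>2 * t\<^sup>2" if \<epsilon>: "\<epsilon> > 0" for a c n \<epsilon>
  proof -
    \<comment> \<open>Strictly positive even if both directions vanish, since it appears as a
      divisor.\<close>
    define N where "N = norm a + norm c + 1"
    have N: "N > 0" by (simp add: N_def add_nonneg_pos)
    obtain \<delta> where \<delta>: "\<delta> > 0" "\<And>x. norm (x - u) < \<delta> \<Longrightarrow> norm (f' x - f' u - f'' (x - u)) \<le> \<epsilon> * norm (x - u)"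
      using f' \<epsilon> unfolding has_derivative_at_alt by blast
    obtain \<delta>' where \<delta>': "\<delta>' > 0" "ball u \<delta>' \<subseteq> W" using W open_contains_ball by blast
    define T where "T = min \<delta> \<delta>' / N"
    have T: "T > 0" using N \<delta>(1) \<delta>'(1) by (simp add: T_def)
    show ?thesis
    proof (intro exI[of _ T] conjI T allI impI)
      fix t :: real assume t: "0 < t" "t < T"
      have bound: "norm (s *\<^sub>R a + r *\<^sub>R c) \<le> t * (norm a + norm c) \<and> norm (s *\<^sub>R a + r *\<^sub>R c) < min \<delta> \<delta>'"
        if "0 \<le> s" "s \<le> t" "0 \<le> r" "r \<le> t" for s r
      proof -
        have "norm (s *\<^sub>R a + r *\<^sub>R c) \<le> s * norm a + r * norm c"
          using norm_triangle_ineq[of "s *\<^sub>R a" "r *\<^sub>R c"] that by simp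
        also have "\<dots> \<le> t * norm a + t * norm c" using that by (intro add_mono mult_right_mono) auto
        finally have 1: "norm (s *\<^sub>R a + r *\<^sub>R c) \<le> t * (norm a + norm c)" by (simp add: distrib_left)
        also have "\<dots> < t * N" using t by (simp add: N_def)
        also have "\<dots> < min \<delta> \<delta>'" using t N by (simp add: T_def pos_less_divide_eq)
        finally show ?thesis using 1 by simp
      qed
      define h where "h s = n \<bullet> (f (u + s *\<^sub>R a + t *\<^sub>R c) - f (u + s *\<^sub>R a))" for s
      have inW: "u + s *\<^sub>R a + t *\<^sub>R c \<in> W" "u + s *\<^sub>R a \<in> W" if "0 \<le> s" "s \<le> t" for s
      proof -
        have "u + k \<in> W" if "norm k < \<delta>'" for k
          using \<delta>'(2) that by (auto simp: subset_iff dist_norm)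
        from this[of "s *\<^sub>R a + t *\<^sub>R c"] this[of "s *\<^sub>R a + 0 *\<^sub>R c"]
        show "u + s *\<^sub>R a + t *\<^sub>R c \<in> W" "u + s *\<^sub>R a \<in> W"
          using bound[of s t] bound[of s 0] that t by (auto simp: add.assoc)
      qed
      have der: "(h has_real_derivative n \<bullet> (f' (u + s *\<^sub>R a + t *\<^sub>R c) a - f' (u + s *\<^sub>R a) a)) (at s)"
        if s: "0 \<le> s" "s \<le> t" for s
      proof -
        have 1: "((\<lambda>s. u + s *\<^sub>R a + t *\<^sub>R c) has_derivative (\<lambda>x. x *\<^sub>R a)) (at s)"
          "((\<lambda>s. u + s *\<^sub>R a) has_derivative (\<lambda>x. x *\<^sub>R a)) (at s)"
          by (auto intro!: derivative_eq_intros)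
        have "((\<lambda>s. f (u + s *\<^sub>R a + t *\<^sub>R c) - f (u + s *\<^sub>R a)) has_derivative
            (\<lambda>x. f' (u + s *\<^sub>R a + t *\<^sub>R c) (x *\<^sub>R a) - f' (u + s *\<^sub>R a) (x *\<^sub>R a))) (at s)"
          using diff_chain_at[OF 1(1) f[OF inW(1)[OF s]]] diff_chain_at[OF 1(2) f[OF inW(2)[OF s]]]
          by (intro has_derivative_diff) (simp_all add: o_def)
        from has_derivative_inner_right[OF this, of n] show ?thesis
          unfolding h_def[abs_def] has_field_derivative_def
          by (rule has_derivative_eq_rhs) (auto simp: blinfun.scaleR_right inner_diff_right algebra_simps)
      qed
      \<comment> \<open>The mean value theorem in direction \<open>a\<close> is applied to the
        increment of \<open>f\<close> in direction \<open>c\<close>; what remains is a difference of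
        first derivatives, which \<open>f''\<close> controls.\<close>
      obtain \<xi> where \<xi>: "0 < \<xi>" "\<xi> < t"
          "h t - h 0 = (t - 0) * (n \<bullet> (f' (u + \<xi> *\<^sub>R a + t *\<^sub>R c) a - f' (u + \<xi> *\<^sub>R a) a))"
        using MVT2[OF t(1) der] by blast
      define r where "r k = f' (u + k) - f' u - f'' k" for k
      have r: "norm (r (\<xi> *\<^sub>R a + s *\<^sub>R c)) \<le> \<epsilon> * (t * (norm a + norm c))" if "0 \<le> s" "s \<le> t" for s
      proof -
        have "norm (r (\<xi> *\<^sub>R a + s *\<^sub>R c)) \<le> \<epsilon> * norm (\<xi> *\<^sub>R a + s *\<^sub>R c)"
          unfolding r_def using \<delta>(2)[of "u + (\<xi> *\<^sub>R a + s *\<^sub>R c)"] bound[of \<xi> s] \<xi> that by simp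
        also have "\<dots> \<le> \<epsilon> * (t * (norm a + norm c))"
          using bound[of \<xi> s] \<xi> that \<epsilon> by (intro mult_left_mono) auto
        finally show ?thesis .
      qed
      have split: "f' (u + \<xi> *\<^sub>R a + t *\<^sub>R c) - f' (u + \<xi> *\<^sub>R a)
          = t *\<^sub>R f'' c + (r (\<xi> *\<^sub>R a + t *\<^sub>R c) - r (\<xi> *\<^sub>R a))"
        by (simp add: r_def linear_add[OF lin] linear_cmul[OF lin] add.assoc)
      have val: "n \<bullet> (f (u + t *\<^sub>R a + t *\<^sub>R c) - f (u + t *\<^sub>R a) - f (u + t *\<^sub>R c) + f u) = h t - h 0"
        by (simp add: h_def inner_diff_right inner_add_right)
      have "h t - h 0 = t * (n \<bullet> ((f' (u + \<xi> *\<^sub>R a + t *\<^sub>R c) - f' (u + \<xi> *\<^sub>R a)) a))"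
        using \<xi>(3) by (simp add: blinfun.diff_left)
      also have "\<dots> = t\<^sup>2 * (n \<bullet> f'' c a) + t * (n \<bullet> ((r (\<xi> *\<^sub>R a + t *\<^sub>R c) - r (\<xi> *\<^sub>R a)) a))"
        unfolding split blinfun.add_left blinfun.scaleR_left inner_add_right inner_scaleR_right
        by (simp add: power2_eq_square distrib_left)
      finally have "\<bar>h t - h 0 - t\<^sup>2 * (n \<bullet> f'' c a)\<bar> = t * \<bar>n \<bullet> ((r (\<xi> *\<^sub>R a + t *\<^sub>R c) - r (\<xi> *\<^sub>R a)) a)\<bar>"
        using t by (simp add: abs_mult)
      also have "\<dots> \<le> t * (norm n * ((2 * (\<epsilon> * (t * (norm a + norm c)))) * norm a))"
      proof (intro mult_left_mono order_trans[OF Cauchy_Schwarz_ineq2])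
        have "norm (r (\<xi> *\<^sub>R a + t *\<^sub>R c) - r (\<xi> *\<^sub>R a)) \<le> 2 * (\<epsilon> * (t * (norm a + norm c)))"
          using r[of t] r[of 0] t norm_triangle_ineq4[of "r (\<xi> *\<^sub>R a + t *\<^sub>R c)" "r (\<xi> *\<^sub>R a)"] by simp
        then show "norm ((r (\<xi> *\<^sub>R a + t *\<^sub>R c) - r (\<xi> *\<^sub>R a)) a) \<le> 2 * (\<epsilon> * (t * (norm a + norm c))) * norm a"
          by (intro order_trans[OF norm_blinfun] mult_right_mono) auto
      qed (use t in auto)
      also have "\<dots> = (2 * \<epsilon> * norm n * t\<^sup>2 * (norm a + norm c)) * norm a" by (simp add: power2_eq_square)
      also have "\<dots> \<le> (2 * \<epsilon> * norm n * t\<^sup>2 * (norm a + norm c)) * (norm a + norm c)"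
        using \<epsilon> by (intro mult_left_mono) auto
      finally show "\<bar>n \<bullet> (f (u + t *\<^sub>R a + t *\<^sub>R c) - f (u + t *\<^sub>R a) - f (u + t *\<^sub>R c) + f u) - t\<^sup>2 * (n \<bullet> f'' c a)\<bar>
        \<le> 2 * \<epsilon> * norm n * (norm a + norm c)\<^sup>2 * t\<^sup>2"
        unfolding val by (simp add: power2_eq_square mult_ac)
    qed
  qed
  have "n \<bullet> (f'' c a) = n \<bullet> (f'' a c)" for n
  proof (rule ccontr)
    assume ne: "n \<bullet> (f'' c a) \<noteq> n \<bullet> (f'' a c)"
    define K where "K = norm n * (norm a + norm c)\<^sup>2"
    have K: "K \<ge> 0" by (simp add: K_def)
    \<comment> \<open>The estimates put the two mixed derivatives within
      \<open>4 * \<epsilon> * K\<close> of each other, whereas their assumed gap equals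
      \<open>8 * \<epsilon> * (K + 1)\<close>.\<close>
    define \<epsilon> where "\<epsilon> = \<bar>n \<bullet> f'' c a - n \<bullet> f'' a c\<bar> / 8 / (K + 1)"
    have \<epsilon>: "\<epsilon> > 0" using ne K by (simp add: \<epsilon>_def)
    obtain T1 where T1: "T1 > 0" "\<And>t. 0 < t \<Longrightarrow> t < T1 \<Longrightarrow>
      \<bar>n \<bullet> (f (u + t *\<^sub>R a + t *\<^sub>R c) - f (u + t *\<^sub>R a) - f (u + t *\<^sub>R c) + f u) - t\<^sup>2 * (n \<bullet> f'' c a)\<bar>
        \<le> 2 * \<epsilon> * norm n * (norm a + norm c)\<^sup>2 * t\<^sup>2"
      using est[OF \<epsilon>, of n a c] by blast
    obtain T2 where T2: "T2 > 0" "\<And>t. 0 < t \<Longrightarrow> t < T2 \<Longrightarrow>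
      \<bar>n \<bullet> (f (u + t *\<^sub>R c + t *\<^sub>R a) - f (u + t *\<^sub>R c) - f (u + t *\<^sub>R a) + f u) - t\<^sup>2 * (n \<bullet> f'' a c)\<bar>
        \<le> 2 * \<epsilon> * norm n * (norm c + norm a)\<^sup>2 * t\<^sup>2"
      using est[OF \<epsilon>, of n c a] by blast
    define t where "t = min T1 T2 / 2"
    have t: "0 < t" "t < T1" "t < T2" using T1(1) T2(1) by (auto simp: t_def)
    define X where "X = n \<bullet> (f (u + t *\<^sub>R a + t *\<^sub>R c) - f (u + t *\<^sub>R a) - f (u + t *\<^sub>R c) + f u)"
    have X2: "X = n \<bullet> (f (u + t *\<^sub>R c + t *\<^sub>R a) - f (u + t *\<^sub>R c) - f (u + t *\<^sub>R a) + f u)"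
      by (simp add: X_def algebra_simps)
    have a1: "\<bar>X - t\<^sup>2 * (n \<bullet> f'' c a)\<bar> \<le> 2 * \<epsilon> * K * t\<^sup>2"
      using T1(2)[OF t(1,2)] by (simp add: X_def K_def mult_ac)
    have a2: "\<bar>X - t\<^sup>2 * (n \<bullet> f'' a c)\<bar> \<le> 2 * \<epsilon> * K * t\<^sup>2"
      using T2(2)[OF t(1,3)] by (simp add: X2 K_def mult_ac add.commute)
    have "t\<^sup>2 * \<bar>n \<bullet> f'' c a - n \<bullet> f'' a c\<bar> = \<bar>t\<^sup>2 * (n \<bullet> f'' c a) - t\<^sup>2 * (n \<bullet> f'' a c)\<bar>"
      by (simp add: abs_mult flip: right_diff_distrib)
    also have "\<dots> \<le> t\<^sup>2 * (4 * \<epsilon> * K)" using a1 a2 by (simp add: algebra_simps)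
    finally have "\<bar>n \<bullet> f'' c a - n \<bullet> f'' a c\<bar> \<le> 4 * \<epsilon> * K" using t(1) by simp
    moreover have "\<bar>n \<bullet> f'' c a - n \<bullet> f'' a c\<bar> = 8 * (\<epsilon> * (K + 1))"
    proof -
      have "K + 1 \<noteq> 0" using K by simp
      then have "\<epsilon> * (K + 1) = \<bar>n \<bullet> f'' c a - n \<bullet> f'' a c\<bar> / 8"
        by (rule iffD1[OF nonzero_eq_divide_eq \<epsilon>_def])
      then show ?thesis by simp
    qed
    moreover have "\<epsilon> * K \<le> \<epsilon> * (K + 1)" "0 < \<epsilon> * (K + 1)" using \<epsilon> K by auto
    ultimately show False unfolding mult.assoc by linarith
  qed
  then show ?thesis using vector_eq_rdot by (metis inner_commute)
qed

text \<open>Near \<open>u\<close> the increment of \<open>f'\<close> from its value at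
  \<open>u\<close> is at most \<open>onorm f'' + 1\<close> times the distance; the mean value
  inequality on the segment turns this into a quadratic error. It is applied below to the inverse of
  a slice chart.\<close>

lemma derivative_quadratic_remainder:
  fixes f :: "'a::real_normed_vector \<Rightarrow> 'b::real_normed_vector" and f' :: "'a \<Rightarrow> 'a \<Rightarrow>\<^sub>L 'b"
  assumes W: "open W" "u \<in> W" and f: "\<And>x. x \<in> W \<Longrightarrow> (f has_derivative f' x) (at x)"
    and f': "(f' has_derivative f'') (at u)"
  obtains \<delta> K where "\<delta> > 0" "ball u \<delta> \<subseteq> W"
    "\<forall>x\<in>ball u \<delta>. norm (f x - f u - f' u (x - u)) \<le> K * (norm (x - u))\<^sup>2"
proof -
  obtain \<delta>1 where \<delta>1: "\<delta>1 > 0" "\<And>x. norm (x - u) < \<delta>1 \<Longrightarrow> norm (f' x - f' u - f'' (x - u)) \<le> 1 * norm (x - u)"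
    using f' zero_less_one unfolding has_derivative_at_alt by blast
  obtain \<delta>2 where \<delta>2: "\<delta>2 > 0" "ball u \<delta>2 \<subseteq> W" using W open_contains_ball by blast
  have bl: "bounded_linear f''" using f' has_derivative_bounded_linear by blast
  define \<delta> where "\<delta> = min \<delta>1 \<delta>2"
  have \<delta>: "\<delta> > 0" "ball u \<delta> \<subseteq> W" using \<delta>1(1) \<delta>2 by (auto simp: \<delta>_def)
  define K where "K = onorm f'' + 1"
  have lip: "norm (f' x - f' u) \<le> K * norm (x - u)" if "norm (x - u) < \<delta>" for x
  proof -
    have "norm (f' x - f' u) \<le> norm (f' x - f' u - f'' (x - u)) + norm (f'' (x - u))"
      using norm_triangle_ineq[of "f' x - f' u - f'' (x - u)" "f'' (x - u)"] by simp
    also have "\<dots> \<le> norm (x - u) + onorm f'' * norm (x - u)"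
      using \<delta>1(2)[of x] that onorm[OF bl, of "x - u"] by (intro add_mono) (auto simp: \<delta>_def)
    finally show ?thesis by (simp add: K_def algebra_simps)
  qed
  show ?thesis
  proof (rule that[OF \<delta>], rule ballI)
    fix x assume x: "x \<in> ball u \<delta>"
    let ?S = "closed_segment u x"
    have seg: "?S \<subseteq> ball u \<delta>" using x \<delta>(1) by (simp add: closed_segment_subset)
    have near: "norm (y - u) \<le> norm (x - u)" if "y \<in> ?S" for y
      using segment_bound(1)[OF that] by simp
    have "norm (f x - f u - f' u (x - u)) \<le> norm (x - u) * (K * norm (x - u))"
    proof (rule differentiable_bound_linearization[of u x ?S f f'])
      show "u + t *\<^sub>R (x - u) \<in> ?S" if "t \<in> {0..1}" for t
        using that by (auto simp: closed_segment_def algebra_simps intro!: exI[of _ t])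
      show "(f has_derivative f' y) (at y within ?S)" if "y \<in> ?S" for y
        using f[of y] that seg \<delta>(2) by (auto intro: has_derivative_at_withinI)
      show "onorm (blinfun_apply (f' y) - blinfun_apply (f' u)) \<le> K * norm (x - u)" if "y \<in> ?S" for y
      proof -
        have "onorm (blinfun_apply (f' y) - blinfun_apply (f' u)) = norm (f' y - f' u)"
          by (simp add: norm_blinfun.rep_eq minus_blinfun.rep_eq fun_diff_def)
        also have "\<dots> \<le> K * norm (y - u)"
          using lip[of y] seg that by (auto simp: dist_norm norm_minus_commute)
        also have "\<dots> \<le> K * norm (x - u)"
          using near[OF that] onorm_pos_le[OF bl] by (intro mult_left_mono) (auto simp: K_def)
        finally show ?thesis .
      qed
    qed simp
    then show "norm (f x - f u - f' u (x - u)) \<le> K * (norm (x - u))\<^sup>2" by (simp add: power2_eq_square mult_ac)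
  qed
qed

lemma has_derivative_blinfun_apply:
  "(f has_derivative f') F \<Longrightarrow> ((\<lambda>x. blinfun_apply (f x) c) has_derivative (\<lambda>h. blinfun_apply (f' h) c)) F"
  by (rule bounded_linear.has_derivative[OF blinfun.bounded_linear_left])

text \<open>\<open>D\<close>, \<open>D2\<close> are the first and second derivatives of the
  parametrization, \<open>Di\<close>, \<open>Di2\<close> those of its inverse. \<open>C2_on\<close>
  only asserts that they exist; fixing them allows explicit formulas.\<close>

locale chart =
  fixes M E W :: "'a::euclidean_space set" and \<psi> :: "'a \<Rightarrow> 'a"
    and D :: "'a \<Rightarrow> 'a \<Rightarrow>\<^sub>L 'a" and D2 :: "'a \<Rightarrow> 'a \<Rightarrow>\<^sub>L ('a \<Rightarrow>\<^sub>L 'a)"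
    and Di :: "'a \<Rightarrow> 'a \<Rightarrow>\<^sub>L 'a" and Di2 :: "'a \<Rightarrow> 'a \<Rightarrow>\<^sub>L ('a \<Rightarrow>\<^sub>L 'a)"
  assumes chart: "slice_chart M E W \<psi>"
    and D: "\<And>x. x \<in> W \<Longrightarrow> (\<psi> has_derivative D x) (at x)"
    and D2: "\<And>x. x \<in> W \<Longrightarrow> (D has_derivative D2 x) (at x)"
    and Di: "\<And>y. y \<in> \<psi> ` W \<Longrightarrow> (inv_into W \<psi> has_derivative Di y) (at y)"
    and Di2: "\<And>y. y \<in> \<psi> ` W \<Longrightarrow> (Di has_derivative Di2 y) (at y)"
    and cont_D2: "continuous_on W D2"
    and cont_Di2: "continuous_on (\<psi> ` W) Di2"

lemma slice_chart_derivatives: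
  assumes "slice_chart M E W \<psi>"
  shows "\<exists>D D2 Di Di2. chart M E W \<psi> D D2 Di Di2"
proof -
  have "C2_on W \<psi>" "C2_on (\<psi> ` W) (inv_into W \<psi>)" using assms by (auto simp: slice_chart_def)
  then obtain D Di where D: "\<forall>x\<in>W. (\<psi> has_derivative blinfun_apply (D x)) (at x)" "C1_on W D"
    and Di: "\<forall>y\<in>\<psi> ` W. (inv_into W \<psi> has_derivative blinfun_apply (Di y)) (at y)" "C1_on (\<psi> ` W) Di"
    unfolding C2_on_def by blast
  obtain D2 where D2: "\<forall>x\<in>W. (D has_derivative blinfun_apply (D2 x)) (at x)" "continuous_on W D2"
    using D(2) unfolding C1_on_def by blast
  obtain Di2 where Di2: "\<forall>y\<in>\<psi> ` W. (Di has_derivative blinfun_apply (Di2 y)) (at y)" "continuous_on (\<psi> ` W) Di2"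
    using Di(2) unfolding C1_on_def by blast
  have "chart M E W \<psi> D D2 Di Di2"
  proof (rule chart.intro[OF assms])
    show "(\<psi> has_derivative D x) (at x)" "(D has_derivative D2 x) (at x)" if "x \<in> W" for x
      using D(1) D2(1) that by blast+
    show "(inv_into W \<psi> has_derivative Di y) (at y)" "(Di has_derivative Di2 y) (at y)" if "y \<in> \<psi> ` W" for y
      using Di(1) Di2(1) that by blast+
  qed (fact D2(2) Di2(2))+
  then show ?thesis by (intro exI)
qed

section \<open>Calculus in a slice chart\<close>

context chart
begin

abbreviation "\<psi>i \<equiv> inv_into W \<psi>"

lemma E: "subspace E" and openW: "open W" and openV: "open (\<psi> ` W)" and inj: "inj_on \<psi> W"
  and slice: "\<psi> ` (W \<inter> E) = \<psi> ` W \<inter> M"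
  using chart by (auto simp: slice_chart_def)

lemma E': "subspace (orthogonal_comp E)" by (rule subspace_orthogonal_comp)

lemma \<psi>i_\<psi> [simp]: "u \<in> W \<Longrightarrow> \<psi>i (\<psi> u) = u" by (rule inv_into_f_f[OF inj])

lemma \<psi>_\<psi>i: "y \<in> \<psi> ` W \<Longrightarrow> \<psi> (\<psi>i y) = y \<and> \<psi>i y \<in> W" by (simp add: f_inv_into_f inv_into_into)

lemma \<psi>_in_M_iff: "u \<in> W \<Longrightarrow> \<psi> u \<in> M \<longleftrightarrow> u \<in> E"
  using slice inj by (auto simp: inj_on_def)

lemma cont_\<psi>: "continuous_on W \<psi>"
  by (rule has_derivative_continuous_on[OF has_derivative_at_withinI[OF D]])

lemma cont_D: "continuous_on W D"
  by (rule has_derivative_continuous_on[OF has_derivative_at_withinI[OF D2]])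

lemma cont_\<psi>i: "continuous_on (\<psi> ` W) \<psi>i"
  by (rule has_derivative_continuous_on[OF has_derivative_at_withinI[OF Di]])

lemma cont_Di: "continuous_on (\<psi> ` W) Di"
  by (rule has_derivative_continuous_on[OF has_derivative_at_withinI[OF Di2]])

lemma lin_D: "linear (blinfun_apply (D u))" and lin_Di: "linear (blinfun_apply (Di u))"
  by (simp_all add: blinfun.bounded_linear_right bounded_linear.linear)

lemma Di_D [simp]: assumes "u \<in> W" shows "Di (\<psi> u) (D u x) = x"
proof -
  have "(\<psi>i \<circ> \<psi> has_derivative Di (\<psi> u) \<circ> D u) (at u)"
    using D[OF assms] Di[of "\<psi> u"] assms by (intro diff_chain_at) auto
  moreover have "(\<psi>i \<circ> \<psi> has_derivative (\<lambda>x. x)) (at u)"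
    by (rule has_derivative_transform_within_open[OF _ openW assms, of "\<lambda>x. x"]) auto
  ultimately have "Di (\<psi> u) \<circ> D u = (\<lambda>x. x)" by (rule has_derivative_unique)
  then show ?thesis by (simp add: fun_eq_iff)
qed

lemma D_Di [simp]: assumes "u \<in> W" shows "D u (Di (\<psi> u) x) = x"
proof -
  have "inj (blinfun_apply (D u))" using Di_D[OF assms] by (metis injI)
  then have "surj (blinfun_apply (D u))" using linear_injective_imp_surjective[OF lin_D] by blast
  then obtain z where "x = D u z" by (metis surjD)
  then show ?thesis using Di_D[OF assms] by simp
qed

text \<open>A frame of the normal bundle that depends differentiably on the base point: the transpose of
  the derivative of the inverse chart.\<close>

definition \<nu> :: "'a \<Rightarrow> 'a \<Rightarrow> 'a" where
  "\<nu> u b = (\<Sum>i\<in>Basis. (Di (\<psi> u) i \<bullet> b) *\<^sub>R i)"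

text \<open>The derivative of the frame vector \<open>\<nu> u b\<close> when the base point moves in
  direction \<open>a\<close>; the chain rule through \<open>\<psi>\<close> inserts
  \<open>D u a\<close>.\<close>

definition d\<nu> :: "'a \<Rightarrow> 'a \<Rightarrow> 'a \<Rightarrow> 'a" where
  "d\<nu> u b a = (\<Sum>i\<in>Basis. (Di2 (\<psi> u) (D u a) i \<bullet> b) *\<^sub>R i)"

lemma inner_\<nu>: "x \<bullet> \<nu> u b = Di (\<psi> u) x \<bullet> b"
proof -
  have "Di (\<psi> u) x = (\<Sum>i\<in>Basis. (x \<bullet> i) *\<^sub>R Di (\<psi> u) i)"
    by (subst euclidean_representation[of x, symmetric]) (simp add: blinfun.sum_right blinfun.scaleR_right)
  then show ?thesis by (simp add: \<nu>_def inner_sum_left inner_sum_right mult.commute)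
qed

lemma D_inner_\<nu> [simp]: "u \<in> W \<Longrightarrow> D u x \<bullet> \<nu> u b = x \<bullet> b"
  by (simp add: inner_\<nu>)

lemma linear_\<nu>: "linear (\<nu> u)" unfolding \<nu>_def[abs_def]
  by (rule linearI) (auto simp: inner_add_right scaleR_add_left sum.distrib scaleR_sum_right)

lemma linear_d\<nu>: "linear (\<lambda>b. d\<nu> u b a)" "linear (d\<nu> u b)" unfolding d\<nu>_def[abs_def]
  by (rule linearI, auto simp: inner_add_right inner_add_left scaleR_add_left sum.distrib scaleR_sum_right
      blinfun.add_right blinfun.add_left blinfun.scaleR_right blinfun.scaleR_left)+

lemma \<nu>_eq_0_iff: "u \<in> W \<Longrightarrow> \<nu> u b = 0 \<longleftrightarrow> b = 0"
  by (metis D_inner_\<nu> inner_eq_zero_iff inner_zero_right linear_0[OF linear_\<nu>])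

lemma has_derivative_\<nu>:
  assumes u: "u \<in> W" shows "((\<lambda>u. \<nu> u b) has_derivative d\<nu> u b) (at u)"
proof -
  have 1: "(Di \<circ> \<psi> has_derivative Di2 (\<psi> u) \<circ> D u) (at u)"
    using D[OF u] Di2[of "\<psi> u"] u by (intro diff_chain_at) auto
  show ?thesis unfolding \<nu>_def d\<nu>_def
  proof (intro has_derivative_sum has_derivative_scaleR_left has_derivative_inner_left)
    fix i :: 'a
    show "((\<lambda>u. blinfun_apply (Di (\<psi> u)) i) has_derivative (\<lambda>a. Di2 (\<psi> u) (D u a) i)) (at u)"
      using has_derivative_blinfun_apply[OF 1] by (simp add: o_def)
  qed
qed

text \<open>Obtained by differentiating \<open>D_inner_\<nu>\<close>.\<close>

lemma D2_inner_\<nu>: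
  assumes u: "u \<in> W" shows "D2 u a x \<bullet> \<nu> u b = - (D u x \<bullet> d\<nu> u b a)"
proof -
  have "((\<lambda>u. D u x \<bullet> \<nu> u b) has_derivative (\<lambda>h. D u x \<bullet> d\<nu> u b h + D2 u h x \<bullet> \<nu> u b)) (at u)"
    by (intro has_derivative_inner has_derivative_blinfun_apply D2 has_derivative_\<nu> u)
  moreover have "((\<lambda>u. D u x \<bullet> \<nu> u b) has_derivative (\<lambda>h. 0)) (at u)"
    by (rule has_derivative_transform_within_open[OF _ openW u, of "\<lambda>_. x \<bullet> b"]) auto
  ultimately have "(\<lambda>h. D u x \<bullet> d\<nu> u b h + D2 u h x \<bullet> \<nu> u b) = (\<lambda>h. 0)"
    by (rule has_derivative_unique)
  then have "D u x \<bullet> d\<nu> u b a + D2 u a x \<bullet> \<nu> u b = 0" by meson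
  then show ?thesis by linarith
qed

lemma D2_symmetric: "u \<in> W \<Longrightarrow> D2 u a c = D2 u c a"
  by (rule second_derivative_symmetric[OF openW _ D D2])

section \<open>Tangent space, normal space and curvature at a point of the slice\<close>

context
  fixes u assumes u: "u \<in> W" "u \<in> E"
begin

lemma line_in_M:
  assumes "e \<in> E"
  shows "\<exists>\<epsilon>>0. \<forall>s. \<bar>s\<bar> < \<epsilon> \<longrightarrow> u + s *\<^sub>R e \<in> W \<and> u + s *\<^sub>R e \<in> E \<and> \<psi> (u + s *\<^sub>R e) \<in> M"
proof -
  have "((\<lambda>s. u + s *\<^sub>R e) \<longlongrightarrow> u + 0 *\<^sub>R e) (nhds 0)" by (intro tendsto_intros filterlim_ident)
  then have "\<forall>\<^sub>F s in nhds 0. u + s *\<^sub>R e \<in> W" using openW u(1) by (intro topological_tendstoD) auto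
  then obtain \<epsilon> where "\<epsilon> > 0" "\<forall>s. dist s 0 < \<epsilon> \<longrightarrow> u + s *\<^sub>R e \<in> W"
    unfolding eventually_nhds_metric by blast
  moreover have "u + s *\<^sub>R e \<in> E" for s using u(2) assms E by (simp add: subspace_add subspace_scale)
  ultimately show ?thesis using \<psi>_in_M_iff by (intro exI[of _ \<epsilon>]) auto
qed

text \<open>A curve in \<open>M\<close>, pulled back by the inverse chart, stays in \<open>E\<close>
  near 0, so its velocity is orthogonal to the complement of \<open>E\<close>. Conversely,
  \<open>\<psi>\<close> maps lines in \<open>E\<close> to curves in \<open>M\<close>.\<close>

lemma tangent_space_chart: "tangent_space_at M (\<psi> u) = D u ` E"
proof (intro equalityI subsetI)
  fix v assume "v \<in> tangent_space_at M (\<psi> u)"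
  then obtain \<gamma> \<epsilon> where \<gamma>: "\<epsilon> > 0" "\<gamma> ` {-\<epsilon><..<\<epsilon>} \<subseteq> M" "\<gamma> 0 = \<psi> u" "(\<gamma> has_vector_derivative v) (at 0)"
    unfolding tangent_space_at_def by blast
  have "isCont \<gamma> 0" using \<gamma>(4) has_vector_derivative_continuous by blast
  then have "\<forall>\<^sub>F t in at 0. \<gamma> t \<in> \<psi> ` W"
    using openV u(1) \<gamma>(3) by (intro topological_tendstoD) (auto simp: isCont_def)
  moreover have "\<forall>\<^sub>F t in at 0. t \<in> {-\<epsilon><..<\<epsilon>}"
    using \<gamma>(1) by (intro eventually_at_in_open') auto
  ultimately have "\<forall>\<^sub>F t in at 0. \<psi>i (\<gamma> t) \<in> E"
  proof eventually_elim
    fix t assume "\<gamma> t \<in> \<psi> ` W" "t \<in> {-\<epsilon><..<\<epsilon>}"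
    moreover from this have "\<gamma> t \<in> M" using \<gamma>(2) by blast
    ultimately have "\<gamma> t \<in> \<psi> ` (W \<inter> E)" using slice by auto
    then show "\<psi>i (\<gamma> t) \<in> E" by auto
  qed
  moreover have "Di (\<psi> u) v \<bullet> b = 0" if "b \<in> orthogonal_comp E" "\<forall>\<^sub>F t in at 0. \<psi>i (\<gamma> t) \<in> E" for b
  proof -
    have "(\<psi>i \<circ> \<gamma> has_derivative Di (\<psi> u) \<circ> (\<lambda>t. t *\<^sub>R v)) (at 0)"
      using \<gamma>(4) Di[of "\<psi> u"] u(1) \<gamma>(3) by (intro diff_chain_at) (auto simp: has_vector_derivative_def)
    then have "((\<lambda>t. \<psi>i (\<gamma> t) \<bullet> b) has_derivative (\<lambda>t. Di (\<psi> u) (t *\<^sub>R v) \<bullet> b)) (at 0)"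
      by (intro has_derivative_inner_left) (simp add: o_def)
    moreover have "((\<lambda>t. \<psi>i (\<gamma> t) \<bullet> b) has_derivative (\<lambda>t. 0)) (at 0)"
    proof (rule has_derivative_transform_eventually[of "\<lambda>t. 0"])
      show "\<forall>\<^sub>F t in at 0. 0 = \<psi>i (\<gamma> t) \<bullet> b"
        using that(2) by eventually_elim (simp add: inner_perp[OF E _ that(1)])
      show "0 = \<psi>i (\<gamma> 0) \<bullet> b" using u by (simp add: \<gamma>(3) inner_perp[OF E _ that(1)])
    qed auto
    ultimately have "(\<lambda>t. Di (\<psi> u) (t *\<^sub>R v) \<bullet> b) = (\<lambda>t. 0)" by (rule has_derivative_unique)
    then show ?thesis by (metis scaleR_one)
  qed
  ultimately have "Di (\<psi> u) v \<in> orthogonal_comp (orthogonal_comp E)"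
    by (auto simp: orthogonal_comp_def orthogonal_def inner_commute)
  then have "Di (\<psi> u) v \<in> E" by (simp add: perp_perp[OF E])
  then show "v \<in> D u ` E" using D_Di[OF u(1), of v] by (metis imageI)
next
  fix v assume "v \<in> D u ` E"
  then obtain e where e: "e \<in> E" "v = D u e" by blast
  obtain \<delta> where \<delta>: "\<delta> > 0" "\<forall>s. \<bar>s\<bar> < \<delta> \<longrightarrow> u + s *\<^sub>R e \<in> W \<and> u + s *\<^sub>R e \<in> E \<and> \<psi> (u + s *\<^sub>R e) \<in> M"
    using line_in_M[OF e(1)] by blast
  have in': "u + s *\<^sub>R e \<in> W \<and> \<psi> (u + s *\<^sub>R e) \<in> M" if "s \<in> {-\<delta><..<\<delta>}" for s
    using \<delta>(2) that by auto
  let ?\<gamma> = "\<lambda>s. \<psi> (u + s *\<^sub>R e)"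
  have der: "(?\<gamma> has_vector_derivative D (u + s *\<^sub>R e) e) (at s)" if "s \<in> {-\<delta><..<\<delta>}" for s
  proof -
    have "((\<lambda>s. u + s *\<^sub>R e) has_derivative (\<lambda>x. x *\<^sub>R e)) (at s)" by (auto intro!: derivative_eq_intros)
    from diff_chain_at[OF this D] show ?thesis
      using in'[OF that] by (simp add: has_vector_derivative_def o_def blinfun.scaleR_right)
  qed
  have "continuous_on {-\<delta><..<\<delta>} (\<lambda>s. D (u + s *\<^sub>R e))"
    using in' by (intro continuous_on_compose2[OF cont_D] continuous_intros) auto
  then have "continuous_on {-\<delta><..<\<delta>} (\<lambda>s. D (u + s *\<^sub>R e) e)" by (intro continuous_intros)
  then have "?\<gamma> C1_differentiable_on {-\<delta><..<\<delta>}"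
    unfolding C1_differentiable_on_def using der by (intro exI[of _ "\<lambda>s. D (u + s *\<^sub>R e) e"]) auto
  moreover have "?\<gamma> ` {-\<delta><..<\<delta>} \<subseteq> M" using in' by auto
  moreover have "(?\<gamma> has_vector_derivative v) (at 0)" using der[of 0] \<delta> e(2) by simp
  ultimately show "v \<in> tangent_space_at M (\<psi> u)" unfolding tangent_space_at_def using \<delta>
    by (intro CollectI exI[of _ ?\<gamma>] exI[of _ \<delta>] conjI) (assumption | simp)+
qed

abbreviation "TM \<equiv> tangent_space_at M (\<psi> u)"
abbreviation "NM \<equiv> normal_space_at M (\<psi> u)"

lemma subspace_tangent: "subspace TM"
  unfolding tangent_space_chart by (rule linear_subspace_image[OF lin_D E])

lemma subspace_normal: "subspace NM"
  unfolding normal_space_at_def by (rule subspace_orthogonal_comp)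

lemma D_tangent: "a \<in> E \<Longrightarrow> D u a \<in> TM"
  by (simp add: tangent_space_chart)

lemma dim_tangent: "dim TM = dim E"
  unfolding tangent_space_chart
  by (intro dim_image_eq lin_D inj_on_inverseI[of _ "Di (\<psi> u)"] Di_D u(1))

lemma \<nu>_normal: "b \<in> orthogonal_comp E \<Longrightarrow> \<nu> u b \<in> NM"
  using D_inner_\<nu>[OF u(1)] inner_perp[OF E]
  unfolding normal_space_at_def tangent_space_chart orthogonal_comp_def[of "D u ` E"] orthogonal_def by fastforce

lemma normal_space_chart: "NM = \<nu> u ` orthogonal_comp E"
proof (intro equalityI subsetI)
  fix n assume n: "n \<in> NM"
  \<comment> \<open>The transpose of \<open>D u\<close> inverts the transposed inverse
    \<open>\<nu> u\<close>.\<close>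
  define b where "b = adjoint (D u) n"
  have b: "x \<bullet> b = D u x \<bullet> n" for x unfolding b_def by (rule adjoint_works[OF lin_D])
  have "b \<in> orthogonal_comp E"
    using n by (auto simp: orthogonal_comp_def orthogonal_def b normal_space_at_def tangent_space_chart)
  moreover have "x \<bullet> (n - \<nu> u b) = 0" for x
    using D_inner_\<nu>[OF u(1), of "Di (\<psi> u) x" b] b[of "Di (\<psi> u) x"] u(1) by (simp add: inner_diff_right)
  then have "n = \<nu> u b" by (metis inner_eq_zero_iff right_minus_eq)
  ultimately show "n \<in> \<nu> u ` orthogonal_comp E" by blast
qed (auto simp: \<nu>_normal)

lemma tangent_normal_inner: "t \<in> TM \<Longrightarrow> n \<in> NM \<Longrightarrow> t \<bullet> n = 0"
  unfolding normal_space_at_def by (rule inner_perp[OF subspace_tangent])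

text \<open>If \<open>X\<close> is tangent to \<open>M\<close>, then \<open>X (\<psi> p) \<bullet> \<nu> p b\<close> vanishes along the slice.\<close>

lemma tangent_field_derivative:
  assumes U: "open U" "\<psi> u \<in> U" and X: "(X has_derivative X') (at (\<psi> u))"
    and tan: "\<And>p. p \<in> M \<inter> U \<Longrightarrow> X p \<in> tangent_space_at M p"
    and a: "a \<in> E" and b: "b \<in> orthogonal_comp E"
  shows "X' (D u a) \<bullet> \<nu> u b = - (X (\<psi> u) \<bullet> d\<nu> u b a)"
proof -
  obtain \<epsilon> where \<epsilon>: "\<epsilon> > 0" "\<forall>s. \<bar>s\<bar> < \<epsilon> \<longrightarrow> u + s *\<^sub>R a \<in> W \<and> u + s *\<^sub>R a \<in> E \<and> \<psi> (u + s *\<^sub>R a) \<in> M"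
    using line_in_M[OF a] by blast
  have lin: "((\<lambda>s. u + s *\<^sub>R a) has_derivative (\<lambda>s. s *\<^sub>R a)) (at 0)" by (auto intro!: derivative_eq_intros)
  have d\<psi>: "((\<lambda>s. \<psi> (u + s *\<^sub>R a)) has_derivative (\<lambda>s. D u (s *\<^sub>R a))) (at 0)"
    using diff_chain_at[OF lin, of \<psi> "D u"] D[OF u(1)] by (simp add: o_def)
  have dX: "((\<lambda>s. X (\<psi> (u + s *\<^sub>R a))) has_derivative (\<lambda>s. X' (D u (s *\<^sub>R a)))) (at 0)"
    using diff_chain_at[OF d\<psi>, of X X'] X by (simp add: o_def)
  have dn: "((\<lambda>s. \<nu> (u + s *\<^sub>R a) b) has_derivative (\<lambda>s. d\<nu> u b (s *\<^sub>R a))) (at 0)"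
    using diff_chain_at[OF lin, of "\<lambda>u. \<nu> u b" "d\<nu> u b"] has_derivative_\<nu>[OF u(1), of b] by (simp add: o_def)
  have ev: "\<forall>\<^sub>F s in at 0. X (\<psi> (u + s *\<^sub>R a)) \<bullet> \<nu> (u + s *\<^sub>R a) b = 0"
  proof -
    have "isCont (\<lambda>s. \<psi> (u + s *\<^sub>R a)) 0" using d\<psi> has_derivative_continuous by blast
    then have "\<forall>\<^sub>F s in at 0. \<psi> (u + s *\<^sub>R a) \<in> U"
      using U by (intro topological_tendstoD) (auto simp: isCont_def)
    moreover have "\<forall>\<^sub>F s in at 0. \<bar>s\<bar> < \<epsilon>"
      using \<epsilon>(1) by (auto simp: eventually_at intro!: exI[of _ \<epsilon>])
    ultimately show ?thesis
    proof eventually_elim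
      fix s assume s: "\<psi> (u + s *\<^sub>R a) \<in> U" "\<bar>s\<bar> < \<epsilon>"
      let ?u = "u + s *\<^sub>R a"
      have in': "?u \<in> W" "?u \<in> E" "\<psi> ?u \<in> M" using \<epsilon>(2) s(2) by auto
      have "X (\<psi> ?u) \<in> D ?u ` E"
        using tan[of "\<psi> ?u"] s(1) in' by (simp add: chart.tangent_space_chart[OF chart_axioms in'(1,2)])
      then show "X (\<psi> ?u) \<bullet> \<nu> ?u b = 0" using in'(1) inner_perp[OF E _ b] by auto
    qed
  qed
  have "((\<lambda>s. X (\<psi> (u + s *\<^sub>R a)) \<bullet> \<nu> (u + s *\<^sub>R a) b) has_derivative
      (\<lambda>s. X (\<psi> u) \<bullet> d\<nu> u b (s *\<^sub>R a) + X' (D u (s *\<^sub>R a)) \<bullet> \<nu> u b)) (at 0)"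
    using has_derivative_inner[OF dX dn] by simp
  moreover have "((\<lambda>s. X (\<psi> (u + s *\<^sub>R a)) \<bullet> \<nu> (u + s *\<^sub>R a) b) has_derivative (\<lambda>s. 0)) (at 0)"
  proof (rule has_derivative_transform_eventually[of "\<lambda>t. 0"])
    show "\<forall>\<^sub>F s in at 0. 0 = X (\<psi> (u + s *\<^sub>R a)) \<bullet> \<nu> (u + s *\<^sub>R a) b" using ev by eventually_elim simp
    have "X (\<psi> u) \<in> TM" using tan U u \<psi>_in_M_iff by blast
    then show "0 = X (\<psi> (u + 0 *\<^sub>R a)) \<bullet> \<nu> (u + 0 *\<^sub>R a) b"
      using tangent_normal_inner \<nu>_normal[OF b] by simp
  qed auto
  ultimately have "(\<lambda>s. X (\<psi> u) \<bullet> d\<nu> u b (s *\<^sub>R a) + X' (D u (s *\<^sub>R a)) \<bullet> \<nu> u b) = (\<lambda>s. 0)"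
    by (rule has_derivative_unique)
  then have "X (\<psi> u) \<bullet> d\<nu> u b (1 *\<^sub>R a) + X' (D u (1 *\<^sub>R a)) \<bullet> \<nu> u b = 0" by meson
  then show ?thesis by simp
qed

text \<open>Inner products with the frame \<open>\<nu> u b\<close> determine a normal vector, and
  \<open>tangent_field_derivative\<close> computes them from the value of \<open>X\<close> at the
  base point alone; this is uniqueness in the definite description. Existence uses a field that is
  constant in the chart.\<close>

lemma second_fundamental_form_chart:
  assumes a: "a \<in> E" and w: "w \<in> TM"
  shows "second_fundamental_form M (\<psi> u) (D u a) w \<in> NM"
    and "b \<in> orthogonal_comp E \<Longrightarrow> second_fundamental_form M (\<psi> u) (D u a) w \<bullet> \<nu> u b = - (w \<bullet> d\<nu> u b a)"
proof -
  define P where "P z \<longleftrightarrow> z \<in> NM \<and>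
     (\<exists>U X. open U \<and> \<psi> u \<in> U \<and> C1_on U X \<and> (\<forall>p\<in>M \<inter> U. X p \<in> tangent_space_at M p) \<and> X (\<psi> u) = w \<and>
        frechet_derivative X (at (\<psi> u)) (D u a) - z \<in> TM)" for z
  have char: "z \<bullet> \<nu> u b = - (w \<bullet> d\<nu> u b a)" if z: "P z" and b: "b \<in> orthogonal_comp E" for z b
  proof -
    obtain U X where U: "open U" "\<psi> u \<in> U" "C1_on U X" "\<And>p. p\<in>M \<inter> U \<Longrightarrow> X p \<in> tangent_space_at M p"
        "X (\<psi> u) = w" "frechet_derivative X (at (\<psi> u)) (D u a) - z \<in> TM"
      using z unfolding P_def by blast
    have "(X has_derivative frechet_derivative X (at (\<psi> u))) (at (\<psi> u))"
      using U(2,3) unfolding C1_on_def by (metis frechet_derivative_works differentiableI)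
    from tangent_field_derivative[OF U(1,2) this U(4) a b]
    have "frechet_derivative X (at (\<psi> u)) (D u a) \<bullet> \<nu> u b = - (w \<bullet> d\<nu> u b a)" by (simp add: U(5))
    moreover have "(frechet_derivative X (at (\<psi> u)) (D u a) - z) \<bullet> \<nu> u b = 0"
      by (rule tangent_normal_inner[OF U(6) \<nu>_normal[OF b]])
    ultimately show ?thesis by (simp add: inner_diff_left)
  qed
  obtain c where c: "c \<in> E" "w = D u c" using w by (auto simp: tangent_space_chart)
  \<comment> \<open>The field pushes the constant vector \<open>c\<close> forward by the chart; at
    \<open>\<psi> u\<close> its derivative in direction \<open>D u a\<close> is
    \<open>D2 u a c\<close>.\<close>
  have ex: "P (oproj NM (D2 u a c))"
    unfolding P_def
  proof (intro conjI exI[of _ "\<psi> ` W"] exI[of _ "\<lambda>y. D (\<psi>i y) c"])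
    show "oproj NM (D2 u a c) \<in> NM" by (rule oproj_mem[OF subspace_normal])
    have der: "((\<lambda>y. D (\<psi>i y) c) has_derivative (\<lambda>h. D2 (\<psi>i y) (Di y h) c)) (at y)" if y: "y \<in> \<psi> ` W" for y
    proof -
      have "(D \<circ> \<psi>i has_derivative D2 (\<psi>i y) \<circ> Di y) (at y)"
        using Di[OF y] D2 \<psi>_\<psi>i[OF y] by (intro diff_chain_at) auto
      from has_derivative_blinfun_apply[OF this] show ?thesis by (simp add: o_def)
    qed
    define F where "F y = blinfun.prod_left c o\<^sub>L (D2 (\<psi>i y) o\<^sub>L Di y)" for y
    show "C1_on (\<psi> ` W) (\<lambda>y. D (\<psi>i y) c)"
      unfolding C1_on_def
    proof (intro exI[of _ F] conjI ballI)
      fix y assume y: "y \<in> \<psi> ` W"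
      show "((\<lambda>y. D (\<psi>i y) c) has_derivative F y) (at y)"
        using der[OF y] by (rule has_derivative_eq_rhs) (auto simp: F_def)
    next
      have "continuous_on (\<psi> ` W) (\<lambda>y. D2 (\<psi>i y))"
        using \<psi>_\<psi>i by (intro continuous_on_compose2[OF cont_D2 cont_\<psi>i]) auto
      then show "continuous_on (\<psi> ` W) F" unfolding F_def[abs_def]
        by (intro continuous_intros cont_Di)
    qed
    show "\<forall>p\<in>M \<inter> \<psi> ` W. D (\<psi>i p) c \<in> tangent_space_at M p"
    proof
      fix p assume "p \<in> M \<inter> \<psi> ` W"
      then obtain q where q: "q \<in> W" "q \<in> E" "p = \<psi> q" using slice by auto
      then show "D (\<psi>i p) c \<in> tangent_space_at M p"
        using c(1) by (simp add: chart.tangent_space_chart[OF chart_axioms q(1,2)])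
    qed
    show "D (\<psi>i (\<psi> u)) c = w" using u c by simp
    have "frechet_derivative (\<lambda>y. D (\<psi>i y) c) (at (\<psi> u)) = (\<lambda>h. D2 u (Di (\<psi> u) h) c)"
      using der[of "\<psi> u"] u by (intro frechet_derivative_at[symmetric]) simp
    then have "frechet_derivative (\<lambda>y. D (\<psi>i y) c) (at (\<psi> u)) (D u a) = D2 u a c" using u by simp
    moreover have "D2 u a c - oproj NM (D2 u a c) \<in> TM"
      using diff_oproj_perp[OF subspace_normal] perp_perp[OF subspace_tangent] by (simp add: normal_space_at_def)
    ultimately show "frechet_derivative (\<lambda>y. D (\<psi>i y) c) (at (\<psi> u)) (D u a) - oproj NM (D2 u a c) \<in> TM" by simp
  qed (use openV u in auto)
  have "\<exists>!z. P z"
  proof (rule ex1I[of P "oproj NM (D2 u a c)", OF ex])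
    fix z assume z: "P z"
    let ?d = "z - oproj NM (D2 u a c)"
    have "?d \<in> NM" using z ex subspace_normal unfolding P_def by (simp add: subspace_diff)
    then obtain b where b: "b \<in> orthogonal_comp E" "?d = \<nu> u b" unfolding normal_space_chart by auto
    have "?d \<bullet> ?d = 0" using char[OF z b(1)] char[OF ex b(1)] by (subst (2) b(2)) (simp add: inner_diff_left)
    then show "z = oproj NM (D2 u a c)" by simp
  qed
  then have "P (THE z. P z)" by (rule theI')
  moreover have "second_fundamental_form M (\<psi> u) (D u a) w = (THE z. P z)"
    unfolding second_fundamental_form_def P_def ..
  ultimately have PII: "P (second_fundamental_form M (\<psi> u) (D u a) w)" by simp
  then show "second_fundamental_form M (\<psi> u) (D u a) w \<in> NM" unfolding P_def by (rule conjunct1)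
  show "second_fundamental_form M (\<psi> u) (D u a) w \<bullet> \<nu> u b = - (w \<bullet> d\<nu> u b a)"
    if "b \<in> orthogonal_comp E" by (rule char[OF PII that])
qed

text \<open>Weingarten's equation. Both sides are tangent and have the same inner products with
  \<open>TM\<close>, by the formula for the second fundamental form.\<close>

lemma shape_operator_chart:
  assumes a: "a \<in> E" and b: "b \<in> orthogonal_comp E"
  shows "shape_operator M (\<psi> u) (\<nu> u b) (D u a) = - oproj TM (d\<nu> u b a)"
  unfolding shape_operator_def
proof (rule the_equality)
  have inn: "- oproj TM (d\<nu> u b a) \<bullet> w = second_fundamental_form M (\<psi> u) (D u a) w \<bullet> \<nu> u b" if "w \<in> TM" for w
    using second_fundamental_form_chart(2)[OF a that b] oproj_inner[OF subspace_tangent that, of "d\<nu> u b a"]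
    by (simp add: inner_commute)
  then show "- oproj TM (d\<nu> u b a) \<in> TM \<and>
      (\<forall>w\<in>TM. - oproj TM (d\<nu> u b a) \<bullet> w = second_fundamental_form M (\<psi> u) (D u a) w \<bullet> \<nu> u b)"
    using oproj_mem[OF subspace_tangent] subspace_tangent by (auto intro: subspace_neg)
  fix s assume s: "s \<in> TM \<and> (\<forall>w\<in>TM. s \<bullet> w = second_fundamental_form M (\<psi> u) (D u a) w \<bullet> \<nu> u b)"
  let ?d = "s - - oproj TM (d\<nu> u b a)"
  have "?d \<in> TM" using s oproj_mem[OF subspace_tangent, of "d\<nu> u b a"] subspace_tangent by (intro subspace_diff subspace_neg) auto
  then have "?d \<bullet> ?d = 0" using s inn by (simp only: inner_diff_left[of s])
  then show "s = - oproj TM (d\<nu> u b a)" by (simp only: inner_eq_zero_iff right_minus_eq)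
qed

end

end

section \<open>Curvature bounds from the reach\<close>

text \<open>If \<open>c\<close> were negative, \<open>f'\<close> would be negative just to the right
  of 0, and \<open>f\<close> would fall below its minimum.\<close>

lemma second_derivative_at_minimum:
  fixes f :: "real \<Rightarrow> real"
  assumes \<epsilon>: "\<epsilon> > 0" and f: "\<And>s. \<bar>s\<bar> < \<epsilon> \<Longrightarrow> (f has_real_derivative f' s) (at s)"
    and f': "(f' has_real_derivative c) (at 0)" "f' 0 = 0"
    and min: "\<And>s. \<bar>s\<bar> < \<epsilon> \<Longrightarrow> f 0 \<le> f s"
  shows "c \<ge> 0"
proof (rule ccontr)
  assume "\<not> c \<ge> 0"
  then obtain d where d: "d > 0" "\<And>h. 0 < h \<Longrightarrow> h < d \<Longrightarrow> f' (0 + h) < f' 0"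
    using DERIV_neg_dec_right[OF f'(1)] by auto
  define s where "s = min d \<epsilon> / 2"
  have s: "0 < s" "s < d" "s < \<epsilon>" using d(1) \<epsilon> by (auto simp: s_def)
  have "\<exists>z>0. z < s \<and> f s - f 0 = (s - 0) * f' z" using s by (intro MVT2 f) auto
  then obtain z where z: "0 < z" "z < s" "f s - f 0 = s * f' z" by auto
  have "f' z < 0" using d(2)[of z] z s f'(2) by simp
  then have "f s - f 0 < 0" using z(3) s(1) by (simp add: mult_pos_neg)
  then show False using min[of s] s by simp
qed

context chart
begin

context
  fixes u assumes u: "u \<in> W" "u \<in> E"
begin

text \<open>Near \<open>\<psi> u\<close> the inverse chart takes \<open>M\<close> into
  \<open>E\<close>, so pairing its Taylor expansion with \<open>b\<close> leaves only the quadratic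
  error. Farther away \<open>norm (z - \<psi> u)\<close> is at least \<open>\<delta>\<close>, and a
  linear bound is already quadratic. The result is the rough hypothesis of
  \<open>federer_inequality\<close>.\<close>

lemma normal_deviation_quadratic:
  assumes b: "b \<in> orthogonal_comp E"
  shows "\<exists>C. \<forall>z\<in>M. \<nu> u b \<bullet> (z - \<psi> u) \<le> C * (norm (z - \<psi> u))\<^sup>2"
proof -
  let ?y = "\<psi> u" and ?v = "\<nu> u b"
  have y: "?y \<in> \<psi> ` W" using u by blast
  obtain \<delta> K where \<delta>: "\<delta> > 0" "ball ?y \<delta> \<subseteq> \<psi> ` W"
      and K: "\<forall>z\<in>ball ?y \<delta>. norm (\<psi>i z - \<psi>i ?y - Di ?y (z - ?y)) \<le> K * (norm (z - ?y))\<^sup>2"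
    by (rule derivative_quadratic_remainder[OF openV y Di Di2[OF y]])
  define C where "C = norm b * \<bar>K\<bar> + norm ?v / \<delta>"
  have "?v \<bullet> (z - ?y) \<le> C * (norm (z - ?y))\<^sup>2" if z: "z \<in> M" for z
  proof (cases "z \<in> ball ?y \<delta>")
    case True
    then have "z \<in> \<psi> ` (W \<inter> E)" unfolding slice using \<delta>(2) z by blast
    then have "\<psi>i z \<in> E" by auto
    then have "(\<psi>i z - u) \<bullet> b = 0" using u E by (intro inner_perp[OF E _ b] subspace_diff)
    then have "?v \<bullet> (z - ?y) = - ((\<psi>i z - \<psi>i ?y - Di ?y (z - ?y)) \<bullet> b)"
      using u by (simp add: inner_commute[of ?v] inner_\<nu> inner_diff_left)
    also have "\<dots> \<le> norm (\<psi>i z - \<psi>i ?y - Di ?y (z - ?y)) * norm b"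
      using Cauchy_Schwarz_ineq2[of "\<psi>i z - \<psi>i ?y - Di ?y (z - ?y)" b] by linarith
    also have "\<dots> \<le> (\<bar>K\<bar> * (norm (z - ?y))\<^sup>2) * norm b"
      using bspec[OF K True] by (intro mult_right_mono) (auto intro: order_trans[OF _ mult_right_mono])
    also have "\<dots> \<le> C * (norm (z - ?y))\<^sup>2" using \<delta>(1) by (simp add: C_def distrib_right)
    finally show ?thesis .
  next
    case False
    then have far: "\<delta> \<le> norm (z - ?y)" by (simp add: dist_norm norm_minus_commute)
    have "?v \<bullet> (z - ?y) \<le> norm ?v * norm (z - ?y)" by (rule norm_cauchy_schwarz)
    also have "\<dots> = norm ?v / \<delta> * (\<delta> * norm (z - ?y))" using \<delta>(1) by simp
    also have "\<dots> \<le> norm ?v / \<delta> * (norm (z - ?y) * norm (z - ?y))"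
      using far \<delta>(1) by (intro mult_left_mono mult_right_mono) auto
    also have "\<dots> \<le> C * (norm (z - ?y))\<^sup>2" by (simp add: C_def distrib_right power2_eq_square)
    finally show ?thesis .
  qed
  then show ?thesis by blast
qed

text \<open>Along the image of a line in \<open>E\<close> the function \<open>K * (norm (z - \<psi>
  u))\<^sup>2 - \<nu> u b \<bullet> (z - \<psi> u)\<close> is nonnegative and vanishes at the base
  point; the claim says that its second derivative there is nonnegative.\<close>

lemma curvature_le:
  assumes a: "a \<in> E" and b: "b \<in> orthogonal_comp E" and K: "\<And>z. z \<in> M \<Longrightarrow> \<nu> u b \<bullet> (z - \<psi> u) \<le> K * (norm (z - \<psi> u))\<^sup>2"
  shows "D2 u a a \<bullet> \<nu> u b \<le> 2 * K * (norm (D u a))\<^sup>2"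
proof -
  let ?y = "\<psi> u" and ?v = "\<nu> u b"
  obtain \<delta> where \<delta>: "\<delta> > 0" "\<forall>s. \<bar>s\<bar> < \<delta> \<longrightarrow> u + s *\<^sub>R a \<in> W \<and> u + s *\<^sub>R a \<in> E \<and> \<psi> (u + s *\<^sub>R a) \<in> M"
    using line_in_M[OF u a] by blast
  then have in': "u + s *\<^sub>R a \<in> W" "\<psi> (u + s *\<^sub>R a) \<in> M" if "\<bar>s\<bar> < \<delta>" for s
    using that by auto
  let ?g = "\<lambda>s. \<psi> (u + s *\<^sub>R a) - ?y"
  let ?Da = "\<lambda>s. D (u + s *\<^sub>R a) a"
  define f where "f s = K * (?g s \<bullet> ?g s) - ?v \<bullet> ?g s" for s
  define f' where "f' s = 2 * K * (?g s \<bullet> ?Da s) - ?v \<bullet> ?Da s" for s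
  have line: "((\<lambda>s. u + s *\<^sub>R a) has_derivative (\<lambda>x. x *\<^sub>R a)) (at s)" for s
    by (auto intro!: derivative_eq_intros)
  have g: "(?g has_derivative (\<lambda>x. x *\<^sub>R ?Da s)) (at s)" if "\<bar>s\<bar> < \<delta>" for s
  proof -
    have "((\<lambda>s. \<psi> (u + s *\<^sub>R a)) has_derivative (\<lambda>x. D (u + s *\<^sub>R a) (x *\<^sub>R a))) (at s)"
      using diff_chain_at[OF line D[OF in'(1)[OF that]]] by (simp add: o_def)
    then show ?thesis by (auto intro!: derivative_eq_intros simp: blinfun.scaleR_right)
  qed
  have Da: "(?Da has_derivative (\<lambda>x. x *\<^sub>R D2 u a a)) (at 0)"
  proof -
    have "((\<lambda>s. D (u + s *\<^sub>R a)) has_derivative (\<lambda>x. D2 u (x *\<^sub>R a))) (at 0)"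
      using diff_chain_at[OF line[of 0], of D "D2 u"] D2[OF u(1)] by (simp add: o_def)
    from has_derivative_blinfun_apply[OF this, of a]
    show ?thesis by (simp add: blinfun.scaleR_right blinfun.scaleR_left)
  qed
  have "0 \<le> 2 * K * (D u a \<bullet> D u a) - ?v \<bullet> D2 u a a"
  proof (rule second_derivative_at_minimum[OF \<delta>(1), of f f'])
    show "(f has_real_derivative f' s) (at s)" if "\<bar>s\<bar> < \<delta>" for s
    proof -
      have "(f has_derivative (\<lambda>x. K * (?g s \<bullet> (x *\<^sub>R ?Da s) + (x *\<^sub>R ?Da s) \<bullet> ?g s) - ?v \<bullet> (x *\<^sub>R ?Da s))) (at s)"
        unfolding f_def[abs_def]
        by (rule has_derivative_diff[OF has_derivative_mult_right[OF has_derivative_inner[OF g g]] has_derivative_inner_right[OF g]])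
          (rule that)+
      then show ?thesis unfolding has_field_derivative_def f'_def
        by (rule has_derivative_eq_rhs) (auto simp: fun_eq_iff inner_commute algebra_simps)
    qed
    show "(f' has_real_derivative 2 * K * (D u a \<bullet> D u a) - ?v \<bullet> D2 u a a) (at 0)"
    proof -
      have g0: "(?g has_derivative (\<lambda>x. x *\<^sub>R D u a)) (at 0)" using g[of 0] \<delta> by simp
      have "(f' has_derivative (\<lambda>x. 2 * K * (?g 0 \<bullet> (x *\<^sub>R D2 u a a) + (x *\<^sub>R D u a) \<bullet> ?Da 0) - ?v \<bullet> (x *\<^sub>R D2 u a a))) (at 0)"
        unfolding f'_def[abs_def]
        by (rule has_derivative_diff[OF has_derivative_mult_right[OF has_derivative_inner[OF g0 Da]] has_derivative_inner_right[OF Da]])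
      then show ?thesis unfolding has_field_derivative_def
        by (rule has_derivative_eq_rhs) (auto simp: fun_eq_iff algebra_simps)
    qed
    show "f' 0 = 0" using D_tangent[OF u a] \<nu>_normal[OF u b] tangent_normal_inner[OF u]
      by (simp add: f'_def inner_commute)
    show "f 0 \<le> f s" if "\<bar>s\<bar> < \<delta>" for s
      using K[OF in'(2)[OF that]] by (simp add: f_def power2_norm_eq_inner)
  qed
  then show ?thesis by (simp add: power2_norm_eq_inner inner_commute)
qed

end

end

locale submanifold_reach = positive_reach M t0 for M :: "(real^'n) set" and t0 +
  fixes d :: nat
  assumes submanifold: "C2_submanifold d M"
begin

lemma chart_at:
  assumes "y \<in> M"
  obtains E W \<psi> D D2 Di Di2 u where "chart M E W \<psi> D D2 Di Di2" "dim E = d" "u \<in> W" "u \<in> E" "\<psi> u = y"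
proof -
  obtain E W \<psi> where c: "slice_chart M E W \<psi>" "dim E = d" "y \<in> \<psi> ` W"
    using submanifold assms unfolding C2_submanifold_def by blast
  then have "y \<in> \<psi> ` (W \<inter> E)" using assms by (simp add: slice_chart_def)
  then obtain u where "u \<in> W" "u \<in> E" "\<psi> u = y" by blast
  then show ?thesis using slice_chart_derivatives[OF c(1)] c(2) that by blast
qed

abbreviation "T y \<equiv> tangent_space_at M y"
abbreviation "N y \<equiv> normal_space_at M y"

text \<open>The shape operator is meaningful on tangent vectors only. Composing with the projection
  gives an operator on the whole space that is linear when \<open>v\<close> is normal, as the
  determinant lemmas require.\<close>

definition shape :: "real^'n \<Rightarrow> real^'n \<Rightarrow> real^'n \<Rightarrow> real^'n" where
  "shape y v x = shape_operator M y v (oproj (T y) x)"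

context
  fixes y assumes y: "y \<in> M"
begin

lemma subspace_T: "subspace (T y)" and subspace_N: "subspace (N y)" and dim_T: "dim (T y) = d"
proof -
  obtain E W \<psi> D D2 Di Di2 u where c: "chart M E W \<psi> D D2 Di Di2" "dim E = d" "u \<in> W" "u \<in> E" "\<psi> u = y"
    by (rule chart_at[OF y])
  interpret chart M E W \<psi> D D2 Di Di2 by (rule c)
  show "subspace (T y)" "subspace (N y)" "dim (T y) = d"
    using c subspace_tangent[OF c(3,4)] subspace_normal[OF c(3,4)] dim_tangent[OF c(3,4)] by auto
qed

lemma federer:
  assumes v: "v \<in> N y" and z: "z \<in> M"
  shows "v \<bullet> (z - y) \<le> norm v * (norm (z - y))\<^sup>2 / (2 * t0)"
proof -
  obtain E W \<psi> D D2 Di Di2 u where c: "chart M E W \<psi> D D2 Di Di2" "dim E = d" "u \<in> W" "u \<in> E" "\<psi> u = y"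
    by (rule chart_at[OF y])
  interpret chart M E W \<psi> D D2 Di Di2 by (rule c)
  obtain b where "b \<in> orthogonal_comp E" "v = \<nu> u b"
    using v c normal_space_chart[OF c(3,4)] by auto
  then obtain C where "\<forall>z\<in>M. v \<bullet> (z - y) \<le> C * (norm (z - y))\<^sup>2"
    using normal_deviation_quadratic[OF c(3,4)] c(5) by blast
  then show ?thesis using federer_inequality[OF y z] by blast
qed

lemma nearest_normal:
  assumes "v \<in> N y" "norm v < t0"
  shows "nearest (y + v) = y" "infdist (y + v) M = norm v"
  using nearest_add_normal[OF y assms(2) federer[OF assms(1)]] by auto

lemma shape_properties:
  assumes v: "v \<in> N y"
  shows linear_shape: "linear (shape y v)" and shape_mem: "shape y v x \<in> T y"
    and shape_symmetric: "x \<in> T y \<Longrightarrow> x' \<in> T y \<Longrightarrow> shape y v x \<bullet> x' = x \<bullet> shape y v x'"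
    and shape_bound: "x \<in> T y \<Longrightarrow> \<bar>shape y v x \<bullet> x\<bar> \<le> norm v / t0 * (norm x)\<^sup>2"
    and shape_add: "w \<in> N y \<Longrightarrow> shape y (v + w) x = shape y v x + shape y w x"
    and shape_scale: "shape y (c *\<^sub>R v) x = c *\<^sub>R shape y v x"
proof -
  obtain E W \<psi> D D2 Di Di2 u where c: "chart M E W \<psi> D D2 Di Di2" "dim E = d" "u \<in> W" "u \<in> E" "\<psi> u = y"
    by (rule chart_at[OF y])
  interpret chart M E W \<psi> D D2 Di Di2 by (rule c)
  note [simp] = c(5)
  note u = c(3,4)
  have form: "shape y (\<nu> u b) x = - oproj (T y) (d\<nu> u b (Di y (oproj (T y) x)))" if b: "b \<in> orthogonal_comp E" for b x
  proof -
    have "oproj (T y) x \<in> D u ` E"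
      using oproj_mem[OF subspace_T, of x] tangent_space_chart[OF u] by simp
    then obtain a where a: "a \<in> E" "oproj (T y) x = D u a" by blast
    have "Di y (oproj (T y) x) = a" using Di_D[OF u(1), of a] a(2) by simp
    then show ?thesis using shape_operator_chart[OF u a(1) b] by (simp add: shape_def a(2))
  qed
  obtain b where b: "b \<in> orthogonal_comp E" "v = \<nu> u b" using v normal_space_chart[OF u] by auto
  have T: "subspace (T y)" using subspace_T .
  have tan: "\<exists>a\<in>E. x = D u a" if "x \<in> T y" for x using that tangent_space_chart[OF u] by auto
  \<comment> \<open>The bilinear form of the shape operator is the normal component of the second
    derivative of the chart; symmetry and bounds are read off from this formula.\<close>
  have ip: "shape y (\<nu> u b) (D u a) \<bullet> D u a' = D2 u a a' \<bullet> \<nu> u b"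
    if "a \<in> E" "a' \<in> E" "b \<in> orthogonal_comp E" for a a' b
    using form[OF that(3), of "D u a"] D_tangent[OF u that(1)] D_tangent[OF u that(2)]
      oproj_id[OF T] oproj_inner[OF T] Di_D[OF u(1), of a] D2_inner_\<nu>[OF u(1), of a a' b]
    by (simp add: inner_commute)
  have "linear (\<lambda>x. - oproj (T y) (d\<nu> u b (Di y (oproj (T y) x))))"
    using linear_compose[OF linear_compose[OF linear_compose[OF linear_oproj lin_Di[of y]] linear_d\<nu>(2)] linear_oproj, of "T y" u b "T y"]
    by (intro linear_compose_neg) (simp add: o_def)
  moreover have "shape y v = (\<lambda>x. - oproj (T y) (d\<nu> u b (Di y (oproj (T y) x))))"
    unfolding b(2) by (rule ext) (rule form[OF b(1)])
  ultimately show "linear (shape y v)" by simp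
  show "shape y v x \<in> T y" using form[OF b(1)] oproj_mem[OF T] T by (simp add: b(2) subspace_neg)
  show "shape y v x \<bullet> x' = x \<bullet> shape y v x'" if xx: "x \<in> T y" "x' \<in> T y" for x x'
  proof -
    obtain a a' where a: "a \<in> E" "x = D u a" "a' \<in> E" "x' = D u a'" using tan xx by metis
    have "x \<bullet> shape y v x' = D2 u a' a \<bullet> \<nu> u b" using ip[OF a(3,1) b(1)] a b(2) by (simp add: inner_commute)
    also have "\<dots> = shape y v x \<bullet> x'" using ip[OF a(1,3) b(1)] a b(2) D2_symmetric[OF u(1)] by simp
    finally show ?thesis by simp
  qed
  show "\<bar>shape y v x \<bullet> x\<bar> \<le> norm v / t0 * (norm x)\<^sup>2" if xx: "x \<in> T y" for x
  proof -
    obtain a where a: "a \<in> E" "x = D u a" using tan xx by metis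
    \<comment> \<open>The curvature inequality is one-sided, so the lower bound comes from applying
      it to the opposite normal.\<close>
    have nb: "- b \<in> orthogonal_comp E" "\<nu> u (- b) = - v"
      using b subspace_neg[OF E'] linear_neg[OF linear_\<nu>] by auto
    have nv: "- v \<in> N y" using v subspace_neg[OF subspace_N] by simp
    have 1: "D2 u a a \<bullet> v \<le> 2 * (norm v / (2 * t0)) * (norm (D u a))\<^sup>2"
      using federer[OF v] b by (intro curvature_le[OF u a(1) b(1), folded b(2)]) auto
    have 2: "D2 u a a \<bullet> (- v) \<le> 2 * (norm v / (2 * t0)) * (norm (D u a))\<^sup>2"
      using federer[OF nv] by (intro curvature_le[OF u a(1) nb(1), unfolded nb(2)]) auto
    have "shape y v x \<bullet> x = D2 u a a \<bullet> v" using ip[OF a(1,1) b(1)] a b by simp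
    then show ?thesis using 1 2 a(2) by simp
  qed
  show "shape y (v + w) x = shape y v x + shape y w x" if ww: "w \<in> N y"
  proof -
    obtain b' where b': "b' \<in> orthogonal_comp E" "w = \<nu> u b'" using ww normal_space_chart[OF u] by auto
    have "v + w = \<nu> u (b + b')" using b b' linear_add[OF linear_\<nu>] by simp
    then show ?thesis
      using form[OF b(1)] form[OF b'(1)] form[OF subspace_add[OF E' b(1) b'(1)]]
      by (simp add: b(2)[symmetric] b'(2)[symmetric] linear_add[OF linear_d\<nu>(1)] linear_add[OF linear_oproj])
  qed
  show "shape y (c *\<^sub>R v) x = c *\<^sub>R shape y v x"
  proof -
    have "c *\<^sub>R v = \<nu> u (c *\<^sub>R b)" using b linear_cmul[OF linear_\<nu>] by simp
    then show ?thesis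
      using form[OF b(1)] form[OF subspace_scale[OF E' b(1)], of c]
      by (simp add: b(2)[symmetric] linear_cmul[OF linear_d\<nu>(1)] linear_cmul[OF linear_oproj])
  qed
qed

lemma shape_operator_eq_shape: "x \<in> T y \<Longrightarrow> shape_operator M y v x = shape y v x"
  by (simp add: shape_def oproj_id[OF subspace_T])

lemma trace_shape: "trace_on (T y) (shape_operator M y v) = (\<Sum>b\<in>onb (T y). shape y v b \<bullet> b)"
  unfolding trace_on_def using is_onb_mem[OF is_onb_onb[OF subspace_T]]
  by (intro sum.cong) (simp_all add: shape_operator_eq_shape)

lemma normal_jacobian_shape:
  "normal_jacobian M y v = det_indexed (onb (T y)) (\<lambda>b c. (b - shape y v b) \<bullet> c)"
  unfolding normal_jacobian_def det_on_def using is_onb_mem[OF is_onb_onb[OF subspace_T]]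
  by (intro det_indexed_cong) (simp add: shape_operator_eq_shape)

lemma normal_jacobian_bounds:
  assumes v: "v \<in> N y"
  shows "\<bar>normal_jacobian M y v - 1\<bar> \<le> (1 + norm v / t0) ^ d - 1"
    and "\<bar>normal_jacobian M y v - 1 + trace_on (T y) (shape_operator M y v)\<bar>
      \<le> (1 + norm v / t0) ^ d - 1 - d * (norm v / t0)"
  using det_perturbation_bounds[OF linear_shape[OF v] _ dim_T is_onb_onb[OF subspace_T], of "norm v / t0"]
    shape_mem[OF v] shape_symmetric[OF v] shape_bound[OF v] t0
  unfolding normal_jacobian_shape trace_shape by auto

text \<open>The bound on the shape operator makes the identity minus it positive definite as long as
  \<open>norm v < t0\<close>.\<close>

lemma normal_jacobian_pos:
  assumes v: "v \<in> N y" "norm v < t0"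
  shows "normal_jacobian M y v > 0"
  unfolding normal_jacobian_shape
proof (rule det_indexed_pos_def[OF is_onb_onb[OF subspace_T]])
  show "linear (\<lambda>x. x - shape y v x)" by (intro linear_compose_sub linear_ident linear_shape[OF v(1)])
  fix x assume x: "x \<in> T y" "x \<noteq> 0"
  have "shape y v x \<bullet> x \<le> norm v / t0 * (norm x)\<^sup>2" using shape_bound[OF v(1) x(1)] by linarith
  also have "\<dots> < 1 * (norm x)\<^sup>2" using v(2) x(2) t0 by (intro mult_strict_right_mono) auto
  finally show "(x - shape y v x) \<bullet> x > 0" by (simp add: inner_diff_left power2_norm_eq_inner)
qed

lemma linear_part_linear:
  shows "v \<in> N y \<Longrightarrow> w \<in> N y \<Longrightarrow> linear_part M g y (v + w) = linear_part M g y v + linear_part M g y w"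
    and "v \<in> N y \<Longrightarrow> linear_part M g y (c *\<^sub>R v) = c * linear_part M g y v"
  by (simp_all add: linear_part_def trace_shape shape_add shape_scale inner_add_right inner_add_left
      sum.distrib sum_distrib_left algebra_simps)

end

text \<open>First-order condition: along any curve in \<open>M\<close> through the nearest point the
  squared distance to \<open>x\<close> is minimal there.\<close>

lemma nearest_diff_normal: "x - nearest x \<in> N (nearest x)"
proof -
  have "v \<bullet> (x - nearest x) = 0" if vT: "v \<in> T (nearest x)" for v
  proof -
    obtain \<epsilon> \<gamma> where \<gamma>: "\<epsilon> > 0" "\<gamma> ` {-\<epsilon><..<\<epsilon>} \<subseteq> M" "\<gamma> 0 = nearest x" "(\<gamma> has_vector_derivative v) (at 0)"
      using vT unfolding tangent_space_at_def by blast
    define f where "f t = (x - \<gamma> t) \<bullet> (x - \<gamma> t)" for t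
    have "((\<lambda>t. x - \<gamma> t) has_derivative (\<lambda>t. - (t *\<^sub>R v))) (at 0)"
      using \<gamma>(4) unfolding has_vector_derivative_def by (auto intro!: derivative_eq_intros)
    from has_derivative_inner[OF this this]
    have "(f has_real_derivative - 2 * (v \<bullet> (x - nearest x))) (at 0)"
      unfolding has_field_derivative_def f_def[abs_def]
      by (rule has_derivative_eq_rhs) (auto simp: fun_eq_iff \<gamma>(3) inner_commute)
    moreover have "\<forall>t. \<bar>0 - t\<bar> < \<epsilon> \<longrightarrow> f 0 \<le> f t"
    proof (intro allI impI)
      fix t assume "\<bar>0 - t\<bar> < \<epsilon>"
      then have "t \<in> {-\<epsilon><..<\<epsilon>}" by auto
      then have "\<gamma> t \<in> M" using \<gamma>(2) by blast
      then have "norm (x - \<gamma> 0) \<le> norm (x - \<gamma> t)"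
        using closest_point_le[OF closed, of "\<gamma> t" x] by (simp add: \<gamma>(3) dist_norm)
      then have "(norm (x - \<gamma> 0))\<^sup>2 \<le> (norm (x - \<gamma> t))\<^sup>2" by (intro power_mono) auto
      then show "f 0 \<le> f t" by (simp add: f_def power2_norm_eq_inner)
    qed
    ultimately have "- 2 * (v \<bullet> (x - nearest x)) = 0" by (rule DERIV_local_min[OF _ \<gamma>(1)])
    then show ?thesis by simp
  qed
  then show ?thesis by (simp add: normal_space_at_def orthogonal_comp_def orthogonal_def)
qed

end

section \<open>Normal coordinates\<close>

lemma gram_det_pos:
  fixes A :: "real^'n \<Rightarrow> real^'n"
  assumes E: "subspace E" and A: "linear A" and inj: "\<And>x. x \<in> E \<Longrightarrow> x \<noteq> 0 \<Longrightarrow> A x \<noteq> 0"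
  shows "gram_det E A > 0"
proof -
  have val: "(adjoint A \<circ> A) b \<bullet> c = A b \<bullet> A c" for b c
    by (simp add: adjoint_works[OF A] inner_commute)
  have "det_indexed (onb E) (\<lambda>b c. (adjoint A \<circ> A) b \<bullet> c) > 0"
  proof (rule det_indexed_pos_def[OF is_onb_onb[OF E] linear_compose[OF A adjoint_linear[OF A]]])
    show "(adjoint A \<circ> A) x \<bullet> x > 0" if "x \<in> E" "x \<noteq> 0" for x
      unfolding val using inj[OF that] by simp
  qed
  then show ?thesis unfolding gram_det_def val .
qed

lemma gram_det_cong:
  assumes "subspace E" "\<And>x. x \<in> E \<Longrightarrow> A x = B x"
  shows "gram_det E A = gram_det E B"
  unfolding gram_det_def using is_onb_mem[OF is_onb_onb[OF assms(1)]]
  by (intro det_indexed_cong) (simp add: assms(2))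

lemma borel_vimage_continuous_on:
  fixes f :: "'a::topological_space \<Rightarrow> 'b::topological_space"
  assumes "continuous_on S f" "S \<in> sets borel" "B \<in> sets borel"
  shows "{x \<in> S. f x \<in> B} \<in> sets borel"
proof -
  have "f -` B \<inter> space (restrict_space borel S) \<in> sets (restrict_space borel S)"
    using measurable_sets[OF borel_measurable_continuous_on_restrict[OF assms(1)] assms(3)] .
  then have "f -` B \<inter> S \<in> sets borel"
    using assms(2) by (simp add: space_restrict_space sets_restrict_space_iff)
  moreover have "f -` B \<inter> S = {x \<in> S. f x \<in> B}" by auto
  ultimately show ?thesis by simp
qed

locale tube_radius = submanifold_reach M t0 d for M :: "(real^'n) set" and t0 d +
  fixes r :: real
  assumes r: "0 < r" "r < t0"
begin

text \<open>The inner integral of the tube formula, named so that the integrand can vary;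
  \<open>fibre_integral (\<lambda>_. 1) y\<close> is the mass of the fibre over
  \<open>y\<close>.\<close>

definition fibre_integral :: "(real^'n \<Rightarrow> ennreal) \<Rightarrow> real^'n \<Rightarrow> ennreal" where
  "fibre_integral f y = (\<integral>\<^sup>+v\<in>N y \<inter> ball 0 r. f (y + v) * ennreal (normal_jacobian M y v) \<partial>lborel_sub (N y))"

definition tube_over :: "(real^'n) set \<Rightarrow> (real^'n) set" where
  "tube_over B = {x \<in> tube M r. nearest x \<in> B}"

lemma open_tube: "open (tube M r)"
  unfolding tube_def by (intro open_Collect_less continuous_intros)

lemma continuous_on_nearest_tube: "continuous_on (tube M r) nearest"
  using r by (intro continuous_on_subset[OF continuous_on_nearest]) (auto simp: tube_def)

lemma tube_over_borel: "B \<in> sets borel \<Longrightarrow> tube_over B \<in> sets borel"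
  unfolding tube_over_def
  by (rule borel_vimage_continuous_on[OF continuous_on_nearest_tube borel_open[OF open_tube]])

end

locale tube_chart = tube_radius M t0 d r + chart M E W \<psi> D D2 Di Di2
  for M :: "(real^'n) set" and t0 d r E W \<psi> D D2 Di Di2
begin

abbreviation "\<pi> \<equiv> oproj E"

text \<open>Base point and normal coefficient are packed into one vector \<open>w\<close>, with
  \<open>\<pi> w\<close> in \<open>E\<close> and \<open>w - \<pi> w\<close> in its complement, so
  that domain and range are the same Euclidean space and the change of variables applies
  directly.\<close>

definition \<Phi> :: "real^'n \<Rightarrow> real^'n" where "\<Phi> w = \<psi> (\<pi> w) + \<nu> (\<pi> w) (w - \<pi> w)"

text \<open>The derivative of \<open>\<Phi>\<close>; the middle term accounts for the turning of the
  normal frame and vanishes for \<open>w\<close> in \<open>E\<close>.\<close>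

definition L :: "real^'n \<Rightarrow> real^'n \<Rightarrow> real^'n" where
  "L w h = D (\<pi> w) (\<pi> h) + d\<nu> (\<pi> w) (w - \<pi> w) (\<pi> h) + \<nu> (\<pi> w) (h - \<pi> h)"

lemma bounded_linear_\<pi>: "bounded_linear \<pi>"
  using linear_oproj by (simp add: linear_conv_bounded_linear)

lemma cont_\<pi>: "continuous_on S \<pi>"
  by (rule linear_continuous_on[OF bounded_linear_\<pi>])

lemma \<pi>_sum: "u \<in> E \<Longrightarrow> b \<in> orthogonal_comp E \<Longrightarrow> \<pi> (u + b) = u"
  by (rule oproj_add[OF E])

lemma has_derivative_\<Phi>:
  assumes w: "\<pi> w \<in> W" shows "(\<Phi> has_derivative L w) (at w)"
proof -
  have p: "(\<pi> has_derivative \<pi>) (at w)" by (rule bounded_linear_imp_has_derivative[OF bounded_linear_\<pi>])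
  have 1: "((\<lambda>w. \<psi> (\<pi> w)) has_derivative (\<lambda>h. D (\<pi> w) (\<pi> h))) (at w)"
    using diff_chain_at[OF p D[OF w]] by (simp add: o_def)
  have "((\<lambda>w. Di (\<psi> (\<pi> w))) has_derivative (\<lambda>h. Di2 (\<psi> (\<pi> w)) (D (\<pi> w) (\<pi> h)))) (at w)"
    using diff_chain_at[OF 1, of Di "Di2 (\<psi> (\<pi> w))"] Di2[of "\<psi> (\<pi> w)"] w by (simp add: o_def)
  then have 2: "((\<lambda>w. Di (\<psi> (\<pi> w)) i) has_derivative (\<lambda>h. Di2 (\<psi> (\<pi> w)) (D (\<pi> w) (\<pi> h)) i)) (at w)" for i
    by (rule has_derivative_blinfun_apply)
  have 3: "((\<lambda>w. w - \<pi> w) has_derivative (\<lambda>h. h - \<pi> h)) (at w)" by (intro has_derivative_diff has_derivative_ident p)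
  have "((\<lambda>w. \<psi> (\<pi> w) + (\<Sum>i\<in>Basis. (Di (\<psi> (\<pi> w)) i \<bullet> (w - \<pi> w)) *\<^sub>R i)) has_derivative
     (\<lambda>h. D (\<pi> w) (\<pi> h) + (\<Sum>i\<in>Basis. (Di (\<psi> (\<pi> w)) i \<bullet> (h - \<pi> h)
        + Di2 (\<psi> (\<pi> w)) (D (\<pi> w) (\<pi> h)) i \<bullet> (w - \<pi> w)) *\<^sub>R i))) (at w)"
    by (intro has_derivative_add[OF 1] has_derivative_sum has_derivative_scaleR_left has_derivative_inner[OF 2 3])
  then show ?thesis unfolding \<Phi>_def[abs_def] \<nu>_def
    by (rule has_derivative_eq_rhs) (simp add: fun_eq_iff L_def d\<nu>_def \<nu>_def scaleR_add_left sum.distrib)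
qed

lemma linear_L: "linear (L w)"
proof -
  have "linear (\<lambda>h. D (\<pi> w) (\<pi> h))"
    using linear_compose[OF linear_oproj lin_D] by (simp add: o_def)
  moreover have "linear (\<lambda>h. d\<nu> (\<pi> w) (w - \<pi> w) (\<pi> h))"
    using linear_compose[OF linear_oproj linear_d\<nu>(2)] by (simp add: o_def)
  moreover have "linear (\<lambda>h. \<nu> (\<pi> w) (h - \<pi> h))"
    using linear_compose[OF linear_compose_sub[OF linear_ident linear_oproj] linear_\<nu>] by (simp add: o_def)
  ultimately show ?thesis unfolding L_def[abs_def] by (intro linear_compose_add)
qed

lemma continuous_on_det_L: "continuous_on {w. \<pi> w \<in> W} (\<lambda>w. det (matrix (L w)))"
proof -
  let ?O = "{w. \<pi> w \<in> W}"
  have D': "continuous_on ?O (\<lambda>w. D (\<pi> w))" by (intro continuous_on_compose2[OF cont_D cont_\<pi>]) auto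
  have \<psi>': "continuous_on ?O (\<lambda>w. \<psi> (\<pi> w))" by (intro continuous_on_compose2[OF cont_\<psi> cont_\<pi>]) auto
  have Di': "continuous_on ?O (\<lambda>w. Di (\<psi> (\<pi> w)))" by (intro continuous_on_compose2[OF cont_Di \<psi>']) auto
  have Di2': "continuous_on ?O (\<lambda>w. Di2 (\<psi> (\<pi> w)))" by (intro continuous_on_compose2[OF cont_Di2 \<psi>']) auto
  have "continuous_on ?O (\<lambda>w. L w h)" for h
    unfolding L_def d\<nu>_def \<nu>_def by (intro continuous_intros cont_\<pi> D' Di' Di2')
  then show ?thesis unfolding det_def matrix_def
    by (auto intro!: continuous_intros)
qed

text \<open>At zero normal coefficient the two parts of \<open>L u x\<close> are tangent and normal,
  so they vanish separately, and each depends injectively on its part of \<open>x\<close>.\<close>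

lemma linear_isomorphism_L:
  assumes u: "u \<in> W" "u \<in> E" shows "L u x = D u (\<pi> x) + \<nu> u (x - \<pi> x)" "L u x = 0 \<Longrightarrow> x = 0"
proof -
  have pu: "\<pi> u = u" using oproj_id[OF E u(2)] .
  show form: "L u x = D u (\<pi> x) + \<nu> u (x - \<pi> x)"
    using linear_0[OF linear_d\<nu>(1)] by (simp add: L_def pu)
  assume 0: "L u x = 0"
  let ?t = "D u (\<pi> x)" and ?n = "\<nu> u (x - \<pi> x)"
  have "?t \<bullet> ?n = 0"
    by (rule tangent_normal_inner[OF u D_tangent[OF u oproj_mem[OF E]] \<nu>_normal[OF u diff_oproj_perp[OF E]]])
  moreover have "?t = - ?n" using 0 form by (simp add: eq_neg_iff_add_eq_0)
  ultimately have "?n = 0" by simp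
  then have "?t = 0" using \<open>?t = - ?n\<close> by simp
  have "x - \<pi> x = 0" using \<open>?n = 0\<close> \<nu>_eq_0_iff[OF u(1)] by blast
  moreover have "\<pi> x = 0" using \<open>?t = 0\<close> Di_D[OF u(1), of "\<pi> x"] by simp
  ultimately show "x = 0" by simp
qed

lemma det_L_nonzero: assumes u: "u \<in> W" "u \<in> E" shows "det (matrix (L u)) \<noteq> 0"
proof -
  have "\<forall>x. matrix (L u) *v x = 0 \<longrightarrow> x = 0"
    using linear_isomorphism_L(2)[OF u] by (simp add: matrix_works linear_matrix_vector_mul_eq linear_L)
  then show ?thesis
    using matrix_left_invertible_ker[of "matrix (L u)"] by (metis invertible_det_nz invertible_left_inverse)
qed

lemma abs_det_L:
  assumes u: "u \<in> W" "u \<in> E"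
  shows "\<bar>det (matrix (L u))\<bar> = sqrt (gram_det E (D u)) * sqrt (gram_det (orthogonal_comp E) (\<nu> u))"
proof -
  have LE: "L u x = D u x" if "x \<in> E" for x
    using that linear_0[OF linear_\<nu>] by (simp add: linear_isomorphism_L(1)[OF u] oproj_id[OF E])
  have LN: "L u x = \<nu> u x" if "x \<in> orthogonal_comp E" for x
    using that linear_0[OF lin_D] by (simp add: linear_isomorphism_L(1)[OF u] oproj_perp[OF E])
  have "\<bar>det (matrix (L u))\<bar> = sqrt (gram_det E (L u)) * sqrt (gram_det (orthogonal_comp E) (L u))"
  proof (rule gram_det_block[OF E linear_L])
    fix x y assume "x \<in> E" "y \<in> orthogonal_comp E"
    then show "L u x \<bullet> L u y = 0"
      using tangent_normal_inner[OF u D_tangent[OF u] \<nu>_normal[OF u]] by (simp add: LE LN)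
  qed
  then show ?thesis using gram_det_cong[OF E LE] gram_det_cong[OF E' LN] by simp
qed

lemma gram_D_pos: "u \<in> W \<Longrightarrow> gram_det E (D u) > 0"
  using Di_D by (intro gram_det_pos[OF E lin_D]) (metis blinfun.zero_right)

lemma gram_\<nu>_pos: "u \<in> W \<Longrightarrow> gram_det (orthogonal_comp E) (\<nu> u) > 0"
  using \<nu>_eq_0_iff by (intro gram_det_pos[OF E' linear_\<nu>]) blast

text \<open>Let \<open>Z\<close> be \<open>L (u + b)\<close> after the inverse of
  \<open>L u\<close>. It fixes the normal space and sends a tangent vector \<open>s = D u a\<close>
  to \<open>s + d\<nu> u b a\<close>, whose tangential part is \<open>s\<close> minus the shape
  operator applied to \<open>s\<close>. The normal part does not enter the block
  determinant.\<close>

lemma det_L_normal_jacobian: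
  assumes u: "u \<in> W" "u \<in> E" and b: "b \<in> orthogonal_comp E"
  shows "det (matrix (L (u + b))) = normal_jacobian M (\<psi> u) (\<nu> u b) * det (matrix (L u))"
proof -
  let ?y = "\<psi> u" and ?v = "\<nu> u b"
  have y: "?y \<in> M" using \<psi>_in_M_iff u by blast
  have v: "?v \<in> N ?y" by (rule \<nu>_normal[OF u b])
  have inj: "inj (L u)" using linear_isomorphism_L(2)[OF u] linear_injective_0[OF linear_L] by blast
  obtain A' where A': "linear A'" "\<And>x. A' (L u x) = x" "\<And>x. L u (A' x) = x"
    using linear_injective_isomorphism[OF linear_L inj] by blast
  define Z where "Z = L (u + b) \<circ> A'"
  have linZ: "linear Z" unfolding Z_def by (rule linear_compose[OF A'(1) linear_L])
  have form: "L (u + b) x = D u (\<pi> x) + d\<nu> u b (\<pi> x) + \<nu> u (x - \<pi> x)" for x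
    by (simp add: L_def \<pi>_sum[OF u(2) b])
  have A'n: "A' (\<nu> u b') = b'" if "b' \<in> orthogonal_comp E" for b'
    using A'(2)[of b'] that linear_0[OF lin_D] by (simp add: linear_isomorphism_L(1)[OF u] oproj_perp[OF E])
  have A't: "A' (D u a) = a" if "a \<in> E" for a
    using A'(2)[of a] that linear_0[OF linear_\<nu>] by (simp add: linear_isomorphism_L(1)[OF u] oproj_id[OF E])
  have "det (matrix Z) = det_indexed (onb (T ?y)) (\<lambda>s c. Z s \<bullet> c)"
  proof (rule det_matrix_block[OF is_onb_onb[OF subspace_T[OF y]] linZ])
    fix n assume "n \<in> orthogonal_comp (T ?y)"
    then have "n \<in> N ?y" by (simp add: normal_space_at_def)
    then obtain b' where "b' \<in> orthogonal_comp E" "n = \<nu> u b'" using normal_space_chart[OF u] by auto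
    then show "Z n = n"
      using linear_0[OF lin_D] linear_0[OF linear_d\<nu>(2)] by (simp add: Z_def A'n form oproj_perp[OF E])
  qed
  also have "\<dots> = normal_jacobian M ?y ?v"
    unfolding normal_jacobian_shape[OF y]
  proof (rule det_indexed_cong)
    fix s c assume "s \<in> onb (T ?y)" "c \<in> onb (T ?y)"
    then have s: "s \<in> T ?y" and c: "c \<in> T ?y" using is_onb_mem[OF is_onb_onb[OF subspace_T[OF y]]] by auto
    obtain a where a: "a \<in> E" "s = D u a" using s tangent_space_chart[OF u] by auto
    have "shape ?y ?v s = - oproj (T ?y) (d\<nu> u b a)"
      using shape_operator_chart[OF u a(1) b] shape_operator_eq_shape[OF y s] a(2) by simp
    then have "(s - shape ?y ?v s) \<bullet> c = s \<bullet> c + d\<nu> u b a \<bullet> c"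
      using oproj_inner[OF subspace_T[OF y] c] by (simp add: inner_diff_left inner_add_left)
    moreover have "Z s = s + d\<nu> u b a"
      using linear_0[OF linear_\<nu>] a by (simp add: Z_def A't form oproj_id[OF E])
    ultimately show "Z s \<bullet> c = (s - shape ?y ?v s) \<bullet> c" by (simp add: inner_add_left)
  qed
  finally have "det (matrix Z) = normal_jacobian M ?y ?v" .
  moreover have "L (u + b) = Z \<circ> L u" by (simp add: Z_def fun_eq_iff A'(2))
  ultimately show ?thesis using matrix_compose[OF linear_L linZ] by (simp add: det_mul)
qed

text \<open>The Jacobian is only meaningful for normal \<open>v\<close>. A Borel function on the
  ambient space is obtained by recovering the coefficient \<open>b\<close> from \<open>v\<close>
  with the transpose of \<open>D u\<close> and taking a quotient of determinants.\<close>

lemma normal_jacobian_borel: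
  assumes u: "u \<in> W" "u \<in> E"
  shows "\<exists>J \<in> borel_measurable borel. \<forall>v\<in>N (\<psi> u). J v = normal_jacobian M (\<psi> u) v"
proof (intro bexI ballI)
  let ?b = "\<lambda>v. oproj (orthogonal_comp E) (adjoint (D u) v)"
  let ?J = "\<lambda>v. det (matrix (L (u + ?b v))) / det (matrix (L u))"
  have b: "?b v \<in> orthogonal_comp E" for v by (rule oproj_mem[OF E'])
  have "continuous_on UNIV (adjoint (blinfun_apply (D u)))"
    using adjoint_linear[OF lin_D] by (simp add: linear_continuous_on linear_conv_bounded_linear)
  then have "continuous_on UNIV (\<lambda>v. u + ?b v)"
    using linear_oproj[of "orthogonal_comp E"]
    by (intro continuous_intros continuous_on_compose2[of UNIV "oproj (orthogonal_comp E)" UNIV "adjoint (blinfun_apply (D u))"])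
      (auto simp: linear_continuous_on linear_conv_bounded_linear)
  then have "continuous_on UNIV (\<lambda>v. det (matrix (L (u + ?b v))))"
    using \<pi>_sum[OF u(2) b] u by (intro continuous_on_compose2[OF continuous_on_det_L]) auto
  then show "?J \<in> borel_measurable borel"
    by (intro borel_measurable_divide borel_measurable_const borel_measurable_continuous_onI)
  fix v assume "v \<in> N (\<psi> u)"
  then obtain b' where b': "b' \<in> orthogonal_comp E" "v = \<nu> u b'" using normal_space_chart[OF u] by auto
  have "x \<bullet> adjoint (D u) v = x \<bullet> b'" for x
    using adjoint_works[OF lin_D, of x u v] b' u(1) by simp
  then have "adjoint (D u) v = b'" by (metis inner_commute vector_eq_rdot)
  then have "?b v = b'" using oproj_id[OF E' b'(1)] by simp
  then show "?J v = normal_jacobian M (\<psi> u) v"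
    using det_L_normal_jacobian[OF u b'(1)] det_L_nonzero[OF u] b'(2) by simp
qed

end

section \<open>The tube formula over one chart\<close>

context tube_chart
begin

context
  fixes A assumes A: "A \<in> sets borel" "A \<subseteq> W \<inter> E"
begin

definition chart_tube :: "(real^'n) set" where
  "chart_tube = {w. \<pi> w \<in> A \<and> norm (\<nu> (\<pi> w) (w - \<pi> w)) < r}"

lemma preimage_\<pi>_borel: "{w. \<pi> w \<in> A} \<in> sets borel"
  using borel_vimage_continuous_on[OF cont_\<pi>[of UNIV] _ A(1)] by simp

lemma chart_tube_borel: "chart_tube \<in> sets borel"
proof -
  have Di': "continuous_on {w. \<pi> w \<in> A} (\<lambda>w. Di (\<psi> (\<pi> w)))"
    using A(2) by (intro continuous_on_compose2[OF cont_Di] continuous_on_compose2[OF cont_\<psi> cont_\<pi>]) auto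
  have "continuous_on {w. \<pi> w \<in> A} (\<lambda>w. norm (\<nu> (\<pi> w) (w - \<pi> w)))"
    unfolding \<nu>_def by (intro continuous_intros cont_\<pi> Di')
  from borel_vimage_continuous_on[OF this preimage_\<pi>_borel, of "{..<r}"] show ?thesis
    by (simp add: chart_tube_def)
qed

lemma nearest_\<Phi>:
  assumes w: "w \<in> chart_tube"
  shows "\<Phi> w \<in> tube M r" "nearest (\<Phi> w) = \<psi> (\<pi> w)"
proof -
  have u: "\<pi> w \<in> W" "\<pi> w \<in> E" using w A(2) by (auto simp: chart_tube_def)
  have y: "\<psi> (\<pi> w) \<in> M" using \<psi>_in_M_iff u by blast
  have v: "\<nu> (\<pi> w) (w - \<pi> w) \<in> N (\<psi> (\<pi> w))" by (rule \<nu>_normal[OF u diff_oproj_perp[OF E]])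
  have n: "norm (\<nu> (\<pi> w) (w - \<pi> w)) < t0" "norm (\<nu> (\<pi> w) (w - \<pi> w)) < r"
    using w r by (auto simp: chart_tube_def)
  show "\<Phi> w \<in> tube M r" "nearest (\<Phi> w) = \<psi> (\<pi> w)"
    using nearest_normal[OF y v n(1)] n(2) by (auto simp: \<Phi>_def tube_def)
qed

lemma inj_on_\<Phi>: "inj_on \<Phi> chart_tube"
proof (rule inj_onI)
  fix w w' assume w: "w \<in> chart_tube" "w' \<in> chart_tube" and eq: "\<Phi> w = \<Phi> w'"
  have u: "\<pi> w \<in> W" "\<pi> w' \<in> W" using w A(2) by (auto simp: chart_tube_def)
  have "\<psi> (\<pi> w) = \<psi> (\<pi> w')" using nearest_\<Phi>(2)[OF w(1)] nearest_\<Phi>(2)[OF w(2)] eq by simp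
  then have p: "\<pi> w = \<pi> w'" using inj u by (simp add: inj_on_def)
  then have "\<nu> (\<pi> w) ((w - \<pi> w) - (w' - \<pi> w)) = 0"
    using eq by (simp add: \<Phi>_def linear_diff[OF linear_\<nu>])
  then have "(w - \<pi> w) - (w' - \<pi> w) = 0" using \<nu>_eq_0_iff[OF u(1)] by blast
  then show "w = w'" by simp
qed

text \<open>A point of the tube determines \<open>u\<close> through its nearest point and
  \<open>b\<close> through the normal vector \<open>x - nearest x\<close>, which gives
  surjectivity.\<close>

lemma image_\<Phi>: "\<Phi> ` chart_tube = tube_over (\<psi> ` A)"
proof (intro equalityI subsetI)
  fix x assume "x \<in> \<Phi> ` chart_tube"
  then show "x \<in> tube_over (\<psi> ` A)"
    using nearest_\<Phi> by (auto simp: tube_over_def chart_tube_def)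
next
  fix x assume "x \<in> tube_over (\<psi> ` A)"
  then obtain u where u: "u \<in> A" "nearest x = \<psi> u" and xt: "infdist x M < r"
    by (auto simp: tube_over_def tube_def)
  have uW: "u \<in> W" "u \<in> E" using u A(2) by auto
  have "x - \<psi> u \<in> N (\<psi> u)" using nearest_diff_normal[of x] u(2) by simp
  then obtain b where b: "b \<in> orthogonal_comp E" "x - \<psi> u = \<nu> u b" using normal_space_chart[OF uW] by auto
  have pw: "\<pi> (u + b) = u" by (rule \<pi>_sum[OF uW(2) b(1)])
  have "norm (\<nu> u b) < r" using dist_nearest[of x] xt by (simp add: b(2)[symmetric] u(2) dist_norm)
  then have "u + b \<in> chart_tube" using u(1) by (simp add: chart_tube_def pw)
  moreover have "\<Phi> (u + b) = x" using b(2)[symmetric] by (simp add: \<Phi>_def pw)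
  ultimately show "x \<in> \<Phi> ` chart_tube" by blast
qed

lemma image_chart_borel: "\<psi> ` A \<in> sets borel"
proof -
  have "\<psi> ` A = {y \<in> \<psi> ` W. \<psi>i y \<in> A}"
    using A(2) inv_into_f_f[OF inj] by (force simp: f_inv_into_f)
  then show ?thesis
    using borel_vimage_continuous_on[OF cont_\<psi>i borel_open[OF openV] A(1)] by simp
qed

abbreviation "jac u \<equiv> sqrt (gram_det E (D u))"

lemma chart_tube_integrand_borel:
  assumes f: "f \<in> borel_measurable borel"
  shows "(\<lambda>w. f (\<Phi> w) * ennreal \<bar>det (matrix (L w))\<bar> * indicator chart_tube w) \<in> borel_measurable borel"
    and "(\<lambda>w. if w \<in> chart_tube then \<bar>det (matrix (L w))\<bar> else 0) \<in> borel_measurable borel"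
proof -
  have sub: "chart_tube \<subseteq> {w. \<pi> w \<in> W}" using A(2) by (auto simp: chart_tube_def)
  have "continuous_on {w. \<pi> w \<in> W} \<Phi>"
    by (rule has_derivative_continuous_on[OF has_derivative_at_withinI[OF has_derivative_\<Phi>]]) simp
  then have "(\<lambda>w. if w \<in> chart_tube then \<Phi> w else 0) \<in> borel_measurable borel"
    using sub by (intro borel_measurable_continuous_on_if[OF chart_tube_borel]) (auto intro: continuous_on_subset)
  from measurable_compose[OF this f]
  have 1: "(\<lambda>w. f (if w \<in> chart_tube then \<Phi> w else 0)) \<in> borel_measurable borel" .
  show 2: "(\<lambda>w. if w \<in> chart_tube then \<bar>det (matrix (L w))\<bar> else 0) \<in> borel_measurable borel"
    using sub by (intro borel_measurable_continuous_on_if[OF chart_tube_borel] continuous_intros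
        continuous_on_subset[OF continuous_on_det_L]) auto
  have "(\<lambda>w. f (if w \<in> chart_tube then \<Phi> w else 0) * ennreal (if w \<in> chart_tube then \<bar>det (matrix (L w))\<bar> else 0)
      * indicator chart_tube w) \<in> borel_measurable borel"
    using 1 2 chart_tube_borel by measurable
  moreover have "(\<lambda>w. f (if w \<in> chart_tube then \<Phi> w else 0) * ennreal (if w \<in> chart_tube then \<bar>det (matrix (L w))\<bar> else 0)
      * indicator chart_tube w) = (\<lambda>w. f (\<Phi> w) * ennreal \<bar>det (matrix (L w))\<bar> * indicator chart_tube w)"
    by (auto simp: fun_eq_iff indicator_def)
  ultimately show "(\<lambda>w. f (\<Phi> w) * ennreal \<bar>det (matrix (L w))\<bar> * indicator chart_tube w) \<in> borel_measurable borel"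
    by simp
qed

text \<open>The determinant at \<open>u + b\<close> factors into \<open>normal_jacobian\<close>,
  \<open>jac u\<close> and the Gram factor of \<open>\<nu> u\<close>; the last is absorbed by the
  linear substitution \<open>v = \<nu> u b\<close> in the normal space.\<close>

lemma fibre_integral_chart:
  assumes f: "f \<in> borel_measurable borel" and u: "u \<in> A"
  shows "(\<integral>\<^sup>+b. f (\<Phi> (u + b)) * ennreal \<bar>det (matrix (L (u + b)))\<bar> * indicator chart_tube (u + b)
      \<partial>lborel_sub (orthogonal_comp E)) = ennreal (jac u) * fibre_integral f (\<psi> u)"
proof -
  have uW: "u \<in> W" "u \<in> E" using u A(2) by auto
  let ?y = "\<psi> u"
  have y: "?y \<in> M" using \<psi>_in_M_iff uW by blast
  obtain J where J': "J \<in> borel_measurable borel" "\<forall>v\<in>N ?y. J v = normal_jacobian M ?y v"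
    using normal_jacobian_borel[OF uW] by blast
  note J = J'(1) J'(2)[rule_format]
  define h where "h v = f (?y + v) * ennreal (J v) * indicator (ball 0 r) v" for v
  have [measurable]: "ball (0::real^'n) r \<in> sets borel" by simp
  have hm: "h \<in> borel_measurable borel" unfolding h_def[abs_def] using f J(1) by measurable
  let ?s = "sqrt (gram_det (orthogonal_comp E) (\<nu> u))"
  have dimE: "dim E = dim (T ?y)" using dim_tangent[OF uW] by simp
  have "(\<integral>\<^sup>+b. f (\<Phi> (u + b)) * ennreal \<bar>det (matrix (L (u + b)))\<bar> * indicator chart_tube (u + b)
      \<partial>lborel_sub (orthogonal_comp E)) = (\<integral>\<^sup>+b. ennreal (jac u) * (h (\<nu> u b) * ennreal ?s) \<partial>lborel_sub (orthogonal_comp E))"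
  proof (rule nn_integral_cong_AE)
    show "AE b in lborel_sub (orthogonal_comp E).
      f (\<Phi> (u + b)) * ennreal \<bar>det (matrix (L (u + b)))\<bar> * indicator chart_tube (u + b)
        = ennreal (jac u) * (h (\<nu> u b) * ennreal ?s)"
      using AE_lborel_sub[OF E']
    proof eventually_elim
      fix b assume b: "b \<in> orthogonal_comp E"
      let ?v = "\<nu> u b"
      have v: "?v \<in> N ?y" by (rule \<nu>_normal[OF uW b])
      have pw: "\<pi> (u + b) = u" by (rule \<pi>_sum[OF uW(2) b])
      have ph: "\<Phi> (u + b) = ?y + ?v" by (simp add: \<Phi>_def pw)
      show "f (\<Phi> (u + b)) * ennreal \<bar>det (matrix (L (u + b)))\<bar> * indicator chart_tube (u + b)
        = ennreal (jac u) * (h ?v * ennreal ?s)"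
      proof (cases "norm ?v < r")
        case True
        \<comment> \<open>Positivity removes the absolute value, so that the signed Jacobian of the
          statement appears.\<close>
        then have Jp: "normal_jacobian M ?y ?v > 0" using normal_jacobian_pos[OF y v] r by simp
        have "\<bar>det (matrix (L (u + b)))\<bar> = normal_jacobian M ?y ?v * (jac u * ?s)"
          using det_L_normal_jacobian[OF uW b] abs_det_L[OF uW] Jp by (simp add: abs_mult)
        then have "ennreal \<bar>det (matrix (L (u + b)))\<bar> = ennreal (J ?v) * (ennreal (jac u) * ennreal ?s)"
          using Jp gram_D_pos[OF uW(1)] gram_\<nu>_pos[OF uW(1)] by (simp add: J(2)[OF v] ennreal_mult)
        moreover have "u + b \<in> chart_tube" using True u by (simp add: chart_tube_def pw)
        ultimately show ?thesis using True by (simp add: ph h_def mult_ac)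
      next
        case False
        then have "u + b \<notin> chart_tube" by (simp add: chart_tube_def pw)
        then show ?thesis using False by (simp add: h_def)
      qed
    qed
  qed
  also have "\<dots> = ennreal (jac u) * (\<integral>\<^sup>+b. h (\<nu> u b) * ennreal ?s \<partial>lborel_sub (orthogonal_comp E))"
    using hm linear_borel_measurable[OF linear_\<nu>] by (intro nn_integral_cmult) simp
  also have "(\<integral>\<^sup>+b. h (\<nu> u b) * ennreal ?s \<partial>lborel_sub (orthogonal_comp E)) = (\<integral>\<^sup>+v. h v \<partial>lborel_sub (orthogonal_comp (T ?y)))"
    using gram_\<nu>_pos[OF uW(1)] \<nu>_normal[OF uW]
    by (intro nn_integral_lborel_sub_linear[symmetric] E subspace_T[OF y] dimE linear_\<nu> hm)
      (auto simp: normal_space_at_def)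
  also have "\<dots> = fibre_integral f ?y"
    unfolding fibre_integral_def normal_space_at_def[symmetric]
  proof (rule nn_integral_cong_AE)
    show "AE v in lborel_sub (N ?y). h v = f (?y + v) * ennreal (normal_jacobian M ?y v) * indicator (N ?y \<inter> ball 0 r) v"
      using AE_lborel_sub[OF subspace_N[OF y]]
      by eventually_elim (simp add: h_def J(2) indicator_def)
  qed
  finally show ?thesis .
qed

lemma fibre_integral_chart_borel:
  assumes f: "f \<in> borel_measurable borel"
  shows "(\<lambda>u. ennreal (jac u) * fibre_integral f (\<psi> u) * indicator A u) \<in> borel_measurable borel"
proof -
  let ?F = "\<lambda>u. \<integral>\<^sup>+b. f (\<Phi> (u + b)) * ennreal \<bar>det (matrix (L (u + b)))\<bar> * indicator chart_tube (u + b)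
      \<partial>lborel_sub (orthogonal_comp E)"
  have "?F \<in> borel_measurable borel"
    by (rule borel_measurable_nn_integral_lborel_sub[OF E' chart_tube_integrand_borel(1)[OF f]])
  then have "(\<lambda>u. ?F u * indicator A u) \<in> borel_measurable borel" using A(1) by measurable
  moreover have "(\<lambda>u. ?F u * indicator A u) = (\<lambda>u. ennreal (jac u) * fibre_integral f (\<psi> u) * indicator A u)"
    using fibre_integral_chart[OF f] by (auto simp: fun_eq_iff indicator_def)
  ultimately show ?thesis by simp
qed

theorem nn_integral_tube_over_chart:
  assumes f: "f \<in> borel_measurable borel"
  shows "(\<integral>\<^sup>+x. f x * indicator (tube_over (\<psi> ` A)) x \<partial>lborel)
    = (\<integral>\<^sup>+u. ennreal (jac u) * fibre_integral f (\<psi> u) * indicator A u \<partial>lborel_sub E)"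
proof -
  let ?h = "\<lambda>w. f (\<Phi> w) * ennreal \<bar>det (matrix (L w))\<bar> * indicator chart_tube w"
  have "(\<integral>\<^sup>+x. f x * indicator (tube_over (\<psi> ` A)) x \<partial>lborel) = (\<integral>\<^sup>+x. f x * indicator (\<Phi> ` chart_tube) x \<partial>lborel)"
    by (simp add: image_\<Phi>)
  also have "\<dots> = (\<integral>\<^sup>+w. ?h w \<partial>lborel)"
  proof (rule nn_integral_change_of_variables[OF chart_tube_borel _ inj_on_\<Phi> _ chart_tube_integrand_borel(2)[OF f] f])
    show "(\<Phi> has_derivative L w) (at w within chart_tube)" if "w \<in> chart_tube" for w
      using that A(2) by (intro has_derivative_at_withinI[OF has_derivative_\<Phi>]) (auto simp: chart_tube_def)
    show "\<Phi> ` chart_tube \<in> sets borel" unfolding image_\<Phi> by (intro tube_over_borel image_chart_borel)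
  qed
  also have "\<dots> = (\<integral>\<^sup>+u. (\<integral>\<^sup>+b. ?h (u + b) \<partial>lborel_sub (orthogonal_comp E)) \<partial>lborel_sub E)"
    by (rule nn_integral_lborel_split[OF E chart_tube_integrand_borel(1)[OF f]])
  also have "\<dots> = (\<integral>\<^sup>+u. ennreal (jac u) * fibre_integral f (\<psi> u) * indicator A u \<partial>lborel_sub E)"
  proof (rule nn_integral_cong_AE)
    show "AE u in lborel_sub E. (\<integral>\<^sup>+b. ?h (u + b) \<partial>lborel_sub (orthogonal_comp E))
        = ennreal (jac u) * fibre_integral f (\<psi> u) * indicator A u"
      using AE_lborel_sub[OF E]
    proof eventually_elim
      fix u assume u: "u \<in> E"
      show "(\<integral>\<^sup>+b. ?h (u + b) \<partial>lborel_sub (orthogonal_comp E)) = ennreal (jac u) * fibre_integral f (\<psi> u) * indicator A u"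
      proof (cases "u \<in> A")
        case True then show ?thesis using fibre_integral_chart[OF f True] by simp
      next
        case False
        have "(\<integral>\<^sup>+b. ?h (u + b) \<partial>lborel_sub (orthogonal_comp E)) = (\<integral>\<^sup>+b. 0 \<partial>lborel_sub (orthogonal_comp E))"
        proof (rule nn_integral_cong_AE)
          show "AE b in lborel_sub (orthogonal_comp E). ?h (u + b) = 0"
            using AE_lborel_sub[OF E']
            by eventually_elim (use False in \<open>simp add: chart_tube_def \<pi>_sum[OF u]\<close>)
        qed
        then show ?thesis using False by simp
      qed
    qed
  qed
  finally show ?thesis .
qed

text \<open>The product with \<open>jac\<close> is Borel as a parameter integral; \<open>jac\<close>
  is continuous and positive, so it can be divided out, and the continuous inverse chart carries the
  result to \<open>M\<close>.\<close>

lemma fibre_integral_image_borel: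
  assumes f: "f \<in> borel_measurable borel"
  shows "(\<lambda>y. fibre_integral f y * indicator (\<psi> ` A) y) \<in> borel_measurable borel"
proof -
  have cj: "continuous_on W (\<lambda>u. inverse (jac u))"
    unfolding gram_det_def det_indexed_def
    by (intro continuous_intros cont_D) (use gram_D_pos in \<open>force simp: gram_det_def det_indexed_def\<close>)
  have "continuous_on A (\<lambda>u. inverse (jac u))" using A(2) by (intro continuous_on_subset[OF cj]) auto
  then have "(\<lambda>u. if u \<in> A then inverse (jac u) else 0) \<in> borel_measurable borel"
    by (rule borel_measurable_continuous_on_if[OF A(1)]) simp
  then have "(\<lambda>u. ennreal (jac u) * fibre_integral f (\<psi> u) * indicator A u * ennreal (if u \<in> A then inverse (jac u) else 0))
      \<in> borel_measurable borel"
    using fibre_integral_chart_borel[OF f] by measurable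
  also have "(\<lambda>u. ennreal (jac u) * fibre_integral f (\<psi> u) * indicator A u * ennreal (if u \<in> A then inverse (jac u) else 0))
      = (\<lambda>u. fibre_integral f (\<psi> u) * indicator A u)"
  proof
    fix u
    have "ennreal (jac u) * ennreal (inverse (jac u)) = 1" if "u \<in> A"
    proof -
      have "jac u > 0" using gram_D_pos[of u] that A(2) by auto
      then show ?thesis by (simp flip: ennreal_mult)
    qed
    then show "ennreal (jac u) * fibre_integral f (\<psi> u) * indicator A u * ennreal (if u \<in> A then inverse (jac u) else 0)
      = fibre_integral f (\<psi> u) * indicator A u"
      by (cases "u \<in> A") (simp_all add: mult.commute mult.left_commute)
  qed
  finally have 1: "(\<lambda>u. fibre_integral f (\<psi> u) * indicator A u) \<in> borel_measurable borel" .
  have B: "\<psi> ` A \<in> sets borel" by (rule image_chart_borel)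
  have "continuous_on (\<psi> ` A) \<psi>i" using A(2) by (intro continuous_on_subset[OF cont_\<psi>i]) auto
  then have "(\<lambda>y. if y \<in> \<psi> ` A then \<psi>i y else 0) \<in> borel_measurable borel"
    by (rule borel_measurable_continuous_on_if[OF B]) simp
  from measurable_compose[OF this 1]
  have "(\<lambda>y. fibre_integral f (\<psi> (if y \<in> \<psi> ` A then \<psi>i y else 0)) * indicator A (if y \<in> \<psi> ` A then \<psi>i y else 0) * indicator (\<psi> ` A) y)
    \<in> borel_measurable borel"
    using B by measurable
  also have "(\<lambda>y. fibre_integral f (\<psi> (if y \<in> \<psi> ` A then \<psi>i y else 0)) * indicator A (if y \<in> \<psi> ` A then \<psi>i y else 0) * indicator (\<psi> ` A) y)
    = (\<lambda>y. fibre_integral f y * indicator (\<psi> ` A) y)"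
  proof
    fix y
    show "fibre_integral f (\<psi> (if y \<in> \<psi> ` A then \<psi>i y else 0)) * indicator A (if y \<in> \<psi> ` A then \<psi>i y else 0) * indicator (\<psi> ` A) y
      = fibre_integral f y * indicator (\<psi> ` A) y"
    proof (cases "y \<in> \<psi> ` A")
      case True
      then obtain u where "u \<in> A" "y = \<psi> u" by blast
      then show ?thesis using A(2) True by (auto simp: subset_iff)
    qed simp
  qed
  finally show ?thesis .
qed

end

end

section \<open>The Riemannian volume\<close>

context tube_radius
begin

lemma tube_chart_exists:
  assumes "slice_chart M E W \<psi>"
  obtains D D2 Di Di2 where "tube_chart M t0 d r E W \<psi> D D2 Di Di2"
  using slice_chart_derivatives[OF assms] tube_radius_axioms by (auto simp: tube_chart_def)

lemma borel_M: "M \<in> sets borel"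
  by (rule borel_closed[OF closed])

lemma normal_jacobian_borel_rep:
  assumes y: "y \<in> M"
  shows "\<exists>J \<in> borel_measurable borel. \<forall>v\<in>N y. J v = normal_jacobian M y v"
proof -
  obtain E W \<psi> D D2 Di Di2 u where c: "chart M E W \<psi> D D2 Di Di2" "dim E = d" "u \<in> W" "u \<in> E" "\<psi> u = y"
    by (rule chart_at[OF y])
  have "tube_chart M t0 d r E W \<psi> D D2 Di Di2" by (intro tube_chart.intro tube_radius_axioms c(1))
  from tube_chart.normal_jacobian_borel[OF this c(3,4)] show ?thesis by (simp add: c(5))
qed

lemma slice_chart_image_borel:
  assumes c: "slice_chart M E W \<psi>" and A: "A \<in> sets borel" "A \<subseteq> W \<inter> E"
  shows "\<psi> ` A \<in> sets borel" "\<psi> ` A \<subseteq> M"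
proof -
  obtain D D2 Di Di2 where "tube_chart M t0 d r E W \<psi> D D2 Di Di2" by (rule tube_chart_exists[OF c])
  from tube_chart.image_chart_borel[OF this A] show "\<psi> ` A \<in> sets borel" .
  show "\<psi> ` A \<subseteq> M" using c A(2) unfolding slice_chart_def by blast
qed

lemma fibre_integral_borel_chart:
  assumes c: "slice_chart M E W \<psi>" and A: "A \<in> sets borel" "A \<subseteq> W \<inter> E" and f: "f \<in> borel_measurable borel"
  shows "(\<lambda>y. fibre_integral f y * indicator (\<psi> ` A) y) \<in> borel_measurable borel"
proof -
  obtain D D2 Di Di2 where "tube_chart M t0 d r E W \<psi> D D2 Di Di2" by (rule tube_chart_exists[OF c])
  from tube_chart.fibre_integral_image_borel[OF this A f] show ?thesis .
qed

abbreviation "chart_jac E \<psi> u \<equiv> ennreal (sqrt (gram_det E (frechet_derivative \<psi> (at u))))"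

lemma nn_integral_tube_over_slice_chart:
  assumes c: "slice_chart M E W \<psi>" and A: "A \<in> sets borel" "A \<subseteq> W \<inter> E" and f: "f \<in> borel_measurable borel"
  shows "(\<integral>\<^sup>+x. f x * indicator (tube_over (\<psi> ` A)) x \<partial>lborel)
    = (\<integral>\<^sup>+u. chart_jac E \<psi> u * fibre_integral f (\<psi> u) * indicator A u \<partial>lborel_sub E)"
proof -
  obtain D D2 Di Di2 where t: "tube_chart M t0 d r E W \<psi> D D2 Di Di2" by (rule tube_chart_exists[OF c])
  interpret tube_chart M t0 d r E W \<psi> D D2 Di Di2 by (rule t)
  have "frechet_derivative \<psi> (at u) = D u" if "u \<in> A" for u
    using D[of u] that A(2) by (intro frechet_derivative_at[symmetric]) auto
  then have "ennreal (sqrt (gram_det E (D u))) * fibre_integral f (\<psi> u) * indicator A u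
      = chart_jac E \<psi> u * fibre_integral f (\<psi> u) * indicator A u" for u
    by (cases "u \<in> A") auto
  then show ?thesis unfolding nn_integral_tube_over_chart[OF A f] by simp
qed

text \<open>By compactness finitely many chart ranges cover \<open>M\<close>, and a Borel set is cut
  along them into disjoint pieces, each the image of a Borel subset of one slice. Statements about
  Borel subsets of \<open>M\<close> thus reduce to one chart and finite additivity.\<close>

lemma chart_induct:
  assumes base: "\<And>E W \<psi> A. slice_chart M E W \<psi> \<Longrightarrow> A \<in> sets borel \<Longrightarrow> A \<subseteq> W \<inter> E \<Longrightarrow> P (\<psi> ` A)"
    and un: "\<And>B C. B \<in> sets borel \<Longrightarrow> C \<in> sets borel \<Longrightarrow> B \<subseteq> M \<Longrightarrow> C \<subseteq> M \<Longrightarrow> B \<inter> C = {} \<Longrightarrow>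
      P B \<Longrightarrow> P C \<Longrightarrow> P (B \<union> C)"
    and B: "B \<in> sets borel" "B \<subseteq> M"
  shows "P B"
proof -
  define U where "U = {V. \<exists>E W \<psi>. slice_chart M E W \<psi> \<and> V = \<psi> ` W}"
  have op: "open V" if "V \<in> U" for V using that by (auto simp: U_def slice_chart_def)
  have "M \<subseteq> \<Union>U"
  proof
    fix y assume "y \<in> M"
    then obtain E W \<psi> where "slice_chart M E W \<psi>" "y \<in> \<psi> ` W"
      using submanifold unfolding C2_submanifold_def by blast
    then show "y \<in> \<Union>U" unfolding U_def by blast
  qed
  then obtain U' where U': "U' \<subseteq> U" "finite U'" "M \<subseteq> \<Union>U'"
    using compactE[OF compact _ op] by metis
  have "\<forall>B. B \<in> sets borel \<longrightarrow> B \<subseteq> M \<inter> \<Union>U' \<longrightarrow> P B"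
    using U'(2,1)
  proof (induction U' rule: finite_induct)
    case empty
    \<comment> \<open>The empty set is the image of the empty subset of any chart, and a chart
      exists because \<open>M\<close> is nonempty.\<close>
    obtain y where "y \<in> M" using nonempty by blast
    then obtain E W \<psi> where "slice_chart M E W \<psi>"
      using submanifold unfolding C2_submanifold_def by blast
    from base[OF this, of "{}"] have "P {}" by simp
    then show ?case by auto
  next
    case (insert V U')
    show ?case
    proof (intro allI impI)
      fix B assume B: "B \<in> sets borel" "B \<subseteq> M \<inter> \<Union>(insert V U')"
      obtain E W \<psi> where c: "slice_chart M E W \<psi>" "V = \<psi> ` W" using insert.prems by (auto simp: U_def)
      have oV: "open V" using op insert.prems by simp
      obtain D D2 Di Di2 where t: "tube_chart M t0 d r E W \<psi> D D2 Di Di2" by (rule tube_chart_exists[OF c(1)])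
      interpret c: tube_chart M t0 d r E W \<psi> D D2 Di Di2 by (rule t)
      let ?A = "{u \<in> W. \<psi> u \<in> B} \<inter> E"
      have A: "?A \<in> sets borel" "?A \<subseteq> W \<inter> E"
        using borel_vimage_continuous_on[OF c.cont_\<psi> borel_open[OF c.openW] B(1)]
          borel_closed[OF closed_subspace[OF c.E]] by auto
      have "\<psi> ` ?A = B \<inter> V"
      proof -
        have "y \<in> \<psi> ` ?A" if "y \<in> B" "y \<in> V" for y
        proof -
          have "y \<in> \<psi> ` (W \<inter> E)" unfolding c.slice using that B(2) c(2) by blast
          then show ?thesis using that by blast
        qed
        then show ?thesis using c(2) by blast
      qed
      then have 1: "P (B \<inter> V)" using base[OF c(1) A] by simp
      have IH: "\<forall>B. B \<in> sets borel \<longrightarrow> B \<subseteq> M \<inter> \<Union>U' \<longrightarrow> P B"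
        using insert.IH insert.prems by simp
      have 2: "P (B - V)" using B oV by (intro IH[rule_format] sets.Diff) auto
      have "P ((B \<inter> V) \<union> (B - V))"
        using B oV by (intro un 1 2) auto
      moreover have "(B \<inter> V) \<union> (B - V) = B" by blast
      ultimately show "P B" by simp
    qed
  qed
  then show ?thesis using B U'(3) by blast
qed

lemma indicator_disjoint_union: "B \<inter> C = {} \<Longrightarrow> (indicator (B \<union> C) x :: ennreal) = indicator B x + indicator C x"
  by (auto simp: indicator_def)

lemma fibre_integral_borel:
  assumes f: "f \<in> borel_measurable borel" and B: "B \<in> sets borel" "B \<subseteq> M"
  shows "(\<lambda>y. fibre_integral f y * indicator B y) \<in> borel_measurable borel"
proof (induction rule: chart_induct[OF _ _ B])
  case (1 E W \<psi> A)
  then show ?case by (intro fibre_integral_borel_chart f)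
next
  case (2 B C)
  then have "(\<lambda>y. fibre_integral f y * indicator B y + fibre_integral f y * indicator C y) \<in> borel_measurable borel"
    by (intro borel_measurable_add)
  then show ?case by (simp add: indicator_disjoint_union[OF 2(5)] distrib_left)
qed

lemma fibre_integral_const_on_fibre:
  assumes y: "y \<in> M" and f: "\<And>v. v \<in> N y \<Longrightarrow> norm v < r \<Longrightarrow> f (y + v) = c"
  shows "fibre_integral f y = c * fibre_integral (\<lambda>_. 1) y"
proof -
  obtain J where J: "J \<in> borel_measurable borel" "\<forall>v\<in>N y. J v = normal_jacobian M y v"
    using normal_jacobian_borel_rep[OF y] by blast
  have [measurable]: "ball (0::real^'n) r \<in> sets borel" by simp
  note [measurable] = J(1)
  have ae: "AE v in lborel_sub (N y). v \<in> N y" by (rule AE_lborel_sub[OF subspace_N[OF y]])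
  have "fibre_integral f y = (\<integral>\<^sup>+v. c * (ennreal (J v) * indicator (ball 0 r) v) \<partial>lborel_sub (N y))"
    unfolding fibre_integral_def using ae J(2) f
    by (intro nn_integral_cong_AE) (auto elim!: eventually_mono simp: indicator_def)
  also have "\<dots> = c * (\<integral>\<^sup>+v. ennreal (J v) * indicator (ball 0 r) v \<partial>lborel_sub (N y))"
    by (rule nn_integral_cmult) measurable
  also have "(\<integral>\<^sup>+v. ennreal (J v) * indicator (ball 0 r) v \<partial>lborel_sub (N y)) = fibre_integral (\<lambda>_. 1) y"
    unfolding fibre_integral_def using ae J(2)
    by (intro nn_integral_cong_AE) (auto elim!: eventually_mono simp: indicator_def)
  finally show ?thesis .
qed

text \<open>Positive because the Jacobian is positive on a ball of positive measure, finite because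
  it is at most \<open>2 ^ d\<close> there; both matter for dividing by the mass of a fibre.\<close>

lemma fibre_integral_one_pos_finite:
  assumes y: "y \<in> M"
  shows "0 < fibre_integral (\<lambda>_. 1) y" "fibre_integral (\<lambda>_. 1) y < \<infinity>"
proof -
  obtain J where J: "J \<in> borel_measurable borel" "\<forall>v\<in>N y. J v = normal_jacobian M y v"
    using normal_jacobian_borel_rep[OF y] by blast
  have [measurable]: "ball (0::real^'n) r \<in> sets borel" by simp
  note [measurable] = J(1)
  have ae: "AE v in lborel_sub (N y). v \<in> N y" by (rule AE_lborel_sub[OF subspace_N[OF y]])
  have eq: "fibre_integral (\<lambda>_. 1) y = (\<integral>\<^sup>+v. ennreal (J v) * indicator (ball 0 r) v \<partial>lborel_sub (N y))"
    unfolding fibre_integral_def using ae J(2)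
    by (intro nn_integral_cong_AE) (auto elim!: eventually_mono simp: indicator_def)
  show "0 < fibre_integral (\<lambda>_. 1) y"
  proof (rule ccontr)
    assume "\<not> 0 < fibre_integral (\<lambda>_. 1) y"
    then have "(\<integral>\<^sup>+v. ennreal (J v) * indicator (ball 0 r) v \<partial>lborel_sub (N y)) = 0" by (simp add: eq)
    then have "AE v in lborel_sub (N y). ennreal (J v) * indicator (ball 0 r) v = 0"
      by (subst (asm) nn_integral_0_iff_AE) simp_all
    with ae have "AE v in lborel_sub (N y). v \<notin> ball 0 r"
    proof eventually_elim
      fix v assume v: "v \<in> N y" "ennreal (J v) * indicator (ball 0 r) v = 0"
      show "v \<notin> ball 0 r"
      proof
        assume b: "v \<in> ball 0 r"
        then have "J v > 0" using normal_jacobian_pos[OF y v(1)] J(2) v(1) r by simp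
        then show False using v(2) b by simp
      qed
    qed
    moreover have "{v \<in> space (lborel_sub (N y)). \<not> v \<notin> ball 0 r} = ball 0 r" by auto
    moreover have "ball (0::real^'n) r \<in> sets (lborel_sub (N y))" by simp
    ultimately have "emeasure (lborel_sub (N y)) (ball 0 r) = 0"
      using AE_iff_measurable[of "ball 0 r" "lborel_sub (N y)" "\<lambda>v. v \<notin> ball 0 r"] by blast
    then show False using emeasure_lborel_sub_ball_pos[OF subspace_N[OF y] r(1)] by simp
  qed
  have "(\<integral>\<^sup>+v. ennreal (J v) * indicator (ball 0 r) v \<partial>lborel_sub (N y))
      \<le> (\<integral>\<^sup>+v. ennreal (2 ^ d) * indicator (ball 0 r) v \<partial>lborel_sub (N y))"
  proof (rule nn_integral_mono_AE)
    show "AE v in lborel_sub (N y). ennreal (J v) * indicator (ball 0 r) v \<le> ennreal (2 ^ d) * indicator (ball 0 r) v"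
      using ae
    proof eventually_elim
      fix v assume v: "v \<in> N y"
      show "ennreal (J v) * indicator (ball 0 r) v \<le> ennreal (2 ^ d) * indicator (ball 0 r) v"
      proof (cases "v \<in> ball 0 r")
        case True
        then have "norm v / t0 \<le> 1" using r by simp
        then have "(1 + norm v / t0) ^ d \<le> 2 ^ d" using t0 by (intro power_mono) auto
        then have "J v \<le> 2 ^ d" using normal_jacobian_bounds(1)[OF y v] J(2) v by simp
        then show ?thesis by (intro mult_right_mono ennreal_leI) auto
      qed simp
    qed
  qed
  also have "\<dots> = ennreal (2 ^ d) * emeasure (lborel_sub (N y)) (ball 0 r)"
    by (simp add: nn_integral_cmult)
  also have "\<dots> < \<infinity>"
    using emeasure_lborel_sub_ball_finite[OF subspace_N[OF y], of r] by (simp add: ennreal_mult_less_top)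
  finally show "fibre_integral (\<lambda>_. 1) y < \<infinity>" by (simp add: eq)
qed

text \<open>Dividing Lebesgue measure on the tube by the mass of the fibres and pushing it forward along
  the nearest point projection yields the Riemannian volume.\<close>

definition nearest_tube :: "real^'n \<Rightarrow> real^'n" where
  "nearest_tube x = (if x \<in> tube M r then nearest x else nearest 0)"

definition fibre_weight :: "real^'n \<Rightarrow> ennreal" where
  "fibre_weight x = inverse (fibre_integral (\<lambda>_. 1) (nearest_tube x)) * indicator (tube M r) x"

definition tube_volume :: "(real^'n) measure" where
  "tube_volume = distr (density lborel fibre_weight) (restrict_space borel M) nearest_tube"

text \<open>The default \<open>nearest 0\<close> off the tube keeps the values in \<open>M\<close>,
  the space of the push-forward; \<open>fibre_weight\<close> vanishes there.\<close>

lemma nearest_tube_mem: "nearest_tube x \<in> M"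
  by (simp add: nearest_tube_def nearest_mem)

lemma nearest_tube_borel: "nearest_tube \<in> borel_measurable borel"
  unfolding nearest_tube_def[abs_def]
  by (rule borel_measurable_continuous_on_if[OF borel_open[OF open_tube] continuous_on_nearest_tube]) simp

lemma borel_compose_nearest_tube:
  fixes F :: "real^'n \<Rightarrow> ennreal"
  assumes "(\<lambda>y. F y * indicator M y) \<in> borel_measurable borel"
  shows "(\<lambda>x. F (nearest_tube x)) \<in> borel_measurable borel"
  using measurable_compose[OF nearest_tube_borel assms] nearest_tube_mem by simp

lemma fibre_weight_borel: "fibre_weight \<in> borel_measurable borel"
proof -
  have "(\<lambda>x. fibre_integral (\<lambda>_. 1) (nearest_tube x)) \<in> borel_measurable borel"
    by (intro borel_compose_nearest_tube[of "fibre_integral (\<lambda>_. 1)"] fibre_integral_borel borel_M) auto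
  then show ?thesis unfolding fibre_weight_def[abs_def] using borel_open[OF open_tube] by measurable
qed

section \<open>Integration against the push-forward measure\<close>

lemma sets_tube_volume: "sets tube_volume = sets (restrict_space borel M)"
  and space_tube_volume: "space tube_volume = M"
  by (simp_all add: tube_volume_def space_restrict_space)

lemma borel_measurable_tube_volume_iff:
  fixes F :: "real^'n \<Rightarrow> ennreal"
  shows "F \<in> borel_measurable tube_volume \<longleftrightarrow> (\<lambda>y. F y * indicator M y) \<in> borel_measurable borel"
proof -
  have "F \<in> borel_measurable tube_volume \<longleftrightarrow> F \<in> borel_measurable (restrict_space borel M)"
    by (rule measurable_cong_sets[OF sets_tube_volume refl, THEN arg_cong[where f="\<lambda>A. F \<in> A"]])
  then show ?thesis
    using borel_measurable_restrict_space_iff_ennreal[of M borel F] borel_M by simp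
qed

lemma nn_integral_tube_volume:
  fixes F :: "real^'n \<Rightarrow> ennreal"
  assumes F: "(\<lambda>y. F y * indicator M y) \<in> borel_measurable borel"
  shows "(\<integral>\<^sup>+y. F y \<partial>tube_volume) = (\<integral>\<^sup>+x. fibre_weight x * F (nearest_tube x) \<partial>lborel)"
proof -
  have m: "nearest_tube \<in> measurable (density lborel fibre_weight) (restrict_space borel M)"
    using nearest_tube_borel nearest_tube_mem by (intro measurable_restrict_space2) auto
  have Fm: "F \<in> borel_measurable (restrict_space borel M)"
    using borel_measurable_restrict_space_iff_ennreal[of M borel F] borel_M F by simp
  have "(\<integral>\<^sup>+y. F y \<partial>tube_volume) = (\<integral>\<^sup>+x. F (nearest_tube x) \<partial>density lborel fibre_weight)"
    unfolding tube_volume_def by (subst nn_integral_distr[OF m]) (simp_all add: Fm)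
  also have "\<dots> = (\<integral>\<^sup>+x. fibre_weight x * F (nearest_tube x) \<partial>lborel)"
    using fibre_weight_borel borel_compose_nearest_tube[OF F] by (intro nn_integral_density) auto
  finally show ?thesis .
qed

lemma nn_integral_tube_volume_chart:
  fixes F :: "real^'n \<Rightarrow> ennreal"
  assumes c: "slice_chart M E W \<psi>" and A: "A \<in> sets borel" "A \<subseteq> W \<inter> E"
    and F: "(\<lambda>y. F y * indicator M y) \<in> borel_measurable borel"
  shows "(\<integral>\<^sup>+y. F y * indicator (\<psi> ` A) y \<partial>tube_volume) = (\<integral>\<^sup>+u. chart_jac E \<psi> u * F (\<psi> u) * indicator A u \<partial>lborel_sub E)"
proof -
  let ?B = "\<psi> ` A" and ?f = "\<lambda>x. fibre_weight x * F (nearest_tube x)"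
  have B: "?B \<in> sets borel" "?B \<subseteq> M" by (rule slice_chart_image_borel[OF c A])+
  have fm: "?f \<in> borel_measurable borel"
    using fibre_weight_borel borel_compose_nearest_tube[OF F] by measurable
  have "(\<lambda>y. (F y * indicator M y) * indicator ?B y) \<in> borel_measurable borel" using F B(1) by measurable
  also have "(\<lambda>y. (F y * indicator M y) * indicator ?B y) = (\<lambda>y. F y * indicator ?B y * indicator M y)"
    by (simp add: mult_ac)
  finally have "(\<integral>\<^sup>+y. F y * indicator ?B y \<partial>tube_volume) = (\<integral>\<^sup>+x. fibre_weight x * (F (nearest_tube x) * indicator ?B (nearest_tube x)) \<partial>lborel)"
    by (rule nn_integral_tube_volume)
  also have "\<dots> = (\<integral>\<^sup>+x. ?f x * indicator (tube_over ?B) x \<partial>lborel)"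
    by (intro nn_integral_cong) (auto simp: fibre_weight_def tube_over_def nearest_tube_def indicator_def)
  also have "\<dots> = (\<integral>\<^sup>+u. chart_jac E \<psi> u * fibre_integral ?f (\<psi> u) * indicator A u \<partial>lborel_sub E)"
    by (rule nn_integral_tube_over_slice_chart[OF c A fm])
  also have "\<dots> = (\<integral>\<^sup>+u. chart_jac E \<psi> u * F (\<psi> u) * indicator A u \<partial>lborel_sub E)"
  proof (rule nn_integral_cong)
    fix u
    \<comment> \<open>On the fibre over a point of \<open>M\<close> both factors of the integrand
      are constant, so the fibre integral produces the mass of the fibre, which the weight
      cancels.\<close>
    have "fibre_integral ?f (\<psi> u) = F (\<psi> u)" if "u \<in> A"
    proof -
      let ?y = "\<psi> u"
      have y: "?y \<in> M" using B(2) that by blast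
      note k = fibre_integral_one_pos_finite[OF y]
      have "fibre_integral ?f ?y = (inverse (fibre_integral (\<lambda>_. 1) ?y) * F ?y) * fibre_integral (\<lambda>_. 1) ?y"
      proof (rule fibre_integral_const_on_fibre[OF y])
        fix v assume v: "v \<in> N ?y" "norm v < r"
        have "nearest (?y + v) = ?y" "infdist (?y + v) M = norm v"
          using nearest_normal[OF y v(1)] v(2) r by auto
        then show "?f (?y + v) = inverse (fibre_integral (\<lambda>_. 1) ?y) * F ?y"
          using v(2) by (simp add: fibre_weight_def nearest_tube_def tube_def)
      qed
      also have "\<dots> = F ?y * (fibre_integral (\<lambda>_. 1) ?y * inverse (fibre_integral (\<lambda>_. 1) ?y))" by (simp add: mult_ac)
      also have "fibre_integral (\<lambda>_. 1) ?y * inverse (fibre_integral (\<lambda>_. 1) ?y) = 1"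
        unfolding divide_ennreal_def[symmetric] using k by (intro ennreal_divide_self) auto
      finally show ?thesis by simp
    qed
    then show "chart_jac E \<psi> u * fibre_integral ?f (\<psi> u) * indicator A u = chart_jac E \<psi> u * F (\<psi> u) * indicator A u"
      by (cases "u \<in> A") auto
  qed
  finally show ?thesis .
qed

lemma sets_restrict_M: "B \<in> sets (restrict_space borel M) \<longleftrightarrow> B \<in> sets borel \<and> B \<subseteq> M"
  using borel_M by (simp add: sets_restrict_space_iff conj_commute)

lemma emeasure_tube_volume_chart:
  assumes c: "slice_chart M E W \<psi>" and A: "A \<in> sets borel" "A \<subseteq> W \<inter> E"
  shows "emeasure tube_volume (\<psi> ` A) = (\<integral>\<^sup>+u\<in>A. chart_jac E \<psi> u \<partial>lborel_sub E)"
proof -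
  have "\<psi> ` A \<in> sets tube_volume"
    using slice_chart_image_borel[OF c A] by (simp add: sets_tube_volume sets_restrict_M)
  then have "emeasure tube_volume (\<psi> ` A) = (\<integral>\<^sup>+y. 1 * indicator (\<psi> ` A) y \<partial>tube_volume)" by simp
  also have "\<dots> = (\<integral>\<^sup>+u. chart_jac E \<psi> u * 1 * indicator A u \<partial>lborel_sub E)"
    using borel_M by (intro nn_integral_tube_volume_chart[OF c A]) simp
  finally show ?thesis by simp
qed

text \<open>\<open>tube_volume\<close> satisfies the chart condition by the computation above;
  conversely that condition fixes a measure on all Borel subsets by \<open>chart_induct\<close>,
  since measures are additive.\<close>

theorem riemannian_volume_eq: "riemannian_volume M = tube_volume"
  unfolding riemannian_volume_def
proof (rule the_equality)
  show "space tube_volume = M \<and> sets tube_volume = sets (restrict_space borel M) \<and>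
     (\<forall>E W \<psi> A. slice_chart M E W \<psi> \<and> A \<in> sets borel \<and> A \<subseteq> W \<inter> E \<longrightarrow>
        emeasure tube_volume (\<psi> ` A) = (\<integral>\<^sup>+u\<in>A. chart_jac E \<psi> u \<partial>lborel_sub E))"
    using emeasure_tube_volume_chart sets_tube_volume space_tube_volume by blast
next
  fix \<mu> assume \<mu>: "space \<mu> = M \<and> sets \<mu> = sets (restrict_space borel M) \<and>
     (\<forall>E W \<psi> A. slice_chart M E W \<psi> \<and> A \<in> sets borel \<and> A \<subseteq> W \<inter> E \<longrightarrow>
        emeasure \<mu> (\<psi> ` A) = (\<integral>\<^sup>+u\<in>A. chart_jac E \<psi> u \<partial>lborel_sub E))"
  have s\<mu>: "B \<in> sets \<mu> \<longleftrightarrow> B \<in> sets borel \<and> B \<subseteq> M" for B using \<mu> sets_restrict_M by simp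
  have sv: "B \<in> sets tube_volume \<longleftrightarrow> B \<in> sets borel \<and> B \<subseteq> M" for B by (simp add: sets_tube_volume sets_restrict_M)
  show "\<mu> = tube_volume"
  proof (rule measure_eqI)
    show "sets \<mu> = sets tube_volume" using \<mu> sets_tube_volume by simp
    fix B assume "B \<in> sets \<mu>"
    then have B: "B \<in> sets borel" "B \<subseteq> M" using s\<mu> by auto
    show "emeasure \<mu> B = emeasure tube_volume B"
    proof (induction rule: chart_induct[OF _ _ B])
      case (1 E W \<psi> A)
      then show ?case using \<mu> emeasure_tube_volume_chart[OF 1] by simp
    next
      case (2 B C)
      then show ?case
        using plus_emeasure[of B \<mu> C] plus_emeasure[of B tube_volume C] s\<mu> sv by simp
    qed
  qed
qed

text \<open>Over one chart the tube side and the volume side are the same integral over the slice;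
  \<open>chart_induct\<close> adds up the pieces, tubes over disjoint sets being disjoint.\<close>

theorem nn_integral_tube:
  assumes f: "f \<in> borel_measurable borel"
  shows "fibre_integral f \<in> borel_measurable (riemannian_volume M)"
    and "(\<integral>\<^sup>+x\<in>tube M r. f x \<partial>lborel) = (\<integral>\<^sup>+y. fibre_integral f y \<partial>riemannian_volume M)"
proof -
  have FM: "(\<lambda>y. fibre_integral f y * indicator M y) \<in> borel_measurable borel"
    by (rule fibre_integral_borel[OF f borel_M order_refl])
  then show "fibre_integral f \<in> borel_measurable (riemannian_volume M)"
    by (simp add: riemannian_volume_eq borel_measurable_tube_volume_iff)
  have *: "(\<integral>\<^sup>+x. f x * indicator (tube_over B) x \<partial>lborel) = (\<integral>\<^sup>+y. fibre_integral f y * indicator B y \<partial>tube_volume)"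
    if B: "B \<in> sets borel" "B \<subseteq> M" for B
  proof (induction rule: chart_induct[OF _ _ B])
    case (1 E W \<psi> A)
    then show ?case
      using nn_integral_tube_over_slice_chart[OF 1 f] nn_integral_tube_volume_chart[OF 1 FM] by simp
  next
    case (2 B C)
    have disj: "tube_over B \<inter> tube_over C = {}" and un: "tube_over (B \<union> C) = tube_over B \<union> tube_over C"
      using 2(5) by (auto simp: tube_over_def)
    have m: "(\<lambda>y. fibre_integral f y * indicator X y) \<in> borel_measurable tube_volume"
      if X: "X \<in> sets borel" "X \<subseteq> M" for X
    proof -
      have "(\<lambda>y. fibre_integral f y * indicator X y * indicator M y) = (\<lambda>y. fibre_integral f y * indicator X y)"
        using X(2) by (auto simp: fun_eq_iff indicator_def)
      then show ?thesis using fibre_integral_borel[OF f X] by (simp add: borel_measurable_tube_volume_iff)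
    qed
    show ?case
      unfolding un indicator_disjoint_union[OF disj] indicator_disjoint_union[OF 2(5)] distrib_left
      using 2 m f tube_over_borel by (subst (1 2) nn_integral_add) simp_all
  qed
  have "tube_over M = tube M r" using nearest_mem by (auto simp: tube_over_def)
  then have "(\<integral>\<^sup>+x\<in>tube M r. f x \<partial>lborel) = (\<integral>\<^sup>+y. fibre_integral f y * indicator M y \<partial>tube_volume)"
    using *[OF borel_M order_refl] by simp
  also have "\<dots> = (\<integral>\<^sup>+y. fibre_integral f y \<partial>tube_volume)"
    by (intro nn_integral_cong) (simp add: space_tube_volume)
  finally show "(\<integral>\<^sup>+x\<in>tube M r. f x \<partial>lborel) = (\<integral>\<^sup>+y. fibre_integral f y \<partial>riemannian_volume M)"
    by (simp add: riemannian_volume_eq)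
qed

end

section \<open>The remainder\<close>

text \<open>The gradient is a definite description; identifying it with the vector representing
  \<open>g'\<close> throughout \<open>U\<close>, not only at \<open>x\<close>, is what allows it to
  be differentiated.\<close>

lemma gradient_properties:
  fixes g :: "'a::euclidean_space \<Rightarrow> real" and g' :: "'a \<Rightarrow> 'a \<Rightarrow>\<^sub>L real"
  assumes U: "open U" "x \<in> U" and g': "\<And>x. x \<in> U \<Longrightarrow> (g has_derivative blinfun_apply (g' x)) (at x)"
    and g'': "(g' has_derivative g'') (at x)"
  shows gradient_inner: "gradient g x \<bullet> h = blinfun_apply (g' x) h"
    and gradient_derivative: "(gradient g has_derivative hessian g x) (at x)"
proof -
  let ?D = "\<lambda>x. \<Sum>i\<in>Basis. blinfun_apply (g' x) i *\<^sub>R i"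
  have D: "h \<bullet> ?D x = blinfun_apply (g' x) h" for h x
  proof -
    have "h \<bullet> ?D x = (\<Sum>i\<in>Basis. (h \<bullet> i) * blinfun_apply (g' x) i)" by (simp add: inner_sum_right mult.commute)
    also have "\<dots> = blinfun_apply (g' x) (\<Sum>i\<in>Basis. (h \<bullet> i) *\<^sub>R i)" by (simp add: blinfun.sum_right blinfun.scaleR_right)
    finally show ?thesis by (simp add: euclidean_representation)
  qed
  have grad: "gradient g x = ?D x" if "x \<in> U" for x
    unfolding gradient_def
  proof (rule the_equality)
    show "GDERIV g x :> ?D x" using g'[OF that] by (simp add: gderiv_def D)
    fix E assume "GDERIV g x :> E"
    then have "(\<lambda>h. h \<bullet> E) = blinfun_apply (g' x)" using g'[OF that] by (auto simp: gderiv_def dest: has_derivative_unique)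
    then have "h \<bullet> E = h \<bullet> ?D x" for h by (metis D)
    then show "E = ?D x" by (metis inner_commute vector_eq_rdot)
  qed
  show "gradient g x \<bullet> h = blinfun_apply (g' x) h" using grad[OF U(2)] D by (simp add: inner_commute)
  have "(?D has_derivative (\<lambda>h. \<Sum>i\<in>Basis. blinfun_apply (g'' h) i *\<^sub>R i)) (at x)"
    by (intro has_derivative_sum has_derivative_scaleR_left has_derivative_blinfun_apply g'')
  then have "(gradient g has_derivative (\<lambda>h. \<Sum>i\<in>Basis. blinfun_apply (g'' h) i *\<^sub>R i)) (at x)"
    by (rule has_derivative_transform_within_open[OF _ U]) (simp add: grad)
  from this this[THEN frechet_derivative_at]
  show "(gradient g has_derivative hessian g x) (at x)" unfolding hessian_def by simp
qed

text \<open>Restriction to the segment reduces both bounds to one variable: the mean value theorem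
  for the first, Maclaurin's formula of order two for the second.\<close>

lemma taylor_gradient_bounds:
  fixes g :: "'a::euclidean_space \<Rightarrow> real"
  assumes g: "open U" "K \<subseteq> U" "C2_on U g"
    and seg: "\<And>t. 0 \<le> t \<Longrightarrow> t \<le> 1 \<Longrightarrow> y + t *\<^sub>R v \<in> K"
    and G: "\<And>x. x \<in> K \<Longrightarrow> norm (gradient g x) \<le> G" and H: "\<And>x. x \<in> K \<Longrightarrow> onorm (hessian g x) \<le> H"
  shows "\<bar>g (y + v) - g y\<bar> \<le> G * norm v" "\<bar>g (y + v) - g y - gradient g y \<bullet> v\<bar> \<le> H * (norm v)\<^sup>2 / 2"
proof -
  obtain g' g'' where g': "\<forall>x\<in>U. (g has_derivative blinfun_apply (g' x)) (at x)"
      and g'': "\<forall>x\<in>U. (g' has_derivative blinfun_apply (g'' x)) (at x)"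
    using g(3) unfolding C2_on_def C1_on_def by blast
  \<comment> \<open>Maclaurin's formula takes a sequence of derivatives; entries beyond 2 are filled
    with the second derivative.\<close>
  define diff :: "nat \<Rightarrow> real \<Rightarrow> real" where "diff m t =
    (if m = 0 then g (y + t *\<^sub>R v) else if m = 1 then gradient g (y + t *\<^sub>R v) \<bullet> v
     else hessian g (y + t *\<^sub>R v) v \<bullet> v)" for m t
  have diff: "diff 0 = (\<lambda>t. g (y + t *\<^sub>R v))" "diff 1 = (\<lambda>t. gradient g (y + t *\<^sub>R v) \<bullet> v)"
    "diff 2 = (\<lambda>t. hessian g (y + t *\<^sub>R v) v \<bullet> v)"
    by (simp_all add: diff_def fun_eq_iff)
  have inU: "y + t *\<^sub>R v \<in> U" if "0 \<le> t" "t \<le> 1" for t using seg[OF that] g(2) by blast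
  have line: "((\<lambda>s. y + s *\<^sub>R v) has_derivative (\<lambda>s. s *\<^sub>R v)) (at t)" for t
    by (auto intro!: derivative_eq_intros)
  have hess: "(gradient g has_derivative hessian g x) (at x)" and grad: "gradient g x \<bullet> h = blinfun_apply (g' x) h"
    if "x \<in> U" for x h
    using gradient_properties[OF g(1) that, where g = g and g' = g'] g' g'' that by blast+
  have d0: "(diff 0 has_real_derivative diff 1 t) (at t)" if t: "0 \<le> t" "t \<le> 1" for t
  proof -
    have "((\<lambda>s. g (y + s *\<^sub>R v)) has_derivative (\<lambda>s. g' (y + t *\<^sub>R v) (s *\<^sub>R v))) (at t)"
      using diff_chain_at[OF line, of g "blinfun_apply (g' (y + t *\<^sub>R v))"] g' inU[OF t] by (simp add: o_def)
    then show ?thesis unfolding has_field_derivative_def diff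
      by (rule has_derivative_eq_rhs) (auto simp: grad[OF inU[OF t]] blinfun.scaleR_right fun_eq_iff)
  qed
  have d1: "(diff 1 has_real_derivative diff 2 t) (at t)" if t: "0 \<le> t" "t \<le> 1" for t
  proof -
    have l: "linear (hessian g (y + t *\<^sub>R v))" using hess[OF inU[OF t]] has_derivative_linear by blast
    have "((\<lambda>s. gradient g (y + s *\<^sub>R v)) has_derivative (\<lambda>s. hessian g (y + t *\<^sub>R v) (s *\<^sub>R v))) (at t)"
      using diff_chain_at[OF line hess[OF inU[OF t]]] by (simp add: o_def)
    then have "((\<lambda>s. gradient g (y + s *\<^sub>R v) \<bullet> v) has_derivative (\<lambda>s. hessian g (y + t *\<^sub>R v) (s *\<^sub>R v) \<bullet> v)) (at t)"
      by (rule has_derivative_inner_left)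
    then show ?thesis unfolding has_field_derivative_def diff
      by (rule has_derivative_eq_rhs) (simp add: linear_cmul[OF l] fun_eq_iff)
  qed
  have "\<exists>z>0. z < 1 \<and> diff 0 1 - diff 0 0 = (1 - 0) * diff 1 z"
    by (intro MVT2 d0) auto
  then obtain z where z: "0 < z" "z < 1" "g (y + v) - g y = gradient g (y + z *\<^sub>R v) \<bullet> v"
    by (auto simp: diff_def)
  have "\<bar>g (y + v) - g y\<bar> \<le> norm (gradient g (y + z *\<^sub>R v)) * norm v"
    unfolding z(3) by (rule Cauchy_Schwarz_ineq2)
  also have "\<dots> \<le> G * norm v" using z by (intro mult_right_mono G seg) auto
  finally show "\<bar>g (y + v) - g y\<bar> \<le> G * norm v" .
  have "\<exists>t>0. t < 1 \<and> diff 0 1 = (\<Sum>m<2. diff m 0 / fact m * 1 ^ m) + diff 2 t / fact 2 * 1 ^ 2"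
  proof (rule Maclaurin)
    show "\<forall>m t. m < 2 \<and> 0 \<le> t \<and> t \<le> 1 \<longrightarrow> DERIV (diff m) t :> diff (Suc m) t"
    proof (intro allI impI, elim conjE)
      fix m :: nat and t :: real assume "m < 2" "0 \<le> t" "t \<le> 1"
      then show "DERIV (diff m) t :> diff (Suc m) t"
        using d0[of t] d1[of t] by (cases m) (auto simp: numeral_2_eq_2 less_Suc_eq)
    qed
  qed auto
  then obtain t where t: "0 < t" "t < 1" "diff 0 1 = diff 0 0 + diff 1 0 + diff 2 t / 2"
    by (auto simp: numeral_2_eq_2)
  have "g (y + v) - g y - gradient g y \<bullet> v = (hessian g (y + t *\<^sub>R v) v \<bullet> v) / 2"
    using t(3) by (simp add: diff_def)
  moreover have "\<bar>hessian g (y + t *\<^sub>R v) v \<bullet> v\<bar> \<le> H * (norm v)\<^sup>2"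
  proof -
    have K: "y + t *\<^sub>R v \<in> K" using t by (intro seg) auto
    have bl: "bounded_linear (hessian g (y + t *\<^sub>R v))"
      using hess g(2) K has_derivative_bounded_linear by blast
    have "\<bar>hessian g (y + t *\<^sub>R v) v \<bullet> v\<bar> \<le> norm (hessian g (y + t *\<^sub>R v) v) * norm v" by (rule Cauchy_Schwarz_ineq2)
    also have "\<dots> \<le> (onorm (hessian g (y + t *\<^sub>R v)) * norm v) * norm v" by (intro mult_right_mono onorm[OF bl]) auto
    also have "\<dots> \<le> (H * norm v) * norm v" by (intro mult_right_mono H K) auto
    finally show ?thesis by (simp add: power2_eq_square mult.assoc)
  qed
  ultimately show "\<bar>g (y + v) - g y - gradient g y \<bullet> v\<bar> \<le> H * (norm v)\<^sup>2 / 2" by linarith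
qed

theorem lemma1:
  fixes M :: "(real ^ 'n) set"
    and d :: nat
    and \<tau>\<^sub>0 r R\<^sub>0 G H :: real
    and z\<^sub>0 :: "real ^ 'n"
    and K :: "(real ^ 'n) set"
    and g :: "real ^ 'n \<Rightarrow> real"
  assumes d: "1 \<le> d" "d < CARD('n)"
    and M: "compact M" "connected M" "C2_submanifold d M"
    and reach: "\<tau>\<^sub>0 > 0" "reach M \<ge> ereal \<tau>\<^sub>0"
    and R\<^sub>0: "R\<^sub>0 > 0" "M \<subseteq> cball z\<^sub>0 R\<^sub>0"
    and r: "0 < 2 * r" "2 * r < \<tau>\<^sub>0"
    and K: "K = cball z\<^sub>0 (R\<^sub>0 + 3 * r)"
    and g: "\<exists>U. open U \<and> K \<subseteq> U \<and> C2_on U g"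
    and finite_sups: "bdd_above ((\<lambda>x. norm (gradient g x)) ` K)"
      "bdd_above ((\<lambda>x. onorm (hessian g x)) ` K)"
      "bounded (g ` K)"
    and G: "G = (SUP x\<in>K. norm (gradient g x))"
    and H: "H = (SUP x\<in>K. onorm (hessian g x))"
  shows
    "(\<forall>x\<in>tube M r.
        (closest_point M x, x - closest_point M x) \<in> normal_disc_bundle M r \<and>
        (\<exists>!(y, v). (y, v) \<in> normal_disc_bundle M r \<and> x = y + v)) \<and>
     (\<forall>(y, v)\<in>normal_disc_bundle M r. normal_jacobian M y v \<ge> 0) \<and>
     (\<forall>f :: real ^ 'n \<Rightarrow> ennreal. f \<in> borel_measurable borel \<longrightarrow>
        (\<lambda>y. \<integral>\<^sup>+v\<in>normal_space_at M y \<inter> ball 0 r.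
           f (y + v) * ennreal (normal_jacobian M y v) \<partial>lborel_sub (normal_space_at M y))
          \<in> borel_measurable (riemannian_volume M) \<and>
        (\<integral>\<^sup>+x\<in>tube M r. f x \<partial>lborel) =
        (\<integral>\<^sup>+y. (\<integral>\<^sup>+v\<in>normal_space_at M y \<inter> ball 0 r.
           f (y + v) * ennreal (normal_jacobian M y v) \<partial>lborel_sub (normal_space_at M y))
          \<partial>riemannian_volume M)) \<and>
     (\<forall>y\<in>M.
        (\<forall>v\<in>normal_space_at M y. \<forall>w\<in>normal_space_at M y.
           linear_part M g y (v + w) = linear_part M g y v + linear_part M g y w) \<and>
        (\<forall>v\<in>normal_space_at M y. \<forall>c. linear_part M g y (c *\<^sub>R v) = c * linear_part M g y v) \<and>
        (\<forall>v\<in>normal_space_at M y. linear_part M g y (- v) = - linear_part M g y v)) \<and>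
     (\<forall>y\<in>M. \<forall>v\<in>normal_space_at M y. norm v < r \<longrightarrow>
        exp (- (g (y + v) - g y)) * normal_jacobian M y v
          = 1 + linear_part M g y v + remainder M g y v \<and>
        \<bar>remainder M g y v\<bar> \<le> const_A d G H r \<tau>\<^sub>0 * (norm v)\<^sup>2)"
proof -
  \<comment> \<open>The geometric part works with \<open>r < \<tau>\<^sub>0\<close>; the stronger
    bound \<open>2 * r < \<tau>\<^sub>0\<close> is kept for the remainder.\<close>
  note r2 = r
  interpret tube_radius M \<tau>\<^sub>0 d r
    using M reach r by unfold_locales auto
  obtain U where U: "open U" "K \<subseteq> U" "C2_on U g" using g by blast
  have 1: "(nearest x, x - nearest x) \<in> normal_disc_bundle M r \<and>
      (\<exists>!(y, v). (y, v) \<in> normal_disc_bundle M r \<and> x = y + v)" if x: "x \<in> tube M r" for x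
  proof
    have "norm (x - nearest x) < r" using x dist_nearest[of x] by (simp add: tube_def dist_norm)
    then show b: "(nearest x, x - nearest x) \<in> normal_disc_bundle M r"
      using nearest_mem nearest_diff_normal by (simp add: normal_disc_bundle_def)
    show "\<exists>!(y, v). (y, v) \<in> normal_disc_bundle M r \<and> x = y + v"
    proof (rule ex1I[of _ "(nearest x, x - nearest x)"])
      show "case (nearest x, x - nearest x) of (y, v) \<Rightarrow> (y, v) \<in> normal_disc_bundle M r \<and> x = y + v"
        using b by simp
      fix p assume "case p of (y, v) \<Rightarrow> (y, v) \<in> normal_disc_bundle M r \<and> x = y + v"
      then obtain y v where p: "p = (y, v)" "y \<in> M" "v \<in> normal_space_at M y" "norm v < r" "x = y + v"
        by (cases p) (auto simp: normal_disc_bundle_def)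
      then show "p = (nearest x, x - nearest x)"
        using nearest_normal(1)[OF p(2,3)] r by simp
    qed
  qed
  have 2: "normal_jacobian M y v \<ge> 0" if "(y, v) \<in> normal_disc_bundle M r" for y v
    using that normal_jacobian_pos[of y v] r by (auto simp: normal_disc_bundle_def intro: less_imp_le)
  have 3: "(\<lambda>y. \<integral>\<^sup>+v\<in>normal_space_at M y \<inter> ball 0 r.
           f (y + v) * ennreal (normal_jacobian M y v) \<partial>lborel_sub (normal_space_at M y))
          \<in> borel_measurable (riemannian_volume M) \<and>
        (\<integral>\<^sup>+x\<in>tube M r. f x \<partial>lborel) =
        (\<integral>\<^sup>+y. (\<integral>\<^sup>+v\<in>normal_space_at M y \<inter> ball 0 r.
           f (y + v) * ennreal (normal_jacobian M y v) \<partial>lborel_sub (normal_space_at M y))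
          \<partial>riemannian_volume M)" if "f \<in> borel_measurable borel" for f :: "real ^ 'n \<Rightarrow> ennreal"
    using nn_integral_tube[OF that] unfolding fibre_integral_def[abs_def] by blast
  have 4: "linear_part M g y (- v) = - linear_part M g y v" if "y \<in> M" "v \<in> normal_space_at M y" for y v
    using linear_part_linear(2)[OF that, of g "-1"] by simp
  have 5: "\<bar>remainder M g y v\<bar> \<le> const_A d G H r \<tau>\<^sub>0 * (norm v)\<^sup>2"
    if y: "y \<in> M" and v: "v \<in> normal_space_at M y" "norm v < r" for y v
  proof -
    have GK: "norm (gradient g x) \<le> G" and HK: "onorm (hessian g x) \<le> H" if "x \<in> K" for x
      using cSUP_upper[OF that finite_sups(1)] cSUP_upper[OF that finite_sups(2)] by (simp_all add: G H)
    \<comment> \<open>The segment stays within \<open>R\<^sub>0 + r\<close> of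
      \<open>z\<^sub>0\<close>, hence in \<open>K\<close>, where \<open>G\<close> and
      \<open>H\<close> are bounds.\<close>
    have seg: "y + t *\<^sub>R v \<in> K" if t: "0 \<le> t" "t \<le> 1" for t
    proof -
      have "norm (t *\<^sub>R v) \<le> 1 * norm v" using t by (simp add: mult_left_le_one_le)
      then have "dist (y + t *\<^sub>R v) y \<le> r" using v by (simp add: dist_norm)
      moreover have "dist z\<^sub>0 y \<le> R\<^sub>0" using R\<^sub>0 y by auto
      ultimately have "dist z\<^sub>0 (y + t *\<^sub>R v) \<le> R\<^sub>0 + r"
        using dist_triangle[of z\<^sub>0 "y + t *\<^sub>R v" y] by (simp add: dist_commute)
      then show ?thesis using r by (simp add: K)
    qed
    have yK: "y \<in> K" using seg[of 0] by simp
    \<comment> \<open>This yields the sign of \<open>H\<close>, because \<open>onorm\<close> of a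
      bounded linear map is nonnegative.\<close>
    have "bounded_linear (hessian g y)"
    proof -
      obtain g' g'' where "\<forall>x\<in>U. (g has_derivative blinfun_apply (g' x)) (at x)"
        "\<forall>x\<in>U. (g' has_derivative blinfun_apply (g'' x)) (at x)"
        using U(3) unfolding C2_on_def C1_on_def by blast
      then have "(gradient g has_derivative hessian g y) (at y)"
        using yK U(2) by (intro gradient_derivative[OF U(1)]) auto
      then show ?thesis by (rule has_derivative_bounded_linear)
    qed
    then have H0: "H \<ge> 0" using HK[OF yK] onorm_pos_le by force
    have G0: "G \<ge> 0" using GK[OF yK] norm_ge_zero[of "gradient g y"] by linarith
    note tay = taylor_gradient_bounds[OF U seg GK HK]
    \<comment> \<open>The scalar estimate with \<open>a = - (g (y + v) - g y)\<close>,
      \<open>l = gradient g y \<bullet> v\<close> and the trace of the shape operator as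
      \<open>t\<close>.\<close>
    have "\<bar>exp (- (g (y + v) - g y)) * normal_jacobian M y v - 1
        - (- (gradient g y \<bullet> v) - trace_on (tangent_space_at M y) (shape_operator M y v))\<bar>
      \<le> const_A d G H r \<tau>\<^sub>0 * (norm v)\<^sup>2"
    proof (rule remainder_estimate)
      show "norm v / \<tau>\<^sub>0 \<le> 1/2" using v r2 reach(1) by (simp add: field_simps)
      show "\<bar>- (g (y + v) - g y)\<bar> \<le> G * norm v" using tay(1) by simp
      have "- (g (y + v) - g y) + gradient g y \<bullet> v = - (g (y + v) - g y - gradient g y \<bullet> v)" by simp
      then show "\<bar>- (g (y + v) - g y) + gradient g y \<bullet> v\<bar> \<le> H * (norm v)\<^sup>2 / 2" using tay(2) by (simp only: abs_minus)
    qed (use v reach G0 H0 normal_jacobian_bounds[OF y v(1)] in auto)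
    then show ?thesis by (simp add: remainder_def linear_part_def)
  qed
  show ?thesis
    using 1 2 3 4 5 linear_part_linear by (auto simp: remainder_def)
qed

end
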